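(* Let $k\ge3$ be an integer, let $u\in\mathbb{L}^{k,2}$, and let $X_t=\delta(u\mathbf{1}_{[0,t]})$, $t\in[0,1]$, be the associated Skorohod integral process. Then there exists a sequence of processes $(Z^{(r)}_t)_{t\in[0,1]}$, $r\ge1$, such that $Z^{(r)}\in\mathbf{BF}$ for every $r\ge1$ and $$\lim_{r\to\infty}V\left(X-Z^{(r)}\right)=0.$$
   Context: Let $T=[0,1]$ (with Lebesgue measure), let $N=(N_t)_{t\in T}$ be a standard Poisson process on the standard Poisson space $(\Omega,\mathbb{F},\mathbf{P})$, and let $\tilde N_t=N_t-t$. For Borel $B\subseteq T$, $\tilde N(B)$ is the associated compensated random measure. Multiple integrals: $L^2_s(T^n)$ is the space of symmetric elements of $L^2(T^n)$, with $\|\cdot\|_n$ the norm of $L^2(T^n)$, and $L^2_s(T^0)=\mathbb{R}$, $I_0(c)=c$. $I_n$ is the multiple Poisson-Itô integral with respect to $\tilde N$: it is determined by $I_n(\tilde f)=\tilde N(B_1)\cdots\tilde N(B_n)$ when $\tilde f$ is the symmetrization of $\mathbf{1}_{B_1}\otimes\cdots\otimes\mathbf{1}_{B_n}$ with $B_1,\dots,B_n$ disjoint, linearity, and the isometry $\mathbf{E}(I_n(f)I_m(g))=n!\langle f,g\rangle_{L^2(T^n)}\mathbf{1}_{(n=m)}$ for symmetric $f,g$. For $f\in L^2(T^n)$, $I_n(f):=I_n(\tilde f)$ with $\tilde f$ the symmetrization. Every $F\in L^2(\mathbf{P})$ measurable with respect to $\mathbb{F}=\sigma(N)$ (completed) has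 a unique expansion $F=\sum_{n\ge0}I_n(f_n)$, $f_n\in L^2_s(T^n)$. Derivative: $\mathbb{D}^{1,2}=\{F=\sum_n I_n(f_n):\sum_n n\,n!\|f_n\|_n^2<\infty\}$ and $D_tF=\sum_{n\ge1}nI_{n-1}(f_n(\cdot,t))$. For $k\ge2$, $\mathbb{D}^{k,2}$ is the space of $k$ times weakly differentiable variables, with $\|F\|_{k,2}^2=\mathbf{E}F^2+\sum_{l=1}^k\|D^lF\|^2_{L^2(T^l\times\Omega)}$, where $D^l$ is the $l$-th iterated derivative (defined on simple functionals by iteration and extended by closure). $\mathbb{L}^{k,2}=L^2(T;\mathbb{D}^{k,2})$, $k\ge1$. Skorohod integral: for $u\in L^2(T\times\Omega)$, $u_t=\sum_{n\ge0}I_n(f_n(\cdot,t))$ with $f_n$ symmetric in its first $n$ variables, $u\in Dom(\delta)$ when the series $\delta(u)=\sum_{n\ge0}I_{n+1}(\tilde f_n)$ converges in $L^2(\mathbf{P})$, $\tilde f_n$ being the symmetrization of $f_n$ in all $n+1$ variables. If $u\in\mathbb{L}^{1,2}$ then $u\mathbf{1}_{[0,t]}\in Dom(\delta)$ for all $t\in T$. For Borel $A\subseteq T$, $\mathbb{F}_A=\sigma\{\tilde N(h\mathbf{1}_A):h\in L^2(T)\}$, where $\tilde N(h)=\int_0^1h\,d\tilde N$, completed with the $\mathbf{P}$-null sets; $\mathbb{F}_t=\mathbb{F}_{[0,t]}$ and $\mathbb{F}_{t^c}=\mathbb{F}_{[0,t]^c}$ (complement in $T$). $L^2_0(\mathbf{P})$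 is the set of zero-mean square integrable random variables. $\mathbf{BF}$ is the class of stochastic processes that are finite linear combinations of processes of the type $Z_t=\mathbf{E}(H_1\mid\mathbb{F}_t)\times\mathbf{E}(H_2\mid\mathbb{F}_{t^c})$, $t\in T$, with $H_1\in L^2_0(\mathbf{P})$ and $H_2\in L^2(\mathbf{P})$. For a measurable process $X=\{X_t:t\in T\}$ with $\mathbf{E}X_t^2<\infty$ for every $t$, $$V(X)=\sup_\pi\mathbf{E}\sum_{i=0}^{n-1}(X_{t_{i+1}}-X_{t_i})^2,$$ where $\pi$ runs over all partitions $0=t_0<t_1<\dots<t_n=1$ of $T$. *)

theory Defs
  imports "HOL-Probability.Probability"
begin

definition L2 :: "'b measure \<Rightarrow> ('b \<Rightarrow> real) set" where
  "L2 M = {f \<in> borel_measurable M. integrable M (\<lambda>x. (f x)\<^sup>2)}"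

definition L2_tendsto :: "'b measure \<Rightarrow> (nat \<Rightarrow> 'b \<Rightarrow> real) \<Rightarrow> ('b \<Rightarrow> real) \<Rightarrow> bool" where
  "L2_tendsto M S f \<longleftrightarrow> (\<forall>m. S m \<in> L2 M) \<and> f \<in> L2 M \<and>
     (\<lambda>m. \<integral>x. (S m x - f x)\<^sup>2 \<partial>M) \<longlonglongrightarrow> 0"

definition L2_zero_mean :: "'b measure \<Rightarrow> ('b \<Rightarrow> real) set" where
  "L2_zero_mean M = {f \<in> L2 M. (\<integral>x. f x \<partial>M) = 0}"

text \<open>The parameter space $T = [0,1]$ and its powers $T^n$; a point of $T^n$ is a function on
  \<open>{..<n}\<close>, and $T^0$ is a one-point space of mass 1.\<close>

definition TT :: "real measure" where
  "TT = restrict_space lborel {0..1}"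

definition Tn :: "nat \<Rightarrow> (nat \<Rightarrow> real) measure" where
  "Tn n = (\<Pi>\<^sub>M i\<in>{..<n}. TT)"

text \<open>Elements of $L^2(T^n)$ are classes modulo null sets, so symmetry (here in the first \<open>m\<close> of
  the variables) is required up to a null set.\<close>

definition symmetric_in :: "nat \<Rightarrow> nat \<Rightarrow> ((nat \<Rightarrow> real) \<Rightarrow> real) \<Rightarrow> bool" where
  "symmetric_in m n f \<longleftrightarrow> (\<forall>p. p permutes {..<m} \<longrightarrow> (AE x in Tn n. f (x \<circ> p) = f x))"

definition L2_sym :: "nat \<Rightarrow> ((nat \<Rightarrow> real) \<Rightarrow> real) set" where
  "L2_sym n = {f \<in> L2 (Tn n). symmetric_in n n f}"

definition symmetrization :: "nat \<Rightarrow> ((nat \<Rightarrow> real) \<Rightarrow> real) \<Rightarrow> (nat \<Rightarrow> real) \<Rightarrow> real" where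
  "symmetrization n f x = (\<Sum>p\<in>{p. p permutes {..<n}}. f (x \<circ> p)) / fact n"

text \<open>The last assumption says that the underlying $\sigma$-field is the completion of the one
  generated by the process.\<close>

locale standard_poisson_space = prob_space M for M :: "'a measure" +
  fixes N :: "real \<Rightarrow> 'a \<Rightarrow> real"
  assumes start: "AE \<omega> in M. N 0 \<omega> = 0"
    and paths: "AE \<omega> in M. mono_on {0..1} (\<lambda>t. N t \<omega>) \<and>
      (\<forall>t\<in>{0..<1}. continuous (at_right t) (\<lambda>s. N s \<omega>))"
    and increments: "\<And>s t j. 0 \<le> s \<Longrightarrow> s < t \<Longrightarrow> t \<le> 1 \<Longrightarrow>
      prob {\<omega> \<in> space M. N t \<omega> - N s \<omega> = real j} = pmf (poisson_pmf (t - s)) j"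
    and indep_increments: "\<And>n t. 0 \<le> t 0 \<Longrightarrow> (\<And>i. i < n \<Longrightarrow> t i < t (Suc i)) \<Longrightarrow> t n \<le> 1 \<Longrightarrow>
      indep_vars (\<lambda>_. borel) (\<lambda>i \<omega>. N (t (Suc i)) \<omega> - N (t i) \<omega>) {..<n}"
    and generated: "M = completion (restr_to_subalg M
      (sigma (space M) {N t -` B \<inter> space M | t B. t \<in> {0..1} \<and> B \<in> sets borel}))"

text \<open>The random counting measure on $T$: the Stieltjes measure of the path, which is continued
  as a constant outside $[0,1]$.\<close>

definition path_measure :: "(real \<Rightarrow> 'a \<Rightarrow> real) \<Rightarrow> 'a \<Rightarrow> real measure" where
  "path_measure N \<omega> = interval_measure (\<lambda>t. N (max 0 (min 1 t)) \<omega>)"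

definition comp_measure :: "(real \<Rightarrow> 'a \<Rightarrow> real) \<Rightarrow> real set \<Rightarrow> 'a \<Rightarrow> real" where
  "comp_measure N B \<omega> = measure (path_measure N \<omega>) B - measure lborel B"

text \<open>Almost every path has finitely many jumps, so for $h \in L^2(T)$ the integral
  $\int_0^1 h\,d\tilde N$ makes sense path by path.\<close>

definition comp_integral :: "(real \<Rightarrow> 'a \<Rightarrow> real) \<Rightarrow> (real \<Rightarrow> real) \<Rightarrow> 'a \<Rightarrow> real" where
  "comp_integral N h \<omega> = (LINT s:{0..1}|path_measure N \<omega>. h s) - (LINT s:{0..1}|lborel. h s)"

definition sigma_field :: "'a measure \<Rightarrow> (real \<Rightarrow> 'a \<Rightarrow> real) \<Rightarrow> real set \<Rightarrow> 'a measure" where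
  "sigma_field M N A = sigma (space M)
     (null_sets M \<union>
      {comp_integral N (\<lambda>s. h s * indicator A s) -` B \<inter> space M | h B. h \<in> L2 TT \<and> B \<in> sets borel})"

text \<open>\<open>I n f\<close> is a version of $I_n(f)$ for $f \in L^2(T^n)$. By density of the kernels in
  \<open>products\<close>, the assumptions determine \<open>I n f\<close> up to a null set.\<close>

locale multiple_poisson_integral = standard_poisson_space M N
    for M :: "'a measure" and N :: "real \<Rightarrow> 'a \<Rightarrow> real" +
  fixes I :: "nat \<Rightarrow> ((nat \<Rightarrow> real) \<Rightarrow> real) \<Rightarrow> 'a \<Rightarrow> real"
  assumes square_integrable: "\<And>n f. f \<in> L2 (Tn n) \<Longrightarrow> I n f \<in> L2 M"
    and products: "\<And>n B. (\<And>i. i < n \<Longrightarrow> B i \<in> sets borel \<and> B i \<subseteq> {0..1}) \<Longrightarrow>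
      disjoint_family_on B {..<n} \<Longrightarrow>
      AE \<omega> in M. I n (symmetrization n (\<lambda>x. \<Prod>i<n. indicator (B i) (x i))) \<omega> =
        (\<Prod>i<n. comp_measure N (B i) \<omega>)"
    and linear: "\<And>n f g a b. f \<in> L2_sym n \<Longrightarrow> g \<in> L2_sym n \<Longrightarrow>
      AE \<omega> in M. I n (\<lambda>x. a * f x + b * g x) \<omega> = a * I n f \<omega> + b * I n g \<omega>"
    and isometry: "\<And>n m f g. f \<in> L2_sym n \<Longrightarrow> g \<in> L2_sym m \<Longrightarrow>
      (\<integral>\<omega>. I n f \<omega> * I m g \<omega> \<partial>M) = (if n = m then fact n * (\<integral>x. f x * g x \<partial>Tn n) else 0)"
    and symmetrized: "\<And>n f. f \<in> L2 (Tn n) \<Longrightarrow>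
      AE \<omega> in M. I n f \<omega> = I n (symmetrization n f) \<omega>"

text \<open>The kernel $f(\cdot,t)$ on $T^n$ of a kernel $f$ on $T^{n+1}$.\<close>

definition section_at :: "nat \<Rightarrow> ((nat \<Rightarrow> real) \<Rightarrow> real) \<Rightarrow> real \<Rightarrow> (nat \<Rightarrow> real) \<Rightarrow> real" where
  "section_at n f t = (\<lambda>x. f (x(n := t)))"

text \<open>If $F = \sum_n I_n(f_n)$, then $D_tF = \sum_{n \ge 1} n I_{n-1}(f_n(\cdot,t))$, so the
  chaos kernels of $D_tF$ are $(n+1) f_{n+1}(\cdot,t)$. Iteration gives the kernels of
  $D^l_{\tau_0,\dots,\tau_{l-1}}F$.\<close>

definition deriv_kernels ::
  "real \<Rightarrow> (nat \<Rightarrow> (nat \<Rightarrow> real) \<Rightarrow> real) \<Rightarrow> nat \<Rightarrow> (nat \<Rightarrow> real) \<Rightarrow> real" where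
  "deriv_kernels t f = (\<lambda>n x. real (Suc n) * section_at n (f (Suc n)) t x)"

primrec iter_deriv_kernels ::
  "nat \<Rightarrow> (nat \<Rightarrow> real) \<Rightarrow> (nat \<Rightarrow> (nat \<Rightarrow> real) \<Rightarrow> real) \<Rightarrow> nat \<Rightarrow> (nat \<Rightarrow> real) \<Rightarrow> real" where
  "iter_deriv_kernels 0 \<tau> f = f"
| "iter_deriv_kernels (Suc l) \<tau> f = deriv_kernels (\<tau> l) (iter_deriv_kernels l \<tau> f)"

text \<open>A simple functional $F = \sum_{n \le m} I_n(f_n)$, and a jointly measurable version
  \<open>G\<close> of its iterated derivative $D^lF$.\<close>

definition simple_functional ::
  "'a measure \<Rightarrow> (nat \<Rightarrow> ((nat \<Rightarrow> real) \<Rightarrow> real) \<Rightarrow> 'a \<Rightarrow> real) \<Rightarrow> nat \<Rightarrow>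
   (nat \<Rightarrow> (nat \<Rightarrow> real) \<Rightarrow> real) \<Rightarrow> ('a \<Rightarrow> real) \<Rightarrow> bool" where
  "simple_functional M I m f F \<longleftrightarrow>
     (\<forall>n. f n \<in> L2_sym n) \<and> (\<forall>n>m. f n = (\<lambda>_. 0)) \<and>
     F \<in> L2 M \<and> (AE \<omega> in M. F \<omega> = (\<Sum>n\<le>m. I n (f n) \<omega>))"

definition simple_deriv ::
  "'a measure \<Rightarrow> (nat \<Rightarrow> ((nat \<Rightarrow> real) \<Rightarrow> real) \<Rightarrow> 'a \<Rightarrow> real) \<Rightarrow> nat \<Rightarrow>
   (nat \<Rightarrow> (nat \<Rightarrow> real) \<Rightarrow> real) \<Rightarrow> nat \<Rightarrow> ((nat \<Rightarrow> real) \<times> 'a \<Rightarrow> real) \<Rightarrow> bool" where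
  "simple_deriv M I m f l G \<longleftrightarrow>
     G \<in> L2 (Tn l \<Otimes>\<^sub>M M) \<and>
     (AE \<tau> in Tn l. AE \<omega> in M. G (\<tau>, \<omega>) = (\<Sum>n\<le>m. I n (iter_deriv_kernels l \<tau> f n) \<omega>))"

text \<open>\<open>weak_derivs M I k F D\<close>: \<open>F\<close> is \<open>k\<close> times weakly differentiable and \<open>D l\<close> is a version of
  $D^lF$ for $1 \le l \le k$ (closure of the iterated derivatives on simple functionals).\<close>

definition weak_derivs ::
  "'a measure \<Rightarrow> (nat \<Rightarrow> ((nat \<Rightarrow> real) \<Rightarrow> real) \<Rightarrow> 'a \<Rightarrow> real) \<Rightarrow> nat \<Rightarrow> ('a \<Rightarrow> real) \<Rightarrow>
   (nat \<Rightarrow> (nat \<Rightarrow> real) \<times> 'a \<Rightarrow> real) \<Rightarrow> bool" where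
  "weak_derivs M I k F D \<longleftrightarrow>
     (\<exists>m f S G. (\<forall>j. simple_functional M I (m j) (f j) (S j)) \<and>
        (\<forall>j. \<forall>l\<in>{1..k}. simple_deriv M I (m j) (f j) l (G j l)) \<and>
        L2_tendsto M S F \<and>
        (\<forall>l\<in>{1..k}. L2_tendsto (Tn l \<Otimes>\<^sub>M M) (\<lambda>j. G j l) (D l)))"

definition Dk2 ::
  "'a measure \<Rightarrow> (nat \<Rightarrow> ((nat \<Rightarrow> real) \<Rightarrow> real) \<Rightarrow> 'a \<Rightarrow> real) \<Rightarrow> nat \<Rightarrow> ('a \<Rightarrow> real) set" where
  "Dk2 M I k = {F. \<exists>D. weak_derivs M I k F D}"

text \<open>The squared norm $\|F\|_{k,2}^2$. The iterated derivatives being closable, the choice of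
  versions is irrelevant.\<close>

definition Dk2_norm_sq ::
  "'a measure \<Rightarrow> (nat \<Rightarrow> ((nat \<Rightarrow> real) \<Rightarrow> real) \<Rightarrow> 'a \<Rightarrow> real) \<Rightarrow> nat \<Rightarrow> ('a \<Rightarrow> real) \<Rightarrow> real" where
  "Dk2_norm_sq M I k F =
     (let D = (SOME D. weak_derivs M I k F D)
      in (\<integral>\<omega>. (F \<omega>)\<^sup>2 \<partial>M) + (\<Sum>l=1..k. \<integral>z. (D l z)\<^sup>2 \<partial>(Tn l \<Otimes>\<^sub>M M)))"

text \<open>$L^2(T; D^{k,2})$, in terms of jointly measurable representatives. The spaces being
  separable, strong measurability of $t \mapsto u_t \in D^{k,2}$ follows from joint
  measurability.\<close>

definition Lk2 ::
  "'a measure \<Rightarrow> (nat \<Rightarrow> ((nat \<Rightarrow> real) \<Rightarrow> real) \<Rightarrow> 'a \<Rightarrow> real) \<Rightarrow> nat \<Rightarrow> (real \<Rightarrow> 'a \<Rightarrow> real) set" where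
  "Lk2 M I k = {u. case_prod u \<in> borel_measurable (TT \<Otimes>\<^sub>M M) \<and>
     (AE t in TT. u t \<in> Dk2 M I k) \<and>
     (\<integral>\<^sup>+t. ennreal (Dk2_norm_sq M I k (u t)) \<partial>TT) < \<infinity>}"

text \<open>\<open>u\<close> lies in the domain of $\delta$ and \<open>Y\<close> is a version of $\delta(u)$.\<close>

definition has_skorohod_integral ::
  "'a measure \<Rightarrow> (nat \<Rightarrow> ((nat \<Rightarrow> real) \<Rightarrow> real) \<Rightarrow> 'a \<Rightarrow> real) \<Rightarrow>
   (real \<Rightarrow> 'a \<Rightarrow> real) \<Rightarrow> ('a \<Rightarrow> real) \<Rightarrow> bool" where
  "has_skorohod_integral M I u Y \<longleftrightarrow>
     case_prod u \<in> L2 (TT \<Otimes>\<^sub>M M) \<and>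
     (\<exists>f. (\<forall>n. f n \<in> L2 (Tn (Suc n)) \<and> symmetric_in n (Suc n) (f n)) \<and>
        (AE t in TT. L2_tendsto M (\<lambda>m \<omega>. \<Sum>n<m. I n (section_at n (f n) t) \<omega>) (u t)) \<and>
        L2_tendsto M (\<lambda>m \<omega>. \<Sum>n<m. I (Suc n) (symmetrization (Suc n) (f n)) \<omega>) Y)"

text \<open>Conditional expectations are only determined almost surely for each \<open>t\<close>, hence the
  representation is up to modification; \<open>Z\<close> itself is a measurable process.\<close>

definition BF :: "'a measure \<Rightarrow> (real \<Rightarrow> 'a \<Rightarrow> real) \<Rightarrow> (real \<Rightarrow> 'a \<Rightarrow> real) set" where
  "BF M N = {Z. case_prod Z \<in> borel_measurable (TT \<Otimes>\<^sub>M M) \<and>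
     (\<exists>(n::nat) (c :: nat \<Rightarrow> real) H1 H2.
        (\<forall>i<n. H1 i \<in> L2_zero_mean M \<and> H2 i \<in> L2 M) \<and>
        (\<forall>t\<in>{0..1}. AE \<omega> in M. Z t \<omega> =
           (\<Sum>i<n. c i * (real_cond_exp M (sigma_field M N {0..t}) (H1 i) \<omega> *
                       real_cond_exp M (sigma_field M N ({0..1} - {0..t})) (H2 i) \<omega>))))}"

definition unit_partitions :: "(nat \<times> (nat \<Rightarrow> real)) set" where
  "unit_partitions = {(n, t). t 0 = 0 \<and> t n = 1 \<and> (\<forall>i<n. t i < t (Suc i))}"

definition V :: "'a measure \<Rightarrow> (real \<Rightarrow> 'a \<Rightarrow> real) \<Rightarrow> ennreal" where
  "V M X = (SUP (n, t) \<in> unit_partitions.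
     \<integral>\<^sup>+\<omega>. ennreal (\<Sum>i<n. (X (t (Suc i)) \<omega> - X (t i) \<omega>)\<^sup>2) \<partial>M)"

end

(*
  If u_t = sum_n I_n(f_n(.,t)), then X_t - X_s is the sum of the I_{n+1} of the symmetrized kernels
  f_n 1_{(s,t]}(x_n).  By orthogonality, and because symmetrization contracts L^2, its second moment
  is at most sum_n (n+1)! || f_n 1_{(s,t]}(x_n) ||^2.  Summing over a partition gives
  V(X) <= sum_n (n+1)! ||f_n||^2, and this is finite because it is the squared L^{1,2} norm of u
  (one derivative is enough).  Hence it suffices to approximate finitely many kernels in L^2.
  Finite linear combinations of indicators of boxes B_0 x ... x B_n with disjoint sides are dense:
  the rest of an arbitrary box lies near the diagonals.  For such a box
  X_t = N~(B_0) ... N~(B_{n-1}) N~(B_n cap [0,t]).  Splitting every N~(B_i) at t and expanding the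
  product gives a sum of terms E(H_1 | F_t) E(H_2 | F_{t^c}), since past and future are independent
  and E(prod_i N~(B_i) | F_A) = prod_i N~(B_i cap A).
*)
theory Submission
  imports Defs "HOL-Real_Asymp.Real_Asymp"
begin

section \<open>Square integrable functions\<close>

text \<open>Three obstacles shape the proof. (1) The hypothesis on \<open>X\<close> supplies chaos
  kernels separately for each time t. Uniqueness of the expansion identifies them, for almost every
  value of the last variable, with the cuts of the one family that belongs to t = 1; only then is
  the kernel of an increment supported in a strip. (2) \<open>weak_derivs\<close> offers arbitrary
  approximating sequences of simple functionals and \<open>Dk2_norm_sq\<close> an arbitrary choice
  of derivatives, so the lower bound on the norm is proved for finitely many kernels at a time and
  passed to the limit kernel by kernel. The weight (n+1)! is n! + n n!, the contributions of F and
  of DF. (3) The process \<open>N\<close> has a regular path only almost surely, whereas the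
  sigma-fields in \<open>BF\<close> come from pathwise integrals. A corrected path, completeness of
  \<open>M\<close> and right-continuity along dyadic grids reduce them to increments of
  \<open>N\<close>, where independence is available. The requirement that H_1 have mean zero is met
  because the side carrying the time variable is cut at t: it always sits in the factor of the past,
  which is therefore never an empty product.\<close>

abbreviation nsq :: "'b measure \<Rightarrow> ('b \<Rightarrow> real) \<Rightarrow> real" where
  "nsq M f \<equiv> \<integral>x. (f x)\<^sup>2 \<partial>M"

lemma L2D [measurable_dest]: "f \<in> L2 M \<Longrightarrow> f \<in> borel_measurable M"
  and L2_integrable: "f \<in> L2 M \<Longrightarrow> integrable M (\<lambda>x. (f x)\<^sup>2)"
  by (auto simp: L2_def)

lemma L2_mult_integrable:
  assumes "f \<in> L2 M" "g \<in> L2 M"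
  shows "integrable M (\<lambda>x. f x * g x)"
proof (rule Bochner_Integration.integrable_bound)
  show "integrable M (\<lambda>x. (f x)\<^sup>2 + (g x)\<^sup>2)"
    using assms by (intro Bochner_Integration.integrable_add L2_integrable)
  show "(\<lambda>x. f x * g x) \<in> borel_measurable M"
    using assms by measurable
  have "\<bar>a * b\<bar> \<le> a\<^sup>2 + b\<^sup>2" for a b :: real
  proof -
    have "0 \<le> (\<bar>a\<bar> - \<bar>b\<bar>)\<^sup>2" by simp
    then have "2 * \<bar>a * b\<bar> \<le> a\<^sup>2 + b\<^sup>2"
      by (simp add: power2_diff abs_mult)
    then show ?thesis by linarith
  qed
  then show "AE x in M. norm (f x * g x) \<le> norm ((f x)\<^sup>2 + (g x)\<^sup>2)"
    by (intro always_eventually allI) simp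
qed

lemma L2_lincomb:
  assumes "f \<in> L2 M" "g \<in> L2 M"
  shows "(\<lambda>x. a * f x + b * g x) \<in> L2 M"
proof -
  have "integrable M (\<lambda>x. a\<^sup>2 * (f x)\<^sup>2 + (2 * a * b) * (f x * g x) + b\<^sup>2 * (g x)\<^sup>2)"
    using assms by (intro Bochner_Integration.integrable_add Bochner_Integration.integrable_mult_right
      L2_integrable L2_mult_integrable)
  also have "(\<lambda>x. a\<^sup>2 * (f x)\<^sup>2 + (2 * a * b) * (f x * g x) + b\<^sup>2 * (g x)\<^sup>2) =
      (\<lambda>x. (a * f x + b * g x)\<^sup>2)"
    by (auto simp: fun_eq_iff power2_eq_square algebra_simps)
  finally show ?thesis
    using assms unfolding L2_def by auto
qed

lemma L2_zero: "(\<lambda>x. 0) \<in> L2 M"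
  by (simp add: L2_def)

lemma L2_add: "f \<in> L2 M \<Longrightarrow> g \<in> L2 M \<Longrightarrow> (\<lambda>x. f x + g x) \<in> L2 M"
  and L2_diff: "f \<in> L2 M \<Longrightarrow> g \<in> L2 M \<Longrightarrow> (\<lambda>x. f x - g x) \<in> L2 M"
  and L2_scale: "f \<in> L2 M \<Longrightarrow> (\<lambda>x. c * f x) \<in> L2 M"
  using L2_lincomb[of f M g 1 1] L2_lincomb[of f M g 1 "-1"] L2_lincomb[of f M f c 0] by simp_all

lemma L2_sum: "(\<And>i. i \<in> A \<Longrightarrow> f i \<in> L2 M) \<Longrightarrow> (\<lambda>x. \<Sum>i\<in>A. f i x) \<in> L2 M"
  by (induction A rule: infinite_finite_induct) (auto simp: L2_zero intro!: L2_add)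

lemma L2_bound:
  assumes "g \<in> L2 M" "f \<in> borel_measurable M" "AE x in M. \<bar>f x\<bar> \<le> \<bar>g x\<bar>"
  shows "f \<in> L2 M"
proof -
  have "integrable M (\<lambda>x. (f x)\<^sup>2)"
    by (rule Bochner_Integration.integrable_bound[OF L2_integrable[OF assms(1)]])
       (use assms in \<open>auto simp: abs_le_square_iff\<close>)
  then show ?thesis using assms(2) by (simp add: L2_def)
qed

lemma L2_cong_AE:
  assumes "g \<in> L2 M" "f \<in> borel_measurable M" "AE x in M. f x = g x"
  shows "f \<in> L2 M"
  by (rule L2_bound[OF assms(1,2)]) (use assms(3) in auto)

lemma (in finite_measure) L2_imp_integrable: "f \<in> L2 M \<Longrightarrow> integrable M f"
  using L2_mult_integrable[of f M "\<lambda>_. 1"] by (simp add: L2_def)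

lemma nsq_nonneg: "0 \<le> nsq M f"
  by simp

lemma nn_integral_nsq: "f \<in> L2 M \<Longrightarrow> (\<integral>\<^sup>+x. ennreal ((f x)\<^sup>2) \<partial>M) = ennreal (nsq M f)"
  by (intro nn_integral_eq_integral L2_integrable) auto

lemma nsq_lincomb:
  assumes "f \<in> L2 M" "g \<in> L2 M"
  shows "nsq M (\<lambda>x. a * f x + b * g x) =
    a\<^sup>2 * nsq M f + 2 * a * b * (\<integral>x. f x * g x \<partial>M) + b\<^sup>2 * nsq M g"
proof -
  have "nsq M (\<lambda>x. a * f x + b * g x) =
      (\<integral>x. a\<^sup>2 * (f x)\<^sup>2 + (2 * a * b) * (f x * g x) + b\<^sup>2 * (g x)\<^sup>2 \<partial>M)"
    by (intro Bochner_Integration.integral_cong) (auto simp: power2_eq_square algebra_simps)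
  then show ?thesis
    using assms by (simp add: L2_integrable L2_mult_integrable)
qed

lemma nsq_zero_iff:
  assumes "f \<in> L2 M"
  shows "nsq M f = 0 \<longleftrightarrow> (AE x in M. f x = 0)"
  using integral_nonneg_eq_0_iff_AE[OF L2_integrable[OF assms]] by simp

lemma L2_Cauchy_Schwarz:
  assumes "f \<in> L2 M" "g \<in> L2 M"
  shows "(\<integral>x. f x * g x \<partial>M)\<^sup>2 \<le> nsq M f * nsq M g"
proof (cases "nsq M g = 0")
  case True
  then have "AE x in M. f x * g x = 0"
    using nsq_zero_iff[OF assms(2)] by auto
  then have "(\<integral>x. f x * g x \<partial>M) = 0"
    by (rule integral_eq_zero_AE)
  then show ?thesis using True by simp
next
  case False
  then have C: "nsq M g > 0" using nsq_nonneg[of M g] by linarith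
  define A B C where "A = nsq M f" "B = (\<integral>x. f x * g x \<partial>M)" "C = nsq M g"
  \<comment> \<open>This is the squared norm of \<open>C * f - B * g\<close>, which is C times the
    residual of projecting f orthogonally onto g.\<close>
  have "0 \<le> C\<^sup>2 * A + 2 * C * (-B) * B + (-B)\<^sup>2 * C"
    using nsq_lincomb[OF assms, of C "-B"] nsq_nonneg[of M "\<lambda>x. C * f x + -B * g x"]
    unfolding A_B_C_def by simp
  also have "\<dots> = C * (A * C - B\<^sup>2)"
    by (simp add: power2_eq_square algebra_simps)
  finally have "0 \<le> A * C - B\<^sup>2"
    using C by (simp add: A_B_C_def zero_le_mult_iff)
  then show ?thesis by (simp add: A_B_C_def)
qed

text \<open>A triangle inequality for squared norms: it costs a factor 2 and keeps square roots out
  of the later estimates.\<close>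

lemma nsq_add_le:
  assumes "f \<in> L2 M" "g \<in> L2 M"
  shows "nsq M (\<lambda>x. f x + g x) \<le> 2 * nsq M f + 2 * nsq M g"
proof -
  have "nsq M (\<lambda>x. f x + g x) \<le> (\<integral>x. 2 * (f x)\<^sup>2 + 2 * (g x)\<^sup>2 \<partial>M)"
  proof (rule integral_mono)
    show "integrable M (\<lambda>x. (f x + g x)\<^sup>2)"
      by (intro L2_integrable L2_add assms)
    show "integrable M (\<lambda>x. 2 * (f x)\<^sup>2 + 2 * (g x)\<^sup>2)"
      using assms by (simp add: L2_integrable)
    show "(f x + g x)\<^sup>2 \<le> 2 * (f x)\<^sup>2 + 2 * (g x)\<^sup>2" for x
      using sum_squares_bound[of "f x" "g x"] by (simp add: power2_sum)
  qed
  then show ?thesis using assms by (simp add: L2_integrable)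
qed

section \<open>Convergence in L^2\<close>

lemma L2_tendstoD:
  assumes "L2_tendsto M S f"
  shows "S m \<in> L2 M" "f \<in> L2 M" "(\<lambda>m. nsq M (\<lambda>x. S m x - f x)) \<longlonglongrightarrow> 0"
  using assms by (auto simp: L2_tendsto_def)

text \<open>Expanding S_m as f plus the error leaves a cross term, which vanishes in the limit by
  Cauchy-Schwarz.\<close>

lemma L2_tendsto_nsq:
  assumes "L2_tendsto M S f"
  shows "(\<lambda>m. nsq M (S m)) \<longlonglongrightarrow> nsq M f"
proof -
  note S = L2_tendstoD[OF assms]
  let ?d = "\<lambda>m x. S m x - f x"
  have d: "?d m \<in> L2 M" for m by (intro L2_diff S)
  have "nsq M (S m) = nsq M f + 2 * (\<integral>x. f x * ?d m x \<partial>M) + nsq M (?d m)" for m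
    using nsq_lincomb[OF S(2) d[of m], of 1 1] by simp
  moreover have "(\<lambda>m. \<integral>x. f x * ?d m x \<partial>M) \<longlonglongrightarrow> 0"
  proof (rule tendsto_0_le[where K = 1])
    show "(\<lambda>m. sqrt (nsq M f * nsq M (?d m))) \<longlonglongrightarrow> 0"
      using S(3) by (auto intro!: tendsto_eq_intros)
    show "\<forall>\<^sub>F m in sequentially. norm (\<integral>x. f x * ?d m x \<partial>M)
        \<le> norm (sqrt (nsq M f * nsq M (?d m))) * 1"
      using L2_Cauchy_Schwarz[OF S(2) d]
      by (intro always_eventually allI) (auto intro!: real_le_rsqrt)
  qed
  ultimately show ?thesis
    using S(3) by (auto intro!: tendsto_eq_intros)
qed

lemma L2_tendsto_lincomb:
  assumes "L2_tendsto M S f" "L2_tendsto M T g"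
  shows "L2_tendsto M (\<lambda>m x. a * S m x + b * T m x) (\<lambda>x. a * f x + b * g x)"
proof -
  note S = L2_tendstoD[OF assms(1)]
  note T = L2_tendstoD[OF assms(2)]
  have "(\<lambda>m. nsq M (\<lambda>x. (a * S m x + b * T m x) - (a * f x + b * g x))) \<longlonglongrightarrow> 0"
  proof (rule tendsto_sandwich[OF _ _ tendsto_const])
    show "(\<lambda>m. 2 * (a\<^sup>2 * nsq M (\<lambda>x. S m x - f x)) + 2 * (b\<^sup>2 * nsq M (\<lambda>x. T m x - g x))) \<longlonglongrightarrow> 0"
      using S(3) T(3) by (auto intro!: tendsto_eq_intros)
    have "nsq M (\<lambda>x. (a * S m x + b * T m x) - (a * f x + b * g x)) \<le>
      2 * (a\<^sup>2 * nsq M (\<lambda>x. S m x - f x)) + 2 * (b\<^sup>2 * nsq M (\<lambda>x. T m x - g x))" for m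
    proof -
      have "nsq M (\<lambda>x. a * (S m x - f x) + b * (T m x - g x)) \<le>
          2 * nsq M (\<lambda>x. a * (S m x - f x)) + 2 * nsq M (\<lambda>x. b * (T m x - g x))"
        by (intro nsq_add_le L2_scale L2_diff S T)
      moreover have "a * (S m x - f x) + b * (T m x - g x) = (a * S m x + b * T m x) - (a * f x + b * g x)" for x
        by (simp add: algebra_simps)
      ultimately show ?thesis by (simp add: power_mult_distrib)
    qed
    then show "\<forall>\<^sub>F m in sequentially. nsq M (\<lambda>x. (a * S m x + b * T m x) - (a * f x + b * g x)) \<le>
      2 * (a\<^sup>2 * nsq M (\<lambda>x. S m x - f x)) + 2 * (b\<^sup>2 * nsq M (\<lambda>x. T m x - g x))"
      by (rule always_eventually[OF allI])
  qed (simp add: nsq_nonneg)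
  then show ?thesis
    unfolding L2_tendsto_def using S T by (auto intro!: L2_lincomb)
qed

lemma L2_tendsto_diff:
  assumes "L2_tendsto M S f" "L2_tendsto M T g"
  shows "L2_tendsto M (\<lambda>m x. S m x - T m x) (\<lambda>x. f x - g x)"
  using L2_tendsto_lincomb[OF assms, of 1 "-1"] by simp

lemma L2_tendsto_scale:
  assumes "L2_tendsto M S f"
  shows "L2_tendsto M (\<lambda>m x. c * S m x) (\<lambda>x. c * f x)"
  using L2_tendsto_lincomb[OF assms assms, of c 0] by simp

text \<open>Almost everywhere equality does not transfer measurability, as the measure need not be
  complete; hence membership of \<open>T m\<close> in \<open>L2 M\<close> is a separate
  premise.\<close>

lemma L2_tendsto_cong_AE:
  assumes "L2_tendsto M S f" "\<And>m. T m \<in> L2 M" "\<And>m. AE x in M. T m x = S m x"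
  shows "L2_tendsto M T f"
proof -
  note S = L2_tendstoD[OF assms(1)]
  have "nsq M (\<lambda>x. T m x - f x) = nsq M (\<lambda>x. S m x - f x)" for m
    by (rule integral_cong_AE) (use assms(2,3)[of m] S(1)[of m] S(2) in auto)
  then show ?thesis using S assms(2) by (auto simp: L2_tendsto_def)
qed

section \<open>The spaces of kernels\<close>

lemma prob_space_TT: "prob_space TT"
  by (auto simp: TT_def prob_space_restrict_space)

lemma space_TT [simp]: "space TT = {0..1}"
  and sets_TT: "sets TT = sets (restrict_space borel {0..1})"
  by (simp_all add: TT_def space_restrict_space sets_restrict_space)

interpretation TT: prob_space TT
  by (rule prob_space_TT)

interpretation Tn: product_prob_space "\<lambda>_::nat. TT" "{..<n}" for n :: nat
  by unfold_locales

lemma prob_space_Tn: "prob_space (Tn n)"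
  unfolding Tn_def by unfold_locales

interpretation TTn: prob_space "Tn n" for n
  by (rule prob_space_Tn)

lemma space_Tn: "space (Tn n) = PiE {..<n} (\<lambda>_. {0..1})"
  by (simp add: Tn_def space_PiM)

lemma measurable_Tn_component: "i < n \<Longrightarrow> (\<lambda>x. x i) \<in> measurable (Tn n) TT"
  unfolding Tn_def by measurable

lemma measurable_id_TT: "(\<lambda>x. x) \<in> borel_measurable TT"
  unfolding TT_def by (intro measurable_restrict_space1) simp

lemma measurable_Tn_real: "i < n \<Longrightarrow> (\<lambda>x. x i) \<in> borel_measurable (Tn n)"
  by (rule measurable_compose[OF measurable_Tn_component measurable_id_TT])

text \<open>Coordinate n is split off because \<open>section_at n\<close> freezes exactly this
  coordinate; the Fubini statements on sections rest on this identity.\<close>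

lemma Tn_Suc: "Tn (Suc n) = distr (TT \<Otimes>\<^sub>M Tn n) (Tn (Suc n)) (\<lambda>(s, x). x(n := s))"
  using distr_pair_PiM_eq_PiM[of "{..<n}" "\<lambda>_. TT" n]
  by (simp add: Tn_def lessThan_Suc prob_space_TT)

lemma measurable_upd_Tn:
  "(\<lambda>(s, x). x(n := s)) \<in> measurable (TT \<Otimes>\<^sub>M Tn n) (Tn (Suc n))"
proof -
  have "(\<lambda>(s, x). x(n := s)) = (\<lambda>(x, s). x(n := s)) \<circ> (\<lambda>(s, x). (x, s :: real))"
    by (auto simp: fun_eq_iff)
  then show ?thesis
    using measurable_comp[OF measurable_pair_swap' measurable_add_dim[of n "{..<n}" "\<lambda>_. TT"]]
    by (simp add: Tn_def lessThan_Suc)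
qed

lemma measurable_section_at_pair:
  assumes "f \<in> measurable (Tn (Suc n)) L"
  shows "(\<lambda>(s, x). f (x(n := s))) \<in> measurable (TT \<Otimes>\<^sub>M Tn n) L"
  using measurable_compose[OF measurable_upd_Tn assms] by (simp add: case_prod_beta')

interpretation TTn_pair: pair_sigma_finite TT "Tn n" for n
  by unfold_locales

section \<open>Fubini for the last variable\<close>

lemma AE_Tn_Suc:
  assumes "AE x in Tn (Suc n). P x"
  shows "AE s in TT. AE x in Tn n. P (x(n := s))"
proof -
  have "AE z in TT \<Otimes>\<^sub>M Tn n. P ((\<lambda>(s, x). x(n := s)) z)"
    using assms AE_distrD[OF measurable_upd_Tn[of n], of P] Tn_Suc[of n] by metis
  then show ?thesis
    using TTn_pair.AE_pair[of "\<lambda>z. P ((\<lambda>(s, x). x(n := s)) z)"] by simp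
qed

lemma nn_integral_Tn_Suc:
  assumes f: "f \<in> borel_measurable (Tn (Suc n))"
  shows "(\<integral>\<^sup>+x. f x \<partial>Tn (Suc n)) = (\<integral>\<^sup>+s. \<integral>\<^sup>+x. f (x(n := s)) \<partial>Tn n \<partial>TT)"
proof -
  have "(\<integral>\<^sup>+x. f x \<partial>Tn (Suc n)) = (\<integral>\<^sup>+z. (\<lambda>(s, x). f (x(n := s))) z \<partial>(TT \<Otimes>\<^sub>M Tn n))"
    using nn_integral_distr[OF measurable_upd_Tn[of n], of f] f Tn_Suc[of n] by (simp add: case_prod_beta')
  also have "\<dots> = (\<integral>\<^sup>+s. \<integral>\<^sup>+x. f (x(n := s)) \<partial>Tn n \<partial>TT)"
    using TTn.nn_integral_fst[OF measurable_section_at_pair[OF f]] by simp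
  finally show ?thesis .
qed

lemma measurable_section_at:
  assumes f: "f \<in> borel_measurable (Tn (Suc n))" and s: "s \<in> {0..1}"
  shows "section_at n f s \<in> borel_measurable (Tn n)"
proof -
  have "(\<lambda>x. (s, x)) \<in> measurable (Tn n) (TT \<Otimes>\<^sub>M Tn n)"
    using s by (intro measurable_Pair1') simp
  from measurable_compose[OF this measurable_section_at_pair[OF f]]
  show ?thesis by (simp add: section_at_def)
qed

text \<open>The iterated integral of f^2 is finite, so the inner integral is finite for almost every
  frozen value; measurability of the section holds for every value in [0,1].\<close>

lemma AE_section_at_L2:
  assumes f: "f \<in> L2 (Tn (Suc n))"
  shows "AE s in TT. section_at n f s \<in> L2 (Tn n)"
proof -
  let ?g = "\<lambda>x. ennreal ((f x)\<^sup>2)"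
  have g: "?g \<in> borel_measurable (Tn (Suc n))" using L2D[OF f] by measurable
  have "(\<integral>\<^sup>+s. \<integral>\<^sup>+x. ?g (x(n := s)) \<partial>Tn n \<partial>TT) \<noteq> \<infinity>"
    using nn_integral_Tn_Suc[OF g] nn_integral_nsq[OF f] by (metis ennreal_neq_top infinity_ennreal_def)
  then have "AE s in TT. (\<integral>\<^sup>+x. ?g (x(n := s)) \<partial>Tn n) \<noteq> \<infinity>"
    using TTn.borel_measurable_nn_integral[OF measurable_section_at_pair[OF g]]
    by (intro nn_integral_PInf_AE) auto
  then show ?thesis
  proof (rule AE_mp, intro AE_I2 impI)
    fix s assume s: "s \<in> space TT" and fin: "(\<integral>\<^sup>+x. ?g (x(n := s)) \<partial>Tn n) \<noteq> \<infinity>"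
    have m: "section_at n f s \<in> borel_measurable (Tn n)"
      using s by (intro measurable_section_at L2D[OF f]) auto
    have "integrable (Tn n) (\<lambda>x. (section_at n f s x)\<^sup>2)"
    proof (rule integrableI_nonneg)
      show "(\<lambda>x. (section_at n f s x)\<^sup>2) \<in> borel_measurable (Tn n)"
        using m by measurable
    qed (use fin in \<open>auto simp: section_at_def top.not_eq_extremum\<close>)
    then show "section_at n f s \<in> L2 (Tn n)" using m by (simp add: L2_def)
  qed
qed

lemma nn_integral_nsq_section_at:
  assumes f: "f \<in> L2 (Tn (Suc n))"
  shows "(\<integral>\<^sup>+s. ennreal (nsq (Tn n) (section_at n f s)) \<partial>TT) = ennreal (nsq (Tn (Suc n)) f)"
proof -
  have "(\<integral>\<^sup>+s. ennreal (nsq (Tn n) (section_at n f s)) \<partial>TT)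
      = (\<integral>\<^sup>+s. \<integral>\<^sup>+x. ennreal ((f (x(n := s)))\<^sup>2) \<partial>Tn n \<partial>TT)"
    using AE_section_at_L2[OF f]
    by (intro nn_integral_cong_AE) (auto simp: section_at_def dest!: nn_integral_nsq)
  also have "\<dots> = ennreal (nsq (Tn (Suc n)) f)"
    using nn_integral_Tn_Suc[of "\<lambda>x. ennreal ((f x)\<^sup>2)" n] nn_integral_nsq[OF f] L2D[OF f] by simp
  finally show ?thesis .
qed

lemma measurable_nsq_section_at:
  assumes f: "f \<in> L2 (Tn (Suc n))"
  shows "(\<lambda>s. nsq (Tn n) (section_at n f s)) \<in> borel_measurable TT"
proof -
  have "(\<lambda>x. (f x)\<^sup>2) \<in> borel_measurable (Tn (Suc n))" using L2D[OF f] by measurable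
  from TTn.borel_measurable_lebesgue_integral[OF measurable_section_at_pair[OF this]]
  show ?thesis by (simp add: section_at_def)
qed

text \<open>Points of \<open>Tn n\<close> are \<open>undefined\<close> outside
  \<open>{..<n}\<close>, where p is the identity, so composing with p keeps them extensional. The
  restricted form is the one to which reindexing of product measures applies.\<close>

lemma permutes_comp_Tn:
  assumes "p permutes {..<n}" "x \<in> space (Tn n)"
  shows "x \<circ> p = (\<lambda>i\<in>{..<n}. x (p i))"
proof
  fix i
  show "(x \<circ> p) i = (\<lambda>i\<in>{..<n}. x (p i)) i"
  proof (cases "i < n")
    case False
    then have "p i = i" "x i = undefined"
      using permutes_not_in[OF assms(1), of i] assms(2) PiE_arb[of x "{..<n}" "\<lambda>_. {0..1}" i]
      by (simp_all add: space_Tn)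
    then show ?thesis using False by simp
  qed simp
qed

lemma measurable_permutes:
  assumes "p permutes {..<n}"
  shows "(\<lambda>x. x \<circ> p) \<in> measurable (Tn n) (Tn n)"
proof -
  have "(\<lambda>x. \<lambda>i\<in>{..<n}. x (p i)) \<in> measurable (Tn n) (Tn n)"
    using permutes_in_image[OF assms] unfolding Tn_def
    by (intro measurable_restrict measurable_component_singleton) auto
  then show ?thesis
    by (rule measurable_cong[THEN iffD1, rotated]) (simp add: permutes_comp_Tn[OF assms])
qed

lemma distr_permutes:
  assumes "p permutes {..<n}"
  shows "distr (Tn n) (Tn n) (\<lambda>x. x \<circ> p) = Tn n"
proof -
  have "distr (Tn n) (Tn n) (\<lambda>x. x \<circ> p) = distr (Tn n) (Tn n) (\<lambda>x. \<lambda>i\<in>{..<n}. x (p i))"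
    by (intro distr_cong refl permutes_comp_Tn[OF assms])
  also have "\<dots> = Tn n"
    unfolding Tn_def
    by (rule distr_PiM_reindex)
       (use permutes_in_image[OF assms] permutes_inj_on[OF assms] prob_space_TT in auto)
  finally show ?thesis .
qed

lemma
  assumes T: "T \<in> measurable M M" and M: "distr M M T = M"
  shows nsq_measure_preserving: "f \<in> borel_measurable M \<Longrightarrow> nsq M (\<lambda>x. f (T x)) = nsq M f"
    and L2_measure_preserving: "f \<in> L2 M \<Longrightarrow> (\<lambda>x. f (T x)) \<in> L2 M"
proof -
  show "nsq M (\<lambda>x. f (T x)) = nsq M f" if "f \<in> borel_measurable M"
    using integral_distr[OF T borel_measurable_power[OF that, of 2]] unfolding M by simp
  show "(\<lambda>x. f (T x)) \<in> L2 M" if "f \<in> L2 M"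
    using integrable_distr[OF T, of "\<lambda>x. (f x)\<^sup>2"] measurable_compose[OF T L2D[OF that]]
    unfolding M by (simp add: L2_def L2_integrable[OF that])
qed

lemmas nsq_permutes = nsq_measure_preserving[OF measurable_permutes distr_permutes]
  and L2_permutes = L2_measure_preserving[OF measurable_permutes distr_permutes]

section \<open>Symmetrization of kernels\<close>

lemma symmetrization_lincomb:
  "symmetrization n (\<lambda>x. a * f x + b * g x) x = a * symmetrization n f x + b * symmetrization n g x"
  unfolding symmetrization_def
  by (simp add: sum.distrib sum_distrib_left add_divide_distrib)

lemma symmetrization_permutes:
  assumes "q permutes {..<n}"
  shows "symmetrization n f (x \<circ> q) = symmetrization n f x"
proof -
  have "(\<Sum>p\<in>{p. p permutes {..<n}}. f (x \<circ> q \<circ> p)) = (\<Sum>p\<in>{p. p permutes {..<n}}. f (x \<circ> p))"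
    using setum_permutations_compose_left[OF assms, of "\<lambda>p. f (x \<circ> p)"]
    by (simp add: o_assoc)
  then show ?thesis by (simp add: symmetrization_def)
qed

lemma L2_symmetrization:
  assumes "f \<in> L2 (Tn n)"
  shows "symmetrization n f \<in> L2 (Tn n)"
proof -
  have "(\<lambda>x. (1 / fact n) * (\<Sum>p\<in>{p. p permutes {..<n}}. f (x \<circ> p))) \<in> L2 (Tn n)"
    using assms by (intro L2_scale L2_sum L2_permutes) auto
  moreover have "(\<lambda>x. (1 / fact n) * (\<Sum>p\<in>{p. p permutes {..<n}}. f (x \<circ> p))) = symmetrization n f"
    by (simp add: symmetrization_def fun_eq_iff)
  ultimately show ?thesis by simp
qed

lemma symmetrization_in_L2_sym:
  assumes "f \<in> L2 (Tn n)"
  shows "symmetrization n f \<in> L2_sym n"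
  using L2_symmetrization[OF assms] by (simp add: L2_sym_def symmetric_in_def symmetrization_permutes)

text \<open>The square of an average is at most the average of the squares, and each permuted copy
  of f has the same norm because permuting coordinates preserves the measure.\<close>

lemma nsq_symmetrization_le:
  assumes "f \<in> L2 (Tn n)"
  shows "nsq (Tn n) (symmetrization n f) \<le> nsq (Tn n) f"
proof -
  let ?P = "{p. p permutes {..<n}}"
  have cP: "real (card ?P) = fact n" by (simp add: card_permutations)
  have int: "integrable (Tn n) (\<lambda>x. (f (x \<circ> p))\<^sup>2)" if "p \<in> ?P" for p
    using that assms by (intro L2_integrable L2_permutes) auto
  have "nsq (Tn n) (symmetrization n f) \<le> (\<integral>x. (\<Sum>p\<in>?P. (f (x \<circ> p))\<^sup>2) / fact n \<partial>Tn n)"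
  proof (rule integral_mono)
    show "integrable (Tn n) (\<lambda>x. (symmetrization n f x)\<^sup>2)"
      by (intro L2_integrable L2_symmetrization assms)
    show "integrable (Tn n) (\<lambda>x. (\<Sum>p\<in>?P. (f (x \<circ> p))\<^sup>2) / fact n)"
      using int by (intro Bochner_Integration.integrable_divide Bochner_Integration.integrable_sum)
    fix x
    have "(\<Sum>p\<in>?P. f (x \<circ> p))\<^sup>2 \<le> (\<Sum>p\<in>?P. (f (x \<circ> p))\<^sup>2) * fact n"
      using sum_squared_le_sum_of_squares[of "\<lambda>p. f (x \<circ> p)" ?P] by (simp only: cP)
    then show "(symmetrization n f x)\<^sup>2 \<le> (\<Sum>p\<in>?P. (f (x \<circ> p))\<^sup>2) / fact n"
      by (simp add: symmetrization_def power_divide divide_simps power2_eq_square mult.commute)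
  qed
  also have "\<dots> = (\<Sum>p\<in>?P. nsq (Tn n) (\<lambda>x. f (x \<circ> p))) / fact n"
    using int by simp
  also have "\<dots> = (\<Sum>p\<in>?P. nsq (Tn n) f) / fact n"
    using assms by (intro arg_cong2[where f = "(/)"] sum.cong refl nsq_permutes L2D) auto
  also have "\<dots> = nsq (Tn n) f"
    by (simp add: cP)
  finally show ?thesis .
qed

lemma L2_symD: "f \<in> L2_sym n \<Longrightarrow> f \<in> L2 (Tn n)"
  by (simp add: L2_sym_def)

lemma L2_sym_lincomb:
  assumes "f \<in> L2_sym n" "g \<in> L2_sym n"
  shows "(\<lambda>x. a * f x + b * g x) \<in> L2_sym n"
proof -
  have "AE x in Tn n. a * f (x \<circ> p) + b * g (x \<circ> p) = a * f x + b * g x" if "p permutes {..<n}" for p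
  proof -
    have "AE x in Tn n. f (x \<circ> p) = f x" "AE x in Tn n. g (x \<circ> p) = g x"
      using assms that by (simp_all add: L2_sym_def symmetric_in_def)
    then show ?thesis by eventually_elim simp
  qed
  then show ?thesis
    using assms by (simp add: L2_sym_def symmetric_in_def L2_lincomb)
qed

lemma L2_sym_zero: "(\<lambda>x. 0) \<in> L2_sym n"
  by (simp add: L2_sym_def symmetric_in_def L2_zero)

lemma L2_sym_diff:
  assumes "f \<in> L2_sym n" "g \<in> L2_sym n"
  shows "(\<lambda>x. f x - g x) \<in> L2_sym n"
  using L2_sym_lincomb[OF assms, of 1 "-1"] by simp

lemma L2_sym_scale:
  assumes "f \<in> L2_sym n"
  shows "(\<lambda>x. c * f x) \<in> L2_sym n"
  using L2_sym_lincomb[OF assms assms, of c 0] by simp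

text \<open>Symmetry is known only up to a null set of T^(n+1). Fubini turns it into symmetry of
  almost every section, one permutation at a time; as there are finitely many permutations, the
  exceptional values still form a null set.\<close>

lemma AE_section_at_L2_sym:
  assumes f: "f \<in> L2 (Tn (Suc n))" and sym: "symmetric_in n (Suc n) f"
  shows "AE s in TT. section_at n f s \<in> L2_sym n"
proof -
  have "AE s in TT. \<forall>p\<in>{p. p permutes {..<n}}. AE x in Tn n.
      section_at n f s (x \<circ> p) = section_at n f s x"
  proof (rule AE_finite_allI)
    fix p assume "p \<in> {p. p permutes {..<n}}"
    then have p: "p permutes {..<n}" by simp
    \<comment> \<open>A permutation of the first n coordinates fixes n, so it commutes with freezing
      the last coordinate.\<close>
    have eq: "(x(n := s)) \<circ> p = (x \<circ> p)(n := s)" for x :: "nat \<Rightarrow> real" and s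
    proof
      fix i show "((x(n := s)) \<circ> p) i = ((x \<circ> p)(n := s)) i"
        using permutes_not_in[OF p, of n] permutes_in_image[OF p, of i] permutes_not_in[OF p, of i]
        by (cases "i = n"; cases "i < n") auto
    qed
    have "AE x in Tn (Suc n). f (x \<circ> p) = f x"
      using sym p by (simp add: symmetric_in_def)
    from AE_Tn_Suc[OF this] show "AE s in TT. AE x in Tn n.
      section_at n f s (x \<circ> p) = section_at n f s x"
      by (simp add: eq section_at_def)
  qed (simp add: finite_permutations)
  with AE_section_at_L2[OF f] show ?thesis
    by eventually_elim (auto simp: L2_sym_def symmetric_in_def)
qed

section \<open>Density of disjoint boxes\<close>

lemma L2_tendsto_dominated:
  assumes w: "w \<in> L2 M" and S: "\<And>m. S m \<in> borel_measurable M" and f: "f \<in> borel_measurable M"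
    and lim: "AE x in M. (\<lambda>m. S m x) \<longlonglongrightarrow> f x"
    and bd: "\<And>m. AE x in M. \<bar>S m x\<bar> \<le> \<bar>w x\<bar>"
  shows "L2_tendsto M S f"
proof -
  have bd_all: "AE x in M. \<forall>m. \<bar>S m x\<bar> \<le> \<bar>w x\<bar>"
    using bd by (simp add: AE_all_countable)
  have bdf: "AE x in M. \<bar>f x\<bar> \<le> \<bar>w x\<bar>"
    using lim bd_all
  proof eventually_elim
    fix x assume "(\<lambda>m. S m x) \<longlonglongrightarrow> f x" "\<forall>m. \<bar>S m x\<bar> \<le> \<bar>w x\<bar>"
    then show "\<bar>f x\<bar> \<le> \<bar>w x\<bar>"
      by (intro LIMSEQ_le_const2[OF tendsto_rabs]) auto
  qed
  have fL: "f \<in> L2 M" and SL: "S m \<in> L2 M" for m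
    by (rule L2_bound[OF w f bdf], rule L2_bound[OF w S bd])
  have "(\<lambda>m. nsq M (\<lambda>x. S m x - f x)) \<longlonglongrightarrow> (\<integral>x. 0 \<partial>M)"
  proof (rule integral_dominated_convergence[where w = "\<lambda>x. 4 * (w x)\<^sup>2"])
    show "AE x in M. (\<lambda>m. (S m x - f x)\<^sup>2) \<longlonglongrightarrow> 0"
      using lim by eventually_elim (auto intro!: tendsto_eq_intros)
    show "AE x in M. norm ((S m x - f x)\<^sup>2) \<le> 4 * (w x)\<^sup>2" for m
      using bd[of m] bdf
    proof eventually_elim
      fix x assume "\<bar>S m x\<bar> \<le> \<bar>w x\<bar>" "\<bar>f x\<bar> \<le> \<bar>w x\<bar>"
      then have "\<bar>S m x - f x\<bar> \<le> \<bar>2 * w x\<bar>" by simp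
      then show "norm ((S m x - f x)\<^sup>2) \<le> 4 * (w x)\<^sup>2"
        using abs_le_square_iff[of "S m x - f x" "2 * w x"] by (simp add: power_mult_distrib)
    qed
  qed (use S f L2_integrable[OF w] in auto)
  then show ?thesis by (simp add: L2_tendsto_def fL SL)
qed

lemma Tn_component: "x \<in> space (Tn n) \<Longrightarrow> i < n \<Longrightarrow> x i \<in> {0..1}"
  using PiE_mem[of x "{..<n}" "\<lambda>_. {0..1}" i] by (simp add: space_Tn)

lemma indicator_PiE:
  assumes "x \<in> space (Tn n)"
  shows "indicator (PiE {..<n} E) x = (\<Prod>i<n. indicator (E i) (x i) :: real)"
proof -
  have "x \<in> extensional {..<n}" using assms by (simp add: space_Tn PiE_def)
  then have "x \<in> PiE {..<n} E \<longleftrightarrow> (\<forall>i<n. x i \<in> E i)" by (auto simp: PiE_def Pi_def)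
  then show ?thesis by (auto simp: indicator_def)
qed

text \<open>The conditions are the premises of \<open>products\<close>: these are the boxes whose
  multiple integral is known as a product of compensated masses.\<close>

definition disjoint_boxes :: "nat \<Rightarrow> (nat \<Rightarrow> real set) set" where
  "disjoint_boxes n = {B. (\<forall>i<n. B i \<in> sets borel \<and> B i \<subseteq> {0..1}) \<and> disjoint_family_on B {..<n}}"

text \<open>A linear span generated by adding one multiple of a box at a time, so that an induction
  has to treat only a single box and a single sum.\<close>

inductive_set box_span :: "nat \<Rightarrow> ((nat \<Rightarrow> real) \<Rightarrow> real) set" for n where
  zero: "(\<lambda>x. 0) \<in> box_span n"
| add: "f \<in> box_span n \<Longrightarrow> B \<in> disjoint_boxes n \<Longrightarrow>
    (\<lambda>x. f x + c * (\<Prod>i<n. indicator (B i) (x i))) \<in> box_span n"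

lemma box_span_add: "g \<in> box_span n \<Longrightarrow> f \<in> box_span n \<Longrightarrow> (\<lambda>x. f x + g x) \<in> box_span n"
proof (induction rule: box_span.induct)
  case (add g B c)
  then show ?case using box_span.add[OF add.IH[OF add.prems] add.hyps(2), of c] by (simp add: add.assoc)
qed simp

lemma box_span_scale: "f \<in> box_span n \<Longrightarrow> (\<lambda>x. a * f x) \<in> box_span n"
proof (induction rule: box_span.induct)
  case (add g B c)
  then show ?case using box_span.add[OF add.IH add.hyps(2), of "a * c"]
    by (simp add: distrib_left mult.assoc)
qed (simp add: box_span.zero)

lemma box_span_sum: "(\<And>j. j \<in> J \<Longrightarrow> f j \<in> box_span n) \<Longrightarrow> (\<lambda>x. \<Sum>j\<in>J. f j x) \<in> box_span n"
  by (induction J rule: infinite_finite_induct) (auto intro: box_span.zero box_span_add)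

lemma box_in_box_span: "B \<in> disjoint_boxes n \<Longrightarrow> (\<lambda>x. \<Prod>i<n. indicator (B i) (x i)) \<in> box_span n"
  using box_span.add[OF box_span.zero, of B n 1] by simp

lemma box_measurable:
  assumes "\<And>i. i < n \<Longrightarrow> B i \<in> sets borel"
  shows "(\<lambda>x. \<Prod>i<n. indicator (B i) (x i) :: real) \<in> borel_measurable (Tn n)"
proof (rule borel_measurable_prod)
  fix i assume "i \<in> {..<n}"
  then show "(\<lambda>x. indicator (B i) (x i) :: real) \<in> borel_measurable (Tn n)"
    using measurable_compose[OF measurable_Tn_real[of i n], of "indicator (B i)" borel] assms by auto
qed

lemma abs_box_le: "\<bar>\<Prod>i<n. indicator (B i) (x i :: real) :: real\<bar> \<le> 1"
  by (simp add: abs_prod prod_le_1)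

lemma box_L2:
  assumes "\<And>i. i < n \<Longrightarrow> B i \<in> sets borel"
  shows "(\<lambda>x. \<Prod>i<n. indicator (B i) (x i) :: real) \<in> L2 (Tn n)"
proof (rule L2_bound[where g = "\<lambda>_. 1"])
  show "(\<lambda>_. 1) \<in> L2 (Tn n)" by (simp add: L2_def)
qed (use box_measurable[OF assms] in \<open>simp_all add: abs_box_le\<close>)

lemma box_span_L2: "f \<in> box_span n \<Longrightarrow> f \<in> L2 (Tn n)"
proof (induction rule: box_span.induct)
  case (add f B c)
  then show ?case by (intro L2_add L2_scale box_L2) (auto simp: disjoint_boxes_def)
qed (rule L2_zero)

definition box_closure :: "nat \<Rightarrow> ((nat \<Rightarrow> real) \<Rightarrow> real) set" where
  "box_closure n = {f \<in> L2 (Tn n). \<forall>e>0. \<exists>g\<in>box_span n. nsq (Tn n) (\<lambda>x. f x - g x) < e}"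

lemma box_closure_limit:
  assumes S: "\<And>m. S m \<in> box_closure n" and lim: "L2_tendsto (Tn n) S f"
  shows "f \<in> box_closure n"
  unfolding box_closure_def
proof (intro CollectI conjI allI impI)
  note L = L2_tendstoD[OF lim]
  show "f \<in> L2 (Tn n)" by (rule L)
  fix e :: real assume e: "e > 0"
  \<comment> \<open>Two errors below e/4, each doubled by \<open>nsq_add_le\<close>, add up to less
    than e.\<close>
  then have "\<forall>\<^sub>F m in sequentially. nsq (Tn n) (\<lambda>x. S m x - f x) < e / 4"
    by (intro order_tendstoD(2)[OF L(3)]) simp
  then obtain m where m: "nsq (Tn n) (\<lambda>x. S m x - f x) < e / 4"
    by (auto simp: eventually_sequentially)
  obtain g where g: "g \<in> box_span n" "nsq (Tn n) (\<lambda>x. S m x - g x) < e / 4"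
    using S[of m] e by (auto simp: box_closure_def dest!: spec[of _ "e / 4"])
  have "nsq (Tn n) (\<lambda>x. (f x - S m x) + (S m x - g x)) \<le>
      2 * nsq (Tn n) (\<lambda>x. f x - S m x) + 2 * nsq (Tn n) (\<lambda>x. S m x - g x)"
    by (intro nsq_add_le L2_diff L box_span_L2 g)
  then have "nsq (Tn n) (\<lambda>x. f x - g x) < e"
    using m g(2) by (simp add: power2_commute[of "f _"])
  with g(1) show "\<exists>g\<in>box_span n. nsq (Tn n) (\<lambda>x. f x - g x) < e" by blast
qed

lemma box_span_subset_closure: "box_span n \<subseteq> box_closure n"
  by (auto simp: box_closure_def box_span_L2 intro!: bexI)

lemma box_closure_lincomb:
  assumes "f \<in> box_closure n" "g \<in> box_closure n"
  shows "(\<lambda>x. a * f x + b * g x) \<in> box_closure n"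
proof -
  have ex: "\<exists>S. \<forall>m. S m \<in> box_span n \<and> nsq (Tn n) (\<lambda>x. f x - S m x) < 1 / real (Suc m)"
    if "f \<in> box_closure n" for f
  proof (rule choice, rule allI)
    fix m
    have "1 / real (Suc m) > 0" by simp
    then show "\<exists>g. g \<in> box_span n \<and> nsq (Tn n) (\<lambda>x. f x - g x) < 1 / real (Suc m)"
      using that unfolding box_closure_def by blast
  qed
  have lim: "L2_tendsto (Tn n) S f" if f: "f \<in> box_closure n"
    and S: "\<And>m. S m \<in> box_span n \<and> nsq (Tn n) (\<lambda>x. f x - S m x) < 1 / real (Suc m)" for f S
  proof -
    have "(\<lambda>m. nsq (Tn n) (\<lambda>x. S m x - f x)) \<longlonglongrightarrow> 0"
    proof (rule tendsto_sandwich[OF _ _ tendsto_const])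
      show "(\<lambda>m. 1 / real (Suc m)) \<longlonglongrightarrow> 0" by (rule lim_1_over_n[THEN LIMSEQ_Suc])
      show "\<forall>\<^sub>F m in sequentially. nsq (Tn n) (\<lambda>x. S m x - f x) \<le> 1 / real (Suc m)"
        using S by (auto simp: power2_commute[of "S _ _"] less_imp_le)
    qed simp
    then show ?thesis using S f by (auto simp: L2_tendsto_def box_span_L2 box_closure_def)
  qed
  from ex[OF assms(1)] obtain S where S:
    "\<And>m. S m \<in> box_span n \<and> nsq (Tn n) (\<lambda>x. f x - S m x) < 1 / real (Suc m)" by blast
  from ex[OF assms(2)] obtain T where T:
    "\<And>m. T m \<in> box_span n \<and> nsq (Tn n) (\<lambda>x. g x - T m x) < 1 / real (Suc m)" by blast
  show ?thesis
  proof (rule box_closure_limit[OF _ L2_tendsto_lincomb[OF lim[OF assms(1) S] lim[OF assms(2) T]]])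
    show "(\<lambda>x. a * S m x + b * T m x) \<in> box_closure n" for m
      using S T box_span_subset_closure by (blast intro: box_span_add box_span_scale)
  qed
qed

lemma box_closure_zero: "(\<lambda>x. 0) \<in> box_closure n"
  using box_span_subset_closure box_span.zero by blast

lemma box_closure_sum:
  "(\<And>j. j \<in> J \<Longrightarrow> f j \<in> box_closure n) \<Longrightarrow> (\<lambda>x. \<Sum>j\<in>J. c j * f j x) \<in> box_closure n"
proof (induction J rule: infinite_finite_induct)
  case (insert j J)
  then show ?case
    using box_closure_lincomb[of "f j" n "\<lambda>x. \<Sum>j\<in>J. c j * f j x" "c j" 1] by simp
qed (simp_all add: box_closure_zero)

lemma box_closure_cong:
  assumes "f \<in> box_closure n" "\<And>x. x \<in> space (Tn n) \<Longrightarrow> g x = f x"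
  shows "g \<in> box_closure n"
proof -
  have f: "f \<in> L2 (Tn n)" using assms(1) by (simp add: box_closure_def)
  have "g \<in> L2 (Tn n)"
  proof (rule L2_cong_AE[OF f])
    show "g \<in> borel_measurable (Tn n)"
      using L2D[OF f] measurable_cong[of "Tn n" g f borel, OF assms(2)] by blast
  qed (simp add: assms(2))
  moreover have "nsq (Tn n) (\<lambda>x. g x - h x) = nsq (Tn n) (\<lambda>x. f x - h x)" for h
    by (rule Bochner_Integration.integral_cong) (simp_all add: assms)
  ultimately show ?thesis using assms(1) by (simp add: box_closure_def)
qed

subsection \<open>Boxes near the diagonal\<close>

text \<open>For q > 0 these are intervals of length 1/q, except that the point 1 alone has index q.
  So there are q + 1 nonempty cells, the origin of the factor \<open>real q + 1\<close> in the
  estimates.\<close>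

definition cell :: "nat \<Rightarrow> nat \<Rightarrow> real set" where
  "cell q a = {x \<in> {0..1}. nat \<lfloor>real q * x\<rfloor> = a}"

lemma cell_borel [measurable]: "cell q a \<in> sets borel"
  unfolding cell_def by measurable

lemma emeasure_cell_le:
  assumes "q > 0"
  shows "emeasure TT (cell q a) \<le> ennreal (1 / real q)"
proof -
  have "cell q a \<subseteq> {real a / real q .. real (Suc a) / real q}"
  proof
    fix x assume x: "x \<in> cell q a"
    then have "\<lfloor>real q * x\<rfloor> = int a"
      by (auto simp: cell_def nat_eq_iff)
    then have "real a \<le> real q * x" "real q * x < real a + 1"
      by (simp_all add: floor_eq_iff)
    then show "x \<in> {real a / real q .. real (Suc a) / real q}"
      using assms by (simp add: divide_simps mult.commute)
  qed
  then have "emeasure lborel (cell q a) \<le> emeasure lborel {real a / real q .. real (Suc a) / real q}"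
    by (intro emeasure_mono) auto
  also have "\<dots> = ennreal (1 / real q)"
    using assms by (simp add: divide_simps emeasure_lborel_Icc_eq)
  finally show ?thesis
    unfolding TT_def by (subst emeasure_restrict_space) (auto simp: cell_def)
qed

lemma cell_in_TT: "cell q a \<in> sets TT"
  using cell_borel[of q a] by (auto simp: sets_TT sets_restrict_space cell_def intro!: image_eqI[of _ _ "cell q a"])

lemma cell_disjoint: "a \<noteq> b \<Longrightarrow> cell q a \<inter> cell q b = {}"
  by (auto simp: cell_def)

text \<open>All other sides are the whole interval and contribute 1, so only the two equal cells of
  length at most 1/q remain.\<close>

lemma emeasure_same_cell_le:
  assumes "q > 0" "i < n" "j < n" "i \<noteq> j"
  shows "emeasure (Tn n) {x \<in> space (Tn n). x i \<in> cell q a \<and> x j \<in> cell q a} \<le> ennreal (1 / (real q)\<^sup>2)"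
proof -
  let ?E = "\<lambda>k. if k \<in> {i, j} then cell q a else {0..1}"
  have "{x \<in> space (Tn n). x i \<in> cell q a \<and> x j \<in> cell q a} = PiE {..<n} ?E"
    using assms by (auto simp: space_Tn PiE_def Pi_def cell_def split: if_splits)
  also have "emeasure (Tn n) \<dots> = (\<Prod>k<n. emeasure TT (?E k))"
    unfolding Tn_def
    by (rule Tn.emeasure_PiM) (auto simp: cell_in_TT intro: sets.top[of TT, simplified])
  also have "\<dots> = (\<Prod>k\<in>{i, j}. emeasure TT (?E k))"
    using assms TT.emeasure_space_1 by (intro prod.mono_neutral_right) auto
  also have "\<dots> = emeasure TT (cell q a) * emeasure TT (cell q a)"
    using assms by simp
  also have "\<dots> \<le> ennreal (1 / real q) * ennreal (1 / real q)"
    by (intro mult_mono emeasure_cell_le assms) auto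
  also have "\<dots> = ennreal (1 / (real q)\<^sup>2)"
    by (simp add: ennreal_mult[symmetric] power2_eq_square)
  finally show ?thesis .
qed

lemma cell_index_le: "x \<in> {0..1} \<Longrightarrow> nat \<lfloor>real q * x\<rfloor> \<le> q"
  by (simp add: nat_le_iff) (metis floor_mono floor_of_nat mult_left_le of_nat_0_le_iff)

lemma in_cell_iff: "x \<in> {0..1} \<Longrightarrow> x \<in> cell q a \<longleftrightarrow> nat \<lfloor>real q * x\<rfloor> = a"
  by (simp add: cell_def)

text \<open>A point clashes when two of its coordinates share a cell. The estimate is a union bound:
  at most n^2 ordered pairs, q + 1 cells, probability at most 1/q^2 each. It tends to 0 like
  1/q.\<close>

lemma measure_clash_le:
  fixes n q :: nat
  defines "clash \<equiv> {x \<in> space (Tn n). \<not> inj_on (\<lambda>i. nat \<lfloor>real q * x i\<rfloor>) {..<n}}"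
  assumes q: "q > 0"
  shows "clash \<in> sets (Tn n)"
    and "measure (Tn n) clash \<le> (real n)\<^sup>2 * (real q + 1) / (real q)\<^sup>2"
proof -
  let ?P = "{(i, j). i < n \<and> j < n \<and> i \<noteq> j}"
  let ?C = "\<lambda>((i, j), a). {x \<in> space (Tn n). x i \<in> cell q a \<and> x j \<in> cell q a}"
  have finP: "finite ?P" by (rule finite_subset[of _ "{..<n} \<times> {..<n}"]) auto
  have fin: "finite (?P \<times> {..q})" using finP by blast
  have eq: "clash = (\<Union>z\<in>?P \<times> {..q}. ?C z)"
  proof (intro set_eqI iffI)
    fix x assume "x \<in> clash"
    then obtain i j where ij: "x \<in> space (Tn n)" "i < n" "j < n" "i \<noteq> j"
      "nat \<lfloor>real q * x i\<rfloor> = nat \<lfloor>real q * x j\<rfloor>"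
      by (auto simp: clash_def inj_on_def)
    define a where "a = nat \<lfloor>real q * x i\<rfloor>"
    have xij: "x i \<in> {0..1}" "x j \<in> {0..1}"
      using ij Tn_component by blast+
    then have "x i \<in> cell q a" "x j \<in> cell q a" "a \<le> q"
      using ij(5) cell_index_le[OF xij(1), of q] by (simp_all add: in_cell_iff a_def)
    then have "x \<in> ?C ((i, j), a)" "((i, j), a) \<in> ?P \<times> {..q}"
      using ij by simp_all
    then show "x \<in> (\<Union>z\<in>?P \<times> {..q}. ?C z)" by blast
  next
    fix x assume "x \<in> (\<Union>z\<in>?P \<times> {..q}. ?C z)"
    then obtain z where z: "z \<in> ?P \<times> {..q}" "x \<in> ?C z" by blast
    obtain i j a where "z = ((i, j), a)" by (metis surj_pair)
    with z have ij: "i < n" "j < n" "i \<noteq> j" "x \<in> space (Tn n)" "x i \<in> cell q a" "x j \<in> cell q a"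
      by simp_all
    then have "\<not> inj_on (\<lambda>i. nat \<lfloor>real q * x i\<rfloor>) {..<n}"
      unfolding inj_on_def cell_def by blast
    with ij show "x \<in> clash" by (simp add: clash_def)
  qed
  have meas: "?C z \<in> sets (Tn n)" if z: "z \<in> ?P \<times> {..q}" for z
  proof -
    obtain i j a where z_eq: "z = ((i, j), a)" by (metis surj_pair)
    with z have ij: "i < n" "j < n" by simp_all
    have "{x \<in> space (Tn n). x k \<in> cell q a} \<in> sets (Tn n)" if "k < n" for k
      using measurable_sets[OF measurable_Tn_real[OF that] cell_borel]
      by (simp add: vimage_def Int_def conj_commute)
    from sets.Int[OF this[OF ij(1)] this[OF ij(2)]] show ?thesis
      by (simp add: z_eq Int_def conj_ac)
  qed
  show "clash \<in> sets (Tn n)"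
    unfolding eq using fin meas by (rule sets.finite_UN)
  have "measure (Tn n) clash \<le> (\<Sum>z\<in>?P \<times> {..q}. measure (Tn n) (?C z))"
    unfolding eq using fin meas by (intro measure_UNION_le) auto
  also have "\<dots> \<le> (\<Sum>z\<in>?P \<times> {..q}. 1 / (real q)\<^sup>2)"
  proof (rule sum_mono)
    fix z assume "z \<in> ?P \<times> {..q}"
    moreover obtain i j a where "z = ((i, j), a)" by (metis surj_pair)
    ultimately show "measure (Tn n) (?C z) \<le> 1 / (real q)\<^sup>2"
      using emeasure_same_cell_le[OF q, of i n j a]
      by (simp add: TTn.emeasure_eq_measure)
  qed
  also have "\<dots> = real (card ?P) * (real q + 1) / (real q)\<^sup>2"
    by (simp add: card_cartesian_product algebra_simps add_divide_distrib)
  also have "\<dots> \<le> (real n)\<^sup>2 * (real q + 1) / (real q)\<^sup>2"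
  proof -
    have "card ?P \<le> card ({..<n} \<times> {..<n})" by (rule card_mono) auto
    then have "real (card ?P) \<le> (real n)\<^sup>2"
      by (simp add: card_cartesian_product power2_eq_square flip: of_nat_mult)
    then show ?thesis by (intro divide_right_mono mult_right_mono) auto
  qed
  finally show "measure (Tn n) clash \<le> (real n)\<^sup>2 * (real q + 1) / (real q)\<^sup>2" .
qed

text \<open>Assign the coordinates injectively to cells and intersect each side with its cell:
  distinct cells are disjoint, so every resulting box has disjoint sides, even if the sides of the
  given box overlap. The sum over all such assignments misses only clashing points.\<close>

lemma box_in_closure:
  assumes B: "\<And>i. i < n \<Longrightarrow> B i \<in> sets borel \<and> B i \<subseteq> {0..1}"
  shows "(\<lambda>x. \<Prod>i<n. indicator (B i) (x i)) \<in> box_closure n"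
proof -
  let ?h = "\<lambda>x. \<Prod>i<n. indicator (B i) (x i) :: real"
  let ?A = "\<lambda>q. {a \<in> {..<n} \<rightarrow>\<^sub>E {..q}. inj_on a {..<n}}"
  define g where "g q x = (\<Sum>a\<in>?A q. \<Prod>i<n. indicator (B i \<inter> cell q (a i)) (x i) :: real)"
    for q :: nat and x :: "nat \<Rightarrow> real"
  let ?clash = "\<lambda>q. {x \<in> space (Tn n). \<not> inj_on (\<lambda>i. nat \<lfloor>real q * x i\<rfloor>) {..<n}}"
  have h: "?h \<in> L2 (Tn n)" using B by (intro box_L2) auto
  have gspan: "g q \<in> box_span n" for q
    unfolding g_def
  proof (intro box_span_sum box_in_box_span)
    fix a assume "a \<in> ?A q"
    then have inj: "inj_on a {..<n}" by simp
    have "B i \<inter> cell q (a i) \<inter> (B j \<inter> cell q (a j)) = {}" if "i < n" "j < n" "i \<noteq> j" for i j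
      using cell_disjoint[of "a i" "a j" q] inj_onD[OF inj, of i j] that by blast
    then show "(\<lambda>i. B i \<inter> cell q (a i)) \<in> disjoint_boxes n"
      using B unfolding disjoint_boxes_def disjoint_family_on_def
      by (auto intro!: sets.Int cell_borel)
  qed
  have geq: "?h x - g q x = ?h x * indicator (?clash q) x" if x: "x \<in> space (Tn n)" for q x
  proof -
    \<comment> \<open>The cell pattern of x: \<open>a0\<close> is the only assignment whose small
      box can contain x, and it takes part in the sum exactly if x does not clash.\<close>
    define a0 where "a0 = (\<lambda>i\<in>{..<n}. nat \<lfloor>real q * x i\<rfloor>)"
    have xi: "x i \<in> {0..1}" if "i < n" for i using Tn_component[OF x that] .
    have a0: "a0 \<in> {..<n} \<rightarrow>\<^sub>E {..q}"
      using xi by (auto simp: a0_def cell_index_le)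
    have fin: "finite (?A q)" by (rule finite_subset[of _ "{..<n} \<rightarrow>\<^sub>E {..q}"]) (auto intro: finite_PiE)
    have summand: "(\<Prod>i<n. indicator (B i \<inter> cell q (a i)) (x i) :: real) = (if a = a0 then ?h x else 0)"
      if a: "a \<in> ?A q" for a
    proof (cases "a = a0")
      case True
      have "x i \<in> cell q (a i)" if "i < n" for i
        using xi[OF that] that by (simp add: True a0_def in_cell_iff)
      then show ?thesis using True by (auto intro!: prod.cong simp: indicator_def)
    next
      case False
      then obtain i where "i < n" "a i \<noteq> a0 i"
        using a a0 by (metis (no_types, lifting) PiE_ext lessThan_iff mem_Collect_eq)
      then have "x i \<notin> cell q (a i)" using xi by (simp add: a0_def in_cell_iff)
      then have "\<exists>i\<in>{..<n}. indicator (B i \<inter> cell q (a i)) (x i) = (0::real)"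
        using \<open>i < n\<close> by (auto simp: indicator_def)
      then show ?thesis using False by simp
    qed
    have "g q x = (\<Sum>a\<in>?A q. if a = a0 then ?h x else 0)"
      unfolding g_def by (rule sum.cong[OF refl summand])
    also have "\<dots> = (if a0 \<in> ?A q then ?h x else 0)"
      using fin by simp
    also have "a0 \<in> ?A q \<longleftrightarrow> x \<notin> ?clash q"
      using a0 x by (auto simp: a0_def inj_on_def)
    finally show ?thesis by (auto simp: indicator_def)
  qed
  have le: "nsq (Tn n) (\<lambda>x. ?h x - g q x) \<le> (real n)\<^sup>2 * (real q + 1) / (real q)\<^sup>2" if q: "q > 0" for q
  proof -
    have "nsq (Tn n) (\<lambda>x. ?h x - g q x) \<le> (\<integral>x. indicator (?clash q) x \<partial>Tn n)"
    proof (rule integral_mono)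
      show "integrable (Tn n) (\<lambda>x. (?h x - g q x)\<^sup>2)"
        by (intro L2_integrable L2_diff h box_span_L2 gspan)
      show "integrable (Tn n) (indicator (?clash q) :: _ \<Rightarrow> real)"
        using measure_clash_le(1)[OF q] by (simp add: TTn.emeasure_eq_measure)
      fix x assume x: "x \<in> space (Tn n)"
      have "(?h x)\<^sup>2 \<le> 1" using abs_box_le[where n = n and B = B and x = x] by (simp add: abs_square_le_1)
      then show "(?h x - g q x)\<^sup>2 \<le> indicator (?clash q) x"
        unfolding geq[OF x] by (cases "x \<in> ?clash q") simp_all
    qed
    also have "\<dots> = measure (Tn n) (?clash q)"
      using measure_clash_le(1)[OF q, of n] by simp
    also have "\<dots> \<le> (real n)\<^sup>2 * (real q + 1) / (real q)\<^sup>2"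
      by (rule measure_clash_le(2)[OF q])
    finally show ?thesis .
  qed
  have "L2_tendsto (Tn n) (\<lambda>q. g (Suc q)) ?h"
  proof -
    have lim: "(\<lambda>q. (real n)\<^sup>2 * (real (Suc q) + 1) / (real (Suc q))\<^sup>2) \<longlonglongrightarrow> 0"
      by real_asymp
    have "nsq (Tn n) (\<lambda>x. g (Suc q) x - ?h x) \<le> (real n)\<^sup>2 * (real (Suc q) + 1) / (real (Suc q))\<^sup>2" for q
      using le[of "Suc q"] by (simp add: power2_commute[of "g _ _"])
    then have "(\<lambda>q. nsq (Tn n) (\<lambda>x. g (Suc q) x - ?h x)) \<longlonglongrightarrow> 0"
      by (intro tendsto_sandwich[OF _ _ tendsto_const lim] always_eventually allI nsq_nonneg)
    then show ?thesis using gspan h by (simp add: L2_tendsto_def box_span_L2)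
  qed
  then show ?thesis
    by (rule box_closure_limit[rotated]) (rule subsetD[OF box_span_subset_closure gspan])
qed

text \<open>Measurable boxes are stable under intersection and generate the product sigma-field.
  Complements are handled by linearity, disjoint unions by dominated convergence with bound
  1.\<close>

lemma indicator_in_closure:
  assumes "A \<in> sets (Tn n)"
  shows "indicator A \<in> box_closure n"
proof -
  let ?G = "{PiE {..<n} E | E. \<forall>i\<in>{..<n}. E i \<in> sets TT}"
  have sets: "sets (Tn n) = sigma_sets (space (Tn n)) ?G"
    unfolding Tn_def sets_PiM space_PiM
    by (simp add: prod_algebra_eq_finite Pi_iff)
  have "?G \<subseteq> Pow (space (Tn n))"
  proof safe
    fix E x assume E: "\<forall>i\<in>{..<n}. E i \<in> sets TT" and x: "x \<in> PiE {..<n} E"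
    have "E i \<subseteq> {0..1}" if "i \<in> {..<n}" for i
      using sets.sets_into_space[OF bspec[OF E that]] by simp
    then have "PiE {..<n} E \<subseteq> PiE {..<n} (\<lambda>_. {0..1})" by (rule PiE_mono)
    with x show "x \<in> space (Tn n)" by (auto simp only: space_Tn)
  qed
  from Int_stable_PiE this assms[unfolded sets] show ?thesis
  proof (induction rule: sigma_sets_induct_disjoint)
    case (basic A)
    then obtain E where A: "A = PiE {..<n} E" and E: "\<And>i. i < n \<Longrightarrow> E i \<in> sets TT" by auto
    have E': "E i \<in> sets borel \<and> E i \<subseteq> {0..1}" if "i < n" for i
      using E[OF that] by (auto simp: sets_TT sets_restrict_space)
    show ?case
      by (rule box_closure_cong[OF box_in_closure[OF E']]) (simp_all add: A indicator_PiE)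
  next
    case empty
    show ?case by (rule box_closure_cong[OF box_closure_zero]) simp
  next
    case (compl A)
    have "indicator (space (Tn n)) \<in> box_closure n"
      by (rule box_closure_cong[OF box_in_closure[where B = "\<lambda>_. {0..1}"]])
         (simp_all add: indicator_PiE[symmetric], simp add: space_Tn)
    from box_closure_lincomb[OF this compl.IH, of 1 "-1"] show ?case
      by (rule box_closure_cong) (auto simp: indicator_def)
  next
    case (union A)
    have meas: "A i \<in> sets (Tn n)" for i
      using union.hyps(2) unfolding sets by (auto dest: range_subsetD)
    have "L2_tendsto (Tn n) (\<lambda>m x. \<Sum>i<m. 1 * indicator (A i) x) (indicator (\<Union>i. A i))"
    proof (rule L2_tendsto_dominated[where w = "\<lambda>_. 1"])
      have eq: "(\<Sum>i<m. indicator (A i) x) = (indicator (\<Union>i<m. A i) x :: real)" for m x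
        using disjoint_family_on_mono[of "{..<m}" UNIV A] union.hyps(1)
        by (subst indicator_UN_disjoint) auto
      show "AE x in Tn n. (\<lambda>m. \<Sum>i<m. 1 * indicator (A i) x :: real) \<longlonglongrightarrow> indicator (\<Union>i. A i) x"
        unfolding mult_1 eq by (intro always_eventually allI LIMSEQ_indicator_UN)
      show "AE x in Tn n. \<bar>\<Sum>i<m. 1 * indicator (A i) x\<bar> \<le> \<bar>1 :: real\<bar>" for m
        unfolding mult_1 eq by (simp add: indicator_def)
      show "(\<lambda>x. \<Sum>i<m. 1 * indicator (A i) x :: real) \<in> borel_measurable (Tn n)" for m
        by (intro borel_measurable_sum borel_measurable_times borel_measurable_const borel_measurable_indicator meas)
      show "(indicator (\<Union>i. A i) :: _ \<Rightarrow> real) \<in> borel_measurable (Tn n)"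
        by (rule borel_measurable_indicator, rule sets.countable_UN) (use meas in blast)
    qed (simp add: L2_def)
    moreover have "(\<lambda>x. \<Sum>i<m. 1 * indicator (A i) x) \<in> box_closure n" for m
      by (rule box_closure_sum[where c = "\<lambda>_. 1"]) (rule union.IH)
    ultimately show ?case by (rule box_closure_limit[rotated])
  qed
qed

text \<open>Simple functions bounded by 2|f| converge pointwise to f, hence in L^2 by domination,
  and each is a finite combination of indicators of its level sets.\<close>

lemma box_span_dense: "box_closure n = L2 (Tn n)"
proof
  show "L2 (Tn n) \<subseteq> box_closure n"
  proof
    fix f assume f: "f \<in> L2 (Tn n)"
    from borel_measurable_implies_sequence_metric[OF L2D[OF f], of 0]
    obtain F where F: "\<And>i. simple_function (Tn n) (F i)"
      "\<And>x. x \<in> space (Tn n) \<Longrightarrow> (\<lambda>i. F i x) \<longlonglongrightarrow> f x"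
      "\<And>i x. x \<in> space (Tn n) \<Longrightarrow> dist (F i x) 0 \<le> 2 * dist (f x) 0" by blast
    have "L2_tendsto (Tn n) F f"
    proof (rule L2_tendsto_dominated[where w = "\<lambda>x. 2 * f x"])
      show "(\<lambda>x. 2 * f x) \<in> L2 (Tn n)" by (rule L2_scale[OF f])
      show "F m \<in> borel_measurable (Tn n)" for m
        by (rule borel_measurable_simple_function[OF F(1)])
    qed (use L2D[OF f] F(2,3) in \<open>auto simp: abs_mult\<close>)
    moreover have "F i \<in> box_closure n" for i
    proof (rule box_closure_cong)
      let ?I = "F i ` space (Tn n)"
      show "(\<lambda>x. \<Sum>y\<in>?I. y * indicator (F i -` {y} \<inter> space (Tn n)) x) \<in> box_closure n"
        by (intro box_closure_sum indicator_in_closure simple_functionD(2)[OF F(1)])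
      fix x assume x: "x \<in> space (Tn n)"
      have "(\<Sum>y\<in>?I. y * indicator (F i -` {y} \<inter> space (Tn n)) x) = (\<Sum>y\<in>?I. if y = F i x then y else 0)"
        using x by (intro sum.cong) (auto simp: indicator_def)
      then show "F i x = (\<Sum>y\<in>?I. y * indicator (F i -` {y} \<inter> space (Tn n)) x)"
        using simple_functionD(1)[OF F(1)] x by simp
    qed
    ultimately show "f \<in> box_closure n" by (rule box_closure_limit[rotated])
  qed
qed (simp add: box_closure_def)

section \<open>Chaos expansions\<close>

context multiple_poisson_integral
begin

lemma I_measurable [measurable]: "f \<in> L2 (Tn n) \<Longrightarrow> I n f \<in> borel_measurable M"
  by (rule L2D[OF square_integrable])

lemma nsq_I: "f \<in> L2_sym n \<Longrightarrow> nsq M (I n f) = fact n * nsq (Tn n) f"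
  using isometry[of f n f n] by (simp add: power2_eq_square)

lemma I_eq_0:
  assumes "f \<in> L2_sym n" "nsq (Tn n) f = 0"
  shows "AE \<omega> in M. I n f \<omega> = 0"
  using nsq_zero_iff[OF square_integrable[OF L2_symD[OF assms(1)]]] nsq_I[OF assms(1)] assms(2) by simp

lemma I_diff:
  assumes "f \<in> L2_sym n" "g \<in> L2_sym n"
  shows "AE \<omega> in M. I n (\<lambda>x. f x - g x) \<omega> = I n f \<omega> - I n g \<omega>"
  using linear[OF assms, of 1 "-1"] by simp

lemma I_scale:
  assumes "f \<in> L2_sym n"
  shows "AE \<omega> in M. I n (\<lambda>x. c * f x) \<omega> = c * I n f \<omega>"
  using linear[OF assms assms, of c 0] by simp

text \<open>The assumptions on \<open>I\<close> concern functions, not classes. The isometry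
  annihilates the integral of a null kernel, so \<open>I\<close> descends to classes modulo null
  sets.\<close>

lemma I_cong:
  assumes "f \<in> L2_sym n" "g \<in> L2_sym n" "AE x in Tn n. f x = g x"
  shows "AE \<omega> in M. I n f \<omega> = I n g \<omega>"
proof -
  have d: "(\<lambda>x. f x - g x) \<in> L2_sym n" by (rule L2_sym_diff[OF assms(1,2)])
  have "nsq (Tn n) (\<lambda>x. f x - g x) = 0"
    using nsq_zero_iff[OF L2_symD[OF d]] assms(3) by simp
  from I_eq_0[OF d this] I_diff[OF assms(1,2)] show ?thesis
    by eventually_elim simp
qed

lemma chaos_L2:
  assumes "\<And>j. j \<in> J \<Longrightarrow> f j \<in> L2_sym (d j)"
  shows "(\<lambda>\<omega>. \<Sum>j\<in>J. I (d j) (f j) \<omega>) \<in> L2 M"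
  using assms by (intro L2_sum square_integrable L2_symD) auto

text \<open>Integrals of different degrees are orthogonal. The degrees are given by an injective
  \<open>d\<close> so that the lemma serves both chaos series, where index n has degree n, and
  Skorohod integrals, where it has degree n + 1.\<close>

lemma nsq_chaos:
  assumes J: "finite J" "inj_on d J" and f: "\<And>j. j \<in> J \<Longrightarrow> f j \<in> L2_sym (d j)"
  shows "nsq M (\<lambda>\<omega>. \<Sum>j\<in>J. I (d j) (f j) \<omega>) = (\<Sum>j\<in>J. fact (d j) * nsq (Tn (d j)) (f j))"
proof -
  have int: "integrable M (\<lambda>\<omega>. I (d i) (f i) \<omega> * I (d j) (f j) \<omega>)" if "i \<in> J" "j \<in> J" for i j
    using that f by (intro L2_mult_integrable square_integrable L2_symD) auto
  have "nsq M (\<lambda>\<omega>. \<Sum>j\<in>J. I (d j) (f j) \<omega>)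
      = (\<integral>\<omega>. (\<Sum>i\<in>J. \<Sum>j\<in>J. I (d i) (f i) \<omega> * I (d j) (f j) \<omega>) \<partial>M)"
    by (simp add: power2_eq_square sum_product)
  also have "\<dots> = (\<Sum>i\<in>J. \<Sum>j\<in>J. \<integral>\<omega>. I (d i) (f i) \<omega> * I (d j) (f j) \<omega> \<partial>M)"
    using int by (subst Bochner_Integration.integral_sum) (auto intro!: sum.cong)
  also have "\<dots> = (\<Sum>i\<in>J. \<Sum>j\<in>J. if i = j then fact (d i) * nsq (Tn (d i)) (f i) else 0)"
  proof (intro sum.cong refl)
    fix i j assume ij: "i \<in> J" "j \<in> J"
    show "(\<integral>\<omega>. I (d i) (f i) \<omega> * I (d j) (f j) \<omega> \<partial>M)
        = (if i = j then fact (d i) * nsq (Tn (d i)) (f i) else 0)"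
      using isometry[OF f[OF ij(1)] f[OF ij(2)]] inj_onD[OF J(2) _ ij]
      by (auto simp: power2_eq_square)
  qed
  also have "\<dots> = (\<Sum>j\<in>J. fact (d j) * nsq (Tn (d j)) (f j))"
    using J(1) by simp
  finally show ?thesis .
qed

definition chaos :: "(nat \<Rightarrow> (nat \<Rightarrow> real) \<Rightarrow> real) \<Rightarrow> ('a \<Rightarrow> real) \<Rightarrow> bool" where
  "chaos f F \<longleftrightarrow> (\<forall>n. f n \<in> L2_sym n) \<and> L2_tendsto M (\<lambda>m \<omega>. \<Sum>n<m. I n (f n) \<omega>) F"

lemma chaosD:
  assumes "chaos f F"
  shows "f n \<in> L2_sym n" "L2_tendsto M (\<lambda>m \<omega>. \<Sum>n<m. I n (f n) \<omega>) F"
  using assms by (auto simp: chaos_def)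

lemma chaos_diff:
  assumes "chaos f F" "chaos g G"
  shows "chaos (\<lambda>n x. f n x - g n x) (\<lambda>\<omega>. F \<omega> - G \<omega>)"
proof -
  note f = chaosD[OF assms(1)] and g = chaosD[OF assms(2)]
  have d: "(\<lambda>x. f n x - g n x) \<in> L2_sym n" for n by (rule L2_sym_diff[OF f(1) g(1)])
  have "L2_tendsto M (\<lambda>m \<omega>. \<Sum>n<m. I n (\<lambda>x. f n x - g n x) \<omega>) (\<lambda>\<omega>. F \<omega> - G \<omega>)"
  proof (rule L2_tendsto_cong_AE[OF L2_tendsto_diff[OF f(2) g(2)]])
    show "(\<lambda>\<omega>. \<Sum>n<m. I n (\<lambda>x. f n x - g n x) \<omega>) \<in> L2 M" for m
      by (rule chaos_L2[OF d])
    have "AE \<omega> in M. \<forall>n. I n (\<lambda>x. f n x - g n x) \<omega> = I n (f n) \<omega> - I n (g n) \<omega>"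
      using I_diff[OF f(1) g(1)] by (simp add: AE_all_countable)
    then show "AE \<omega> in M. (\<Sum>n<m. I n (\<lambda>x. f n x - g n x) \<omega>) =
        (\<Sum>n<m. I n (f n) \<omega>) - (\<Sum>n<m. I n (g n) \<omega>)" for m
      by eventually_elim (simp add: sum_subtractf)
  qed
  with d show ?thesis by (simp add: chaos_def)
qed

lemma chaos_scale:
  assumes "chaos f F"
  shows "chaos (\<lambda>n x. c * f n x) (\<lambda>\<omega>. c * F \<omega>)"
proof -
  note f = chaosD[OF assms]
  have d: "(\<lambda>x. c * f n x) \<in> L2_sym n" for n by (rule L2_sym_scale[OF f(1)])
  have "L2_tendsto M (\<lambda>m \<omega>. \<Sum>n<m. I n (\<lambda>x. c * f n x) \<omega>) (\<lambda>\<omega>. c * F \<omega>)"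
  proof (rule L2_tendsto_cong_AE[OF L2_tendsto_scale[OF f(2)]])
    show "(\<lambda>\<omega>. \<Sum>n<m. I n (\<lambda>x. c * f n x) \<omega>) \<in> L2 M" for m
      by (rule chaos_L2[OF d])
    have "AE \<omega> in M. \<forall>n. I n (\<lambda>x. c * f n x) \<omega> = c * I n (f n) \<omega>"
      using I_scale[OF f(1)] by (simp add: AE_all_countable)
    then show "AE \<omega> in M. (\<Sum>n<m. I n (\<lambda>x. c * f n x) \<omega>) = c * (\<Sum>n<m. I n (f n) \<omega>)" for m
      by eventually_elim (simp add: sum_distrib_left)
  qed
  with d show ?thesis by (simp add: chaos_def)
qed

text \<open>The squared norms of the partial sums increase in m and converge to that of F. A finite
  K avoids any question of summability.\<close>

lemma chaos_Bessel:
  assumes "chaos f F"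
  shows "(\<Sum>n<K. fact n * nsq (Tn n) (f n)) \<le> nsq M F"
proof (rule LIMSEQ_le_const[OF L2_tendsto_nsq[OF chaosD(2)[OF assms]]])
  show "\<exists>N. \<forall>m\<ge>N. (\<Sum>n<K. fact n * nsq (Tn n) (f n)) \<le> nsq M (\<lambda>\<omega>. \<Sum>n<m. I n (f n) \<omega>)"
  proof (intro exI allI impI)
    fix m assume "K \<le> m"
    then have "(\<Sum>n<K. fact n * nsq (Tn n) (f n)) \<le> (\<Sum>n<m. fact n * nsq (Tn n) (f n))"
      by (intro sum_mono2) auto
    also have "\<dots> = nsq M (\<lambda>\<omega>. \<Sum>n<m. I n (f n) \<omega>)"
      using nsq_chaos[of "{..<m}" "\<lambda>n. n" f] chaosD(1)[OF assms] by simp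
    finally show "(\<Sum>n<K. fact n * nsq (Tn n) (f n)) \<le> nsq M (\<lambda>\<omega>. \<Sum>n<m. I n (f n) \<omega>)" .
  qed
qed

lemma chaos_coeff_le:
  assumes "chaos f F"
  shows "fact n * nsq (Tn n) (f n) \<le> nsq M F"
proof -
  have "fact n * nsq (Tn n) (f n) \<le> (\<Sum>n<Suc n. fact n * nsq (Tn n) (f n))"
    by (rule member_le_sum) auto
  also have "\<dots> \<le> nsq M F" by (rule chaos_Bessel[OF assms])
  finally show ?thesis .
qed

text \<open>The difference of the two expansions represents 0, and the norm of each of its kernels
  is controlled by the norm of the variable represented.\<close>

lemma chaos_unique:
  assumes "chaos f F" "chaos g G" "AE \<omega> in M. F \<omega> = G \<omega>"
  shows "AE x in Tn n. f n x = g n x"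
proof -
  note d = chaos_diff[OF assms(1,2)]
  have "nsq M (\<lambda>\<omega>. F \<omega> - G \<omega>) = (\<integral>\<omega>. 0 \<partial>M)"
    by (rule integral_cong_AE)
       (use assms(3) L2D[OF L2_tendstoD(2)[OF chaosD(2)[OF d]]] in \<open>auto intro: borel_measurable_power\<close>)
  then have "fact n * nsq (Tn n) (\<lambda>x. f n x - g n x) \<le> 0"
    using chaos_coeff_le[OF d, of n] by simp
  then have "nsq (Tn n) (\<lambda>x. f n x - g n x) = 0"
    using nsq_nonneg[of "Tn n" "\<lambda>x. f n x - g n x"] using fact_gt_zero[of n, where 'a = real] by (simp add: mult_le_0_iff del: fact_gt_zero)
  then show ?thesis
    using nsq_zero_iff[OF L2_symD[OF chaosD(1)[OF d]]] by simp
qed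

lemma simple_functional_chaos:
  assumes "simple_functional M I m f F"
  shows "chaos f F"
proof -
  have f: "f n \<in> L2_sym n" and z: "n > m \<Longrightarrow> f n = (\<lambda>_. 0)" and F: "F \<in> L2 M"
    and eq: "AE \<omega> in M. F \<omega> = (\<Sum>n\<le>m. I n (f n) \<omega>)" for n
    using assms by (auto simp: simple_functional_def)
  have S: "(\<lambda>\<omega>. \<Sum>n<k. I n (f n) \<omega>) \<in> L2 M" for k by (rule chaos_L2[OF f])
  have I_zero: "AE \<omega> in M. \<forall>n. n > m \<longrightarrow> I n (f n) \<omega> = 0"
  proof (subst AE_all_countable, intro allI)
    fix n show "AE \<omega> in M. n > m \<longrightarrow> I n (f n) \<omega> = 0"
      using I_eq_0[OF f[of n]] z[of n] by (cases "n > m") auto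
  qed
  have "nsq M (\<lambda>\<omega>. (\<Sum>n<k. I n (f n) \<omega>) - F \<omega>) = 0" if k: "k \<ge> Suc m" for k
  proof (subst nsq_zero_iff[OF L2_diff[OF S F]])
    show "AE \<omega> in M. (\<Sum>n<k. I n (f n) \<omega>) - F \<omega> = 0"
      using I_zero eq
    proof eventually_elim
      fix \<omega> assume 0: "\<forall>n. n > m \<longrightarrow> I n (f n) \<omega> = 0" and F: "F \<omega> = (\<Sum>n\<le>m. I n (f n) \<omega>)"
      have "(\<Sum>n<k. I n (f n) \<omega>) = (\<Sum>n\<le>m. I n (f n) \<omega>)"
        using k 0 by (intro sum.mono_neutral_right) auto
      then show "(\<Sum>n<k. I n (f n) \<omega>) - F \<omega> = 0" using F by simp
    qed
  qed
  then have "(\<lambda>k. nsq M (\<lambda>\<omega>. (\<Sum>n<k. I n (f n) \<omega>) - F \<omega>)) \<longlonglongrightarrow> 0"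
    by (intro tendsto_eventually) (auto simp: eventually_sequentially)
  then show ?thesis using f S F by (simp add: chaos_def L2_tendsto_def)
qed

end

section \<open>The norm of the derivative\<close>

text \<open>\<open>weak_derivs\<close> puts the first derivative on \<open>Tn 1\<close>, whose
  points are functions on {0}; evaluation at 0 identifies this space with \<open>TT\<close>.\<close>

lemma distr_Tn_1: "distr (Tn 1) TT (\<lambda>\<tau>. \<tau> 0) = TT"
  unfolding Tn_def using distr_PiM_component[of "{..<1::nat}" "\<lambda>_. TT" 0] prob_space_TT
  by (simp del: One_nat_def)

lemmas measurable_Tn_1 = measurable_Tn_component[OF zero_less_one]

lemma AE_Tn_1:
  assumes "AE s in TT. P s"
  shows "AE \<tau> in Tn 1. P (\<tau> 0)"
  using AE_distrD[OF measurable_Tn_1, of P] assms unfolding distr_Tn_1 .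

lemma nn_integral_Tn_1:
  assumes "h \<in> borel_measurable TT"
  shows "(\<integral>\<^sup>+\<tau>. h (\<tau> 0) \<partial>Tn 1) = (\<integral>\<^sup>+s. h s \<partial>TT)"
  using nn_integral_distr[OF measurable_Tn_1, of h] assms unfolding distr_Tn_1 by simp

lemma L2_sym_symmetric_in_last:
  assumes "f \<in> L2_sym (Suc n)"
  shows "symmetric_in n (Suc n) f"
  unfolding symmetric_in_def
proof (intro allI impI)
  fix p assume "p permutes {..<n}"
  then have "p permutes {..<Suc n}" by (rule permutes_subset) auto
  then show "AE x in Tn (Suc n). f (x \<circ> p) = f x"
    using assms by (simp add: L2_sym_def symmetric_in_def)
qed

context multiple_poisson_integral
begin

text \<open>For fixed t the degree n kernel of D_t F is (n+1) f_{n+1}(.,t), which contributes n!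
  (n+1)^2 ||f_{n+1}(.,t)||^2 to the second moment. Integrating over t restores ||f_{n+1}||^2 by
  Fubini, and n! (n+1)^2 = (n+1) (n+1)!.\<close>

lemma nsq_simple_deriv:
  assumes F: "simple_functional M I m f F" and G: "simple_deriv M I m f 1 G"
  shows "nsq (Tn 1 \<Otimes>\<^sub>M M) G = (\<Sum>n\<le>m. real (Suc n) * fact (Suc n) * nsq (Tn (Suc n)) (f (Suc n)))"
proof -
  interpret P: pair_sigma_finite "Tn 1" M by unfold_locales
  have f: "f n \<in> L2_sym n" for n using F by (simp add: simple_functional_def)
  have GL: "G \<in> L2 (Tn 1 \<Otimes>\<^sub>M M)"
    and Geq: "AE \<tau> in Tn 1. AE \<omega> in M. G (\<tau>, \<omega>) = (\<Sum>n\<le>m. I n (iter_deriv_kernels 1 \<tau> f n) \<omega>)"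
    using G unfolding simple_deriv_def by blast+
  let ?s = "\<lambda>n \<tau>. section_at n (f (Suc n)) (\<tau> (0::nat))"
  have ker: "iter_deriv_kernels 1 \<tau> f n = (\<lambda>x. real (Suc n) * ?s n \<tau> x)" for \<tau> n
    by (simp add: deriv_kernels_def)
  have "AE s in TT. \<forall>n. section_at n (f (Suc n)) s \<in> L2_sym n"
    unfolding AE_all_countable
    using AE_section_at_L2_sym[OF L2_symD[OF f] L2_sym_symmetric_in_last[OF f]] by blast
  then have sec: "AE \<tau> in Tn 1. \<forall>n. ?s n \<tau> \<in> L2_sym n" by (rule AE_Tn_1)
  have meas: "(\<lambda>s. nsq (Tn n) (section_at n (f (Suc n)) s)) \<in> borel_measurable TT" for n
    by (rule measurable_nsq_section_at[OF L2_symD[OF f]])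
  have Gm: "(\<lambda>z. ennreal ((G z)\<^sup>2)) \<in> borel_measurable (Tn 1 \<Otimes>\<^sub>M M)"
    using L2D[OF GL] by measurable
  have "ennreal (nsq (Tn 1 \<Otimes>\<^sub>M M) G) = (\<integral>\<^sup>+z. ennreal ((G z)\<^sup>2) \<partial>(Tn 1 \<Otimes>\<^sub>M M))"
    by (rule nn_integral_nsq[OF GL, symmetric])
  also have "\<dots> = (\<integral>\<^sup>+\<tau>. \<integral>\<^sup>+\<omega>. ennreal ((G (\<tau>, \<omega>))\<^sup>2) \<partial>M \<partial>Tn 1)"
    using nn_integral_fst[OF Gm] by simp
  also have "\<dots> = (\<integral>\<^sup>+\<tau>. (\<Sum>n\<le>m. ennreal (fact n * (real (Suc n))\<^sup>2) * ennreal (nsq (Tn n) (?s n \<tau>))) \<partial>Tn 1)"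
  proof (rule nn_integral_cong_AE)
    show "AE \<tau> in Tn 1. (\<integral>\<^sup>+\<omega>. ennreal ((G (\<tau>, \<omega>))\<^sup>2) \<partial>M) =
        (\<Sum>n\<le>m. ennreal (fact n * (real (Suc n))\<^sup>2) * ennreal (nsq (Tn n) (?s n \<tau>)))"
      using Geq sec
    proof eventually_elim
      fix \<tau> assume eq: "AE \<omega> in M. G (\<tau>, \<omega>) = (\<Sum>n\<le>m. I n (iter_deriv_kernels 1 \<tau> f n) \<omega>)"
        and s: "\<forall>n. ?s n \<tau> \<in> L2_sym n"
      let ?k = "\<lambda>n x. real (Suc n) * ?s n \<tau> x"
      have k: "?k n \<in> L2_sym n" for n by (rule L2_sym_scale) (use s in blast)
      have "(\<integral>\<^sup>+\<omega>. ennreal ((G (\<tau>, \<omega>))\<^sup>2) \<partial>M) = (\<integral>\<^sup>+\<omega>. ennreal ((\<Sum>n\<le>m. I n (?k n) \<omega>)\<^sup>2) \<partial>M)"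
        by (rule nn_integral_cong_AE) (use eq in \<open>eventually_elim, simp only: ker\<close>)
      also have "\<dots> = ennreal (nsq M (\<lambda>\<omega>. \<Sum>n\<le>m. I n (?k n) \<omega>))"
        by (rule nn_integral_nsq[OF chaos_L2[OF k]])
      also have "nsq M (\<lambda>\<omega>. \<Sum>n\<le>m. I n (?k n) \<omega>) = (\<Sum>n\<le>m. fact n * nsq (Tn n) (?k n))"
        using nsq_chaos[of "{..m}" "\<lambda>n. n" ?k, OF _ _ k] by simp
      also have "\<dots> = (\<Sum>n\<le>m. fact n * (real (Suc n))\<^sup>2 * nsq (Tn n) (?s n \<tau>))"
        by (simp add: power_mult_distrib mult.assoc)
      also have "ennreal \<dots> = (\<Sum>n\<le>m. ennreal (fact n * (real (Suc n))\<^sup>2) * ennreal (nsq (Tn n) (?s n \<tau>)))"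
        by (subst sum_ennreal[symmetric]) (auto simp: ennreal_mult intro!: sum.cong)
      finally show "(\<integral>\<^sup>+\<omega>. ennreal ((G (\<tau>, \<omega>))\<^sup>2) \<partial>M) =
        (\<Sum>n\<le>m. ennreal (fact n * (real (Suc n))\<^sup>2) * ennreal (nsq (Tn n) (?s n \<tau>)))" .
    qed
  qed
  also have "\<dots> = (\<Sum>n\<le>m. ennreal (fact n * (real (Suc n))\<^sup>2) * (\<integral>\<^sup>+\<tau>. ennreal (nsq (Tn n) (?s n \<tau>)) \<partial>Tn 1))"
    using measurable_compose[OF measurable_Tn_1 meas]
    by (subst nn_integral_sum) (auto intro!: sum.cong nn_integral_cmult)
  also have "\<dots> = (\<Sum>n\<le>m. ennreal (fact n * (real (Suc n))\<^sup>2) * ennreal (nsq (Tn (Suc n)) (f (Suc n))))"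
    using meas nn_integral_nsq_section_at[OF L2_symD[OF f]]
    by (intro sum.cong refl arg_cong2[where f = "(*)"]) (subst nn_integral_Tn_1[where h = "\<lambda>s. ennreal (nsq _ (section_at _ _ s))"], auto)
  also have "\<dots> = ennreal (\<Sum>n\<le>m. fact n * (real (Suc n))\<^sup>2 * nsq (Tn (Suc n)) (f (Suc n)))"
    by (subst sum_ennreal[symmetric]) (auto simp: ennreal_mult intro!: sum.cong)
  finally have "nsq (Tn 1 \<Otimes>\<^sub>M M) G = (\<Sum>n\<le>m. fact n * (real (Suc n))\<^sup>2 * nsq (Tn (Suc n)) (f (Suc n)))"
    by (subst (asm) ennreal_inj) (auto intro!: sum_nonneg)
  then show ?thesis by (simp add: power2_eq_square algebra_simps)
qed

text \<open>The bound holds for each approximating simple functional. Convergence of these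
  functionals forces convergence of every single kernel through \<open>chaos_coeff_le\<close>, so a
  sum over finitely many n survives the limit.\<close>

lemma weak_deriv_bound:
  assumes D: "weak_derivs M I k F D" and k: "k \<ge> 1" and h: "chaos h F"
  shows "(\<Sum>n<K. real n * fact n * nsq (Tn n) (h n)) \<le> nsq (Tn 1 \<Otimes>\<^sub>M M) (D 1)"
proof -
  obtain m f S G where S: "\<And>j. simple_functional M I (m j) (f j) (S j)"
    and G': "\<And>j l. l \<in> {1..k} \<Longrightarrow> simple_deriv M I (m j) (f j) l (G j l)"
    and SF: "L2_tendsto M S F"
    and GD': "\<And>l. l \<in> {1..k} \<Longrightarrow> L2_tendsto (Tn l \<Otimes>\<^sub>M M) (\<lambda>j. G j l) (D l)"
    using D unfolding weak_derivs_def by blast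
  have "1 \<in> {1..k}" using k by simp
  note G = G'[OF this] and GD = GD'[OF this]
  have f: "f j n \<in> L2_sym n" for j n using S[of j] by (simp add: simple_functional_def)
  have lim: "(\<lambda>j. nsq (Tn n) (f j n)) \<longlonglongrightarrow> nsq (Tn n) (h n)" for n
  proof (rule L2_tendsto_nsq)
    have le: "nsq (Tn n) (\<lambda>x. f j n x - h n x) \<le> nsq M (\<lambda>\<omega>. S j \<omega> - F \<omega>)" for j
    proof -
      have "nsq (Tn n) (\<lambda>x. f j n x - h n x) \<le> fact n * nsq (Tn n) (\<lambda>x. f j n x - h n x)"
        using mult_right_mono[OF fact_ge_1[of n] nsq_nonneg[of "Tn n" "\<lambda>x. f j n x - h n x"]] by simp
      also have "\<dots> \<le> nsq M (\<lambda>\<omega>. S j \<omega> - F \<omega>)"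
        by (rule chaos_coeff_le[OF chaos_diff[OF simple_functional_chaos[OF S] h]])
      finally show ?thesis .
    qed
    have "(\<lambda>j. nsq (Tn n) (\<lambda>x. f j n x - h n x)) \<longlonglongrightarrow> 0"
      by (rule tendsto_sandwich[OF _ _ tendsto_const L2_tendstoD(3)[OF SF]])
         (auto intro!: always_eventually le)
    then show "L2_tendsto (Tn n) (\<lambda>j. f j n) (h n)"
      using f chaosD(1)[OF h] by (simp add: L2_tendsto_def L2_symD)
  qed
  have "(\<Sum>n<K. real n * fact n * nsq (Tn n) (f j n)) \<le> nsq (Tn 1 \<Otimes>\<^sub>M M) (G j 1)" for j
  proof -
    let ?a = "\<lambda>n. real n * fact n * nsq (Tn n) (f j n)"
    have z: "?a n = 0" if "n > m j" for n
      using S[of j] that by (simp add: simple_functional_def)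
    \<comment> \<open>Padding makes the range contain both the indices below K and the indices 1,
      ..., m j + 1 that \<open>nsq_simple_deriv\<close> produces. Terms beyond m j vanish with their
      kernels, and the term n = 0 vanishes through its factor n.\<close>
    have "(\<Sum>n<K. ?a n) \<le> (\<Sum>n<Suc (Suc (m j)) + K. ?a n)"
      by (rule sum_mono2) auto
    also have "\<dots> = (\<Sum>n<Suc (Suc (m j)). ?a n)"
      by (rule sum.mono_neutral_right) (auto simp: z simp del: of_nat_Suc fact_Suc)
    also have "\<dots> = (\<Sum>n\<le>m j. ?a (Suc n))"
      unfolding sum.lessThan_Suc_shift[of ?a "Suc (m j)"]
      by (simp del: of_nat_Suc fact_Suc sum.lessThan_Suc add: lessThan_Suc_atMost)
    also have "\<dots> = nsq (Tn 1 \<Otimes>\<^sub>M M) (G j 1)"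
      using nsq_simple_deriv[OF S G] by simp
    finally show ?thesis .
  qed
  then show ?thesis
    by (intro LIMSEQ_le[OF tendsto_sum[OF tendsto_mult_left[OF lim]] L2_tendsto_nsq[OF GD]]) auto
qed

text \<open>Uses n! + n n! = (n+1)!, the two summands coming from F and from its first derivative.
  The versions picked by \<open>SOME\<close> enter only through \<open>weak_derivs\<close>, so any
  choice obeys the bound.\<close>

lemma Dk2_norm_sq_ge:
  assumes F: "F \<in> Dk2 M I k" and k: "k \<ge> 1" and h: "chaos h F"
  shows "(\<Sum>n<K. fact (Suc n) * nsq (Tn n) (h n)) \<le> Dk2_norm_sq M I k F"
proof -
  define D where "D = (SOME D. weak_derivs M I k F D)"
  have D: "weak_derivs M I k F D"
    using F unfolding D_def Dk2_def by (intro someI_ex[of "weak_derivs M I k F"]) simp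
  have "(\<Sum>n<K. fact (Suc n) * nsq (Tn n) (h n)) =
      (\<Sum>n<K. fact n * nsq (Tn n) (h n)) + (\<Sum>n<K. real n * fact n * nsq (Tn n) (h n))"
    by (simp add: sum.distrib[symmetric] algebra_simps)
  also have "\<dots> \<le> nsq M F + nsq (Tn 1 \<Otimes>\<^sub>M M) (D 1)"
    by (intro add_mono chaos_Bessel[OF h] weak_deriv_bound[OF D k h])
  also have "nsq (Tn 1 \<Otimes>\<^sub>M M) (D 1) \<le> (\<Sum>l=1..k. nsq (Tn l \<Otimes>\<^sub>M M) (D l))"
    using k by (intro member_le_sum[where f = "\<lambda>l. nsq (Tn l \<Otimes>\<^sub>M M) (D l)"]) auto
  finally show ?thesis by (simp add: Dk2_norm_sq_def D_def Let_def)
qed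

end

section \<open>Skorohod integral processes\<close>

text \<open>The time variable of a process kernel is its last one, so this is the kernel of the
  process restricted to times in \<open>A\<close>.\<close>

definition cut :: "nat \<Rightarrow> real set \<Rightarrow> ((nat \<Rightarrow> real) \<Rightarrow> real) \<Rightarrow> (nat \<Rightarrow> real) \<Rightarrow> real" where
  "cut n A f = (\<lambda>x. f x * indicator A (x n))"

lemma cut_measurable:
  assumes "f \<in> borel_measurable (Tn (Suc n))" "A \<in> sets borel"
  shows "cut n A f \<in> borel_measurable (Tn (Suc n))"
  unfolding cut_def
proof (rule borel_measurable_times[OF assms(1)])
  show "(\<lambda>x. indicator A (x n)) \<in> borel_measurable (Tn (Suc n))"
    using measurable_compose[OF measurable_Tn_real[of n "Suc n"], of "indicator A" borel] assms(2) by auto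
qed

lemma cut_L2:
  assumes "f \<in> L2 (Tn (Suc n))" "A \<in> sets borel"
  shows "cut n A f \<in> L2 (Tn (Suc n))"
  by (rule L2_bound[OF assms(1) cut_measurable[OF L2D[OF assms(1)] assms(2)]])
     (auto simp: cut_def indicator_def)

text \<open>The inequality is carried along because the induction step needs it to glue two adjacent
  intervals; on its own it serves later to locate partition points in [0,1].\<close>

lemma sum_indicator_Ioc:
  fixes t :: "nat \<Rightarrow> real"
  assumes "\<And>i. i < p \<Longrightarrow> t i \<le> t (Suc i)"
  shows "t 0 \<le> t p \<and> (\<Sum>i<p. indicator {t i<..t (Suc i)} y) = (indicator {t 0<..t p} y :: real)"
  using assms
proof (induction p)
  case (Suc p)
  have IH: "t 0 \<le> t p" "(\<Sum>i<p. indicator {t i<..t (Suc i)} y) = (indicator {t 0<..t p} y :: real)"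
    using Suc.IH Suc.prems by auto
  with Suc.prems[of p] show ?case by (auto simp: indicator_def)
qed simp

text \<open>The cuts have disjoint supports in the last variable, so their squares add up pointwise
  to at most f^2.\<close>

lemma sum_nsq_cut_le:
  assumes f: "f \<in> L2 (Tn (Suc n))" and t: "\<And>i. i < p \<Longrightarrow> t i \<le> t (Suc i)"
  shows "(\<Sum>i<p. nsq (Tn (Suc n)) (cut n {t i<..t (Suc i)} f)) \<le> nsq (Tn (Suc n)) f"
proof -
  have int: "integrable (Tn (Suc n)) (\<lambda>x. (cut n {t i<..t (Suc i)} f x)\<^sup>2)" for i
    by (intro L2_integrable cut_L2 f) simp
  have "(\<Sum>i<p. nsq (Tn (Suc n)) (cut n {t i<..t (Suc i)} f)) =
      (\<integral>x. (\<Sum>i<p. (cut n {t i<..t (Suc i)} f x)\<^sup>2) \<partial>Tn (Suc n))"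
    using int by simp
  also have "\<dots> \<le> nsq (Tn (Suc n)) f"
  proof (rule integral_mono)
    show "integrable (Tn (Suc n)) (\<lambda>x. \<Sum>i<p. (cut n {t i<..t (Suc i)} f x)\<^sup>2)"
      using int by simp
    show "integrable (Tn (Suc n)) (\<lambda>x. (f x)\<^sup>2)" by (rule L2_integrable[OF f])
    fix x
    have "(\<Sum>i<p. (cut n {t i<..t (Suc i)} f x)\<^sup>2) = (f x)\<^sup>2 * (\<Sum>i<p. indicator {t i<..t (Suc i)} (x n))"
      unfolding sum_distrib_left by (intro sum.cong) (auto simp: cut_def indicator_def)
    also have "\<dots> = (f x)\<^sup>2 * indicator {t 0<..t p} (x n)"
      using sum_indicator_Ioc[of p t "x n"] t by simp
    finally show "(\<Sum>i<p. (cut n {t i<..t (Suc i)} f x)\<^sup>2) \<le> (f x)\<^sup>2"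
      by (simp add: indicator_def)
  qed
  finally show ?thesis .
qed

context multiple_poisson_integral
begin

text \<open>The Skorohod integral over the times in \<open>A\<close> of the process t ->
  I_n(f(.,t)).\<close>

definition skor :: "nat \<Rightarrow> real set \<Rightarrow> ((nat \<Rightarrow> real) \<Rightarrow> real) \<Rightarrow> 'a \<Rightarrow> real" where
  "skor n A f = I (Suc n) (symmetrization (Suc n) (cut n A f))"

lemma skor_kernel:
  "f \<in> L2 (Tn (Suc n)) \<Longrightarrow> A \<in> sets borel \<Longrightarrow> symmetrization (Suc n) (cut n A f) \<in> L2_sym (Suc n)"
  by (rule symmetrization_in_L2_sym, rule cut_L2)

lemma skor_L2: "f \<in> L2 (Tn (Suc n)) \<Longrightarrow> A \<in> sets borel \<Longrightarrow> skor n A f \<in> L2 M"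
  unfolding skor_def by (rule square_integrable, rule L2_symD, rule skor_kernel)

text \<open>Three time sets are allowed, so that linearity in the kernel and additivity in the time
  set, needed for increments, are both instances.\<close>

lemma skor_lincomb:
  assumes "f \<in> L2 (Tn (Suc n))" "g \<in> L2 (Tn (Suc n))" "A \<in> sets borel" "B \<in> sets borel" "C \<in> sets borel"
    and eq: "\<And>x. cut n C h x = a * cut n A f x + b * cut n B g x"
  shows "AE \<omega> in M. skor n C h \<omega> = a * skor n A f \<omega> + b * skor n B g \<omega>"
proof -
  have "symmetrization (Suc n) (cut n C h) =
      (\<lambda>x. a * symmetrization (Suc n) (cut n A f) x + b * symmetrization (Suc n) (cut n B g) x)"
    using eq by (simp add: symmetrization_lincomb[symmetric] fun_eq_iff cong: if_cong)
      (simp add: symmetrization_def eq)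
  then show ?thesis
    using linear[OF skor_kernel skor_kernel, OF assms(1,3,2,4), of a b] by (simp add: skor_def)
qed

lemma skor_add:
  assumes "f \<in> L2 (Tn (Suc n))" "g \<in> L2 (Tn (Suc n))" "A \<in> sets borel"
  shows "AE \<omega> in M. skor n A (\<lambda>x. f x + c * g x) \<omega> = skor n A f \<omega> + c * skor n A g \<omega>"
  using skor_lincomb[OF assms(1,2,3,3,3), of "\<lambda>x. f x + c * g x" 1 c]
  by (simp add: cut_def algebra_simps)

lemma skor_zero: "AE \<omega> in M. skor n A (\<lambda>x. 0) \<omega> = 0"
proof -
  have "symmetrization (Suc n) (cut n A (\<lambda>x. 0)) = (\<lambda>x. 0)"
    by (simp add: fun_eq_iff symmetrization_def cut_def)
  then show ?thesis using I_eq_0[OF L2_sym_zero[of "Suc n"]] by (simp add: skor_def)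
qed

lemma nsq_sum_skor_le:
  assumes h: "\<And>n. h n \<in> L2 (Tn (Suc n))" and A: "A \<in> sets borel"
  shows "nsq M (\<lambda>\<omega>. \<Sum>n<m. skor n A (h n) \<omega>) \<le>
    (\<Sum>n<m. fact (Suc n) * nsq (Tn (Suc n)) (cut n A (h n)))"
proof -
  have "nsq M (\<lambda>\<omega>. \<Sum>n<m. skor n A (h n) \<omega>) =
      (\<Sum>n<m. fact (Suc n) * nsq (Tn (Suc n)) (symmetrization (Suc n) (cut n A (h n))))"
    unfolding skor_def by (rule nsq_chaos) (auto intro: skor_kernel[OF h A])
  also have "\<dots> \<le> (\<Sum>n<m. fact (Suc n) * nsq (Tn (Suc n)) (cut n A (h n)))"
    by (intro sum_mono mult_left_mono nsq_symmetrization_le cut_L2 h A) simp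
  finally show ?thesis .
qed

definition skor_process :: "(nat \<Rightarrow> (nat \<Rightarrow> real) \<Rightarrow> real) \<Rightarrow> (real \<Rightarrow> 'a \<Rightarrow> real) \<Rightarrow> bool" where
  "skor_process f X \<longleftrightarrow> (\<forall>n. f n \<in> L2 (Tn (Suc n))) \<and>
     (\<forall>t\<in>{0..1}. L2_tendsto M (\<lambda>m \<omega>. \<Sum>n<m. skor n {0..t} (f n) \<omega>) (X t))"

lemma skor_processD:
  assumes "skor_process f X"
  shows "f n \<in> L2 (Tn (Suc n))"
    and "t \<in> {0..1} \<Longrightarrow> L2_tendsto M (\<lambda>m \<omega>. \<Sum>n<m. skor n {0..t} (f n) \<omega>) (X t)"
  using assms by (auto simp: skor_process_def)

lemma skor_process_diff:
  assumes "skor_process f X" "skor_process g Y"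
  shows "skor_process (\<lambda>n x. f n x - g n x) (\<lambda>t \<omega>. X t \<omega> - Y t \<omega>)"
  unfolding skor_process_def
proof (intro conjI allI ballI)
  note f = skor_processD[OF assms(1)] and g = skor_processD[OF assms(2)]
  show d: "(\<lambda>x. f n x - g n x) \<in> L2 (Tn (Suc n))" for n by (intro L2_diff f g)
  fix t :: real assume t: "t \<in> {0..1}"
  show "L2_tendsto M (\<lambda>m \<omega>. \<Sum>n<m. skor n {0..t} (\<lambda>x. f n x - g n x) \<omega>) (\<lambda>\<omega>. X t \<omega> - Y t \<omega>)"
  proof (rule L2_tendsto_cong_AE[OF L2_tendsto_diff[OF f(2)[OF t] g(2)[OF t]]])
    show "(\<lambda>\<omega>. \<Sum>n<m. skor n {0..t} (\<lambda>x. f n x - g n x) \<omega>) \<in> L2 M" for m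
      by (intro L2_sum skor_L2 d) simp
    have "AE \<omega> in M. \<forall>n. skor n {0..t} (\<lambda>x. f n x - g n x) \<omega> = skor n {0..t} (f n) \<omega> - skor n {0..t} (g n) \<omega>"
      unfolding AE_all_countable using skor_add[OF f(1) g(1), where A = "{0..t}" and c = "-1"] by simp
    then show "AE \<omega> in M. (\<Sum>n<m. skor n {0..t} (\<lambda>x. f n x - g n x) \<omega>) =
        (\<Sum>n<m. skor n {0..t} (f n) \<omega>) - (\<Sum>n<m. skor n {0..t} (g n) \<omega>)" for m
      by eventually_elim (simp add: sum_subtractf)
  qed
qed

lemma skor_process_increment:
  assumes f: "skor_process f X" and st: "0 \<le> s" "s \<le> t" "t \<le> 1"
  shows "L2_tendsto M (\<lambda>m \<omega>. \<Sum>n<m. skor n {s<..t} (f n) \<omega>) (\<lambda>\<omega>. X t \<omega> - X s \<omega>)"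
proof -
  note F = skor_processD[OF f]
  show ?thesis
  proof (rule L2_tendsto_cong_AE[OF L2_tendsto_diff[OF F(2) F(2)]])
    show "t \<in> {0..1}" "s \<in> {0..1}" using st by auto
    show "(\<lambda>\<omega>. \<Sum>n<m. skor n {s<..t} (f n) \<omega>) \<in> L2 M" for m
      by (intro L2_sum skor_L2 F) simp
    have "AE \<omega> in M. \<forall>n. skor n {s<..t} (f n) \<omega> = skor n {0..t} (f n) \<omega> - skor n {0..s} (f n) \<omega>"
      unfolding AE_all_countable
    proof
      fix n
      have "cut n {s<..t} (f n) x = 1 * cut n {0..t} (f n) x + (-1) * cut n {0..s} (f n) x" for x
        using st by (auto simp: cut_def indicator_def)
      then show "AE \<omega> in M. skor n {s<..t} (f n) \<omega> = skor n {0..t} (f n) \<omega> - skor n {0..s} (f n) \<omega>"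
        using skor_lincomb[OF F(1) F(1), of "{0..t}" "{0..s}" "{s<..t}" n "f n" 1 "-1"] by simp
    qed
    then show "AE \<omega> in M. (\<Sum>n<m. skor n {s<..t} (f n) \<omega>) =
        (\<Sum>n<m. skor n {0..t} (f n) \<omega>) - (\<Sum>n<m. skor n {0..s} (f n) \<omega>)" for m
      by eventually_elim (simp add: sum_subtractf)
  qed
qed

lemma V_skor_process_le:
  assumes Y: "skor_process h Y" and sm: "summable (\<lambda>n. fact (Suc n) * nsq (Tn (Suc n)) (h n))"
  shows "V M Y \<le> ennreal (\<Sum>n. fact (Suc n) * nsq (Tn (Suc n)) (h n))"
  unfolding V_def
proof (rule SUP_least, clarify)
  fix p and t :: "nat \<Rightarrow> real" assume "(p, t) \<in> unit_partitions"
  then have t0: "t 0 = 0" and tp: "t p = 1" and inc: "\<And>i. i < p \<Longrightarrow> t i < t (Suc i)"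
    by (auto simp: unit_partitions_def)
  let ?a = "\<lambda>n. fact (Suc n) * nsq (Tn (Suc n)) (h n)"
  let ?S = "\<lambda>i m \<omega>. \<Sum>n<m. skor n {t i<..t (Suc i)} (h n) \<omega>"
  let ?d = "\<lambda>i \<omega>. Y (t (Suc i)) \<omega> - Y (t i) \<omega>"
  note H = skor_processD(1)[OF Y]
  have ge: "0 \<le> t i" if "i \<le> p" for i
  proof -
    have "t 0 \<le> t i"
      by (rule conjunct1[OF sum_indicator_Ioc]) (use inc that in \<open>simp add: less_imp_le\<close>)
    then show ?thesis using t0 by simp
  qed
  \<comment> \<open>The gluing lemma again, applied to the partition shifted by i.\<close>
  have le: "t i \<le> 1" if "i \<le> p" for i
  proof -
    have "t (i + 0) \<le> t (i + (p - i))"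
      by (rule conjunct1[OF sum_indicator_Ioc[of "p - i" "\<lambda>j. t (i + j)"]])
         (use inc that in \<open>simp add: less_imp_le\<close>)
    then show ?thesis using tp that by simp
  qed
  have lim: "L2_tendsto M (?S i) (?d i)" if "i < p" for i
    using that inc[OF that] ge[of i] le[of "Suc i"] by (intro skor_process_increment[OF Y]) auto
  \<comment> \<open>Uniform in m and in the partition. Truncation comes first because the isometry
    computes norms of finite sums; \<open>sum_le\<close> then lets m tend to infinity in the
    finitely many increments.\<close>
  have le_S: "(\<Sum>i<p. nsq M (?S i m)) \<le> suminf ?a" for m
  proof -
    have "(\<Sum>i<p. nsq M (?S i m)) \<le>
        (\<Sum>i<p. \<Sum>n<m. fact (Suc n) * nsq (Tn (Suc n)) (cut n {t i<..t (Suc i)} (h n)))"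
      by (intro sum_mono nsq_sum_skor_le H) simp
    also have "\<dots> = (\<Sum>n<m. fact (Suc n) * (\<Sum>i<p. nsq (Tn (Suc n)) (cut n {t i<..t (Suc i)} (h n))))"
      by (subst sum.swap) (simp add: sum_distrib_left)
    also have "\<dots> \<le> (\<Sum>n<m. ?a n)"
      by (intro sum_mono mult_left_mono sum_nsq_cut_le H less_imp_le[OF inc]) auto
    also have "\<dots> \<le> suminf ?a"
      by (intro sum_le_suminf sm) auto
    finally show ?thesis .
  qed
  have sum_le: "(\<Sum>i<p. nsq M (?d i)) \<le> suminf ?a"
  proof (rule LIMSEQ_le_const2)
    show "(\<lambda>m. \<Sum>i<p. nsq M (?S i m)) \<longlonglongrightarrow> (\<Sum>i<p. nsq M (?d i))"
      by (intro tendsto_sum L2_tendsto_nsq lim) simp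
  qed (use le_S in blast)
  have dL: "?d i \<in> L2 M" if "i < p" for i using L2_tendstoD(2)[OF lim[OF that]] .
  have "(\<integral>\<^sup>+\<omega>. ennreal (\<Sum>i<p. (?d i \<omega>)\<^sup>2) \<partial>M) = (\<integral>\<^sup>+\<omega>. (\<Sum>i<p. ennreal ((?d i \<omega>)\<^sup>2)) \<partial>M)"
    by (simp add: sum_ennreal)
  also have "\<dots> = (\<Sum>i<p. \<integral>\<^sup>+\<omega>. ennreal ((?d i \<omega>)\<^sup>2) \<partial>M)"
    using L2D[OF dL] by (intro nn_integral_sum) (auto intro!: measurable_compose[OF _ measurable_ennreal] borel_measurable_power)
  also have "\<dots> = (\<Sum>i<p. ennreal (nsq M (?d i)))"
    by (intro sum.cong refl nn_integral_nsq dL) simp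
  also have "\<dots> \<le> ennreal (suminf ?a)"
    using ennreal_leI[OF sum_le] by (simp only: sum_ennreal nsq_nonneg)
  finally show "(\<integral>\<^sup>+\<omega>. ennreal (\<Sum>i<p. (Y (t (Suc i)) \<omega> - Y (t i) \<omega>)\<^sup>2) \<partial>M) \<le> ennreal (suminf ?a)" .
qed

lemma section_at_cut: "section_at n (cut n A f) s = (\<lambda>x. indicator A s * section_at n f s x)"
  by (simp add: section_at_def cut_def fun_eq_iff)

lemma nsq_diff_eq_0_if_sections_eq:
  assumes "f \<in> L2 (Tn (Suc n))" "g \<in> L2 (Tn (Suc n))"
    and eq: "AE s in TT. AE x in Tn n. section_at n f s x = section_at n g s x"
  shows "nsq (Tn (Suc n)) (\<lambda>x. f x - g x) = 0"
proof -
  have d: "(\<lambda>x. f x - g x) \<in> L2 (Tn (Suc n))" by (rule L2_diff[OF assms(1,2)])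
  have "ennreal (nsq (Tn (Suc n)) (\<lambda>x. f x - g x)) =
      (\<integral>\<^sup>+s. ennreal (nsq (Tn n) (section_at n (\<lambda>x. f x - g x) s)) \<partial>TT)"
    by (rule nn_integral_nsq_section_at[OF d, symmetric])
  also have "\<dots> = (\<integral>\<^sup>+s. 0 \<partial>TT)"
    using eq AE_section_at_L2[OF d]
  proof (intro nn_integral_cong_AE, eventually_elim)
    fix s assume e: "AE x in Tn n. section_at n f s x = section_at n g s x"
      and L: "section_at n (\<lambda>x. f x - g x) s \<in> L2 (Tn n)"
    have "AE x in Tn n. section_at n (\<lambda>x. f x - g x) s x = 0"
      using e by eventually_elim (simp add: section_at_def)
    then show "ennreal (nsq (Tn n) (section_at n (\<lambda>x. f x - g x) s)) = 0"
      using nsq_zero_iff[OF L] by simp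
  qed
  finally show ?thesis by (simp add: ennreal_eq_0_iff nsq_nonneg antisym)
qed

lemma I_symmetrization_cong:
  assumes "f \<in> L2 (Tn n)" "g \<in> L2 (Tn n)" "nsq (Tn n) (\<lambda>x. f x - g x) = 0"
  shows "AE \<omega> in M. I n (symmetrization n f) \<omega> = I n (symmetrization n g) \<omega>"
proof (rule I_cong[OF symmetrization_in_L2_sym[OF assms(1)] symmetrization_in_L2_sym[OF assms(2)]])
  have d: "(\<lambda>x. symmetrization n f x - symmetrization n g x) \<in> L2 (Tn n)"
    by (intro L2_diff L2_symmetrization assms)
  have "symmetrization n (\<lambda>x. f x - g x) = (\<lambda>x. symmetrization n f x - symmetrization n g x)"
    using symmetrization_lincomb[of n 1 f "-1" g] by (simp add: fun_eq_iff)
  then have "nsq (Tn n) (\<lambda>x. symmetrization n f x - symmetrization n g x) \<le> 0"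
    using nsq_symmetrization_le[OF L2_diff[OF assms(1,2)]] assms(3) by simp
  then have "nsq (Tn n) (\<lambda>x. symmetrization n f x - symmetrization n g x) = 0"
    by (intro antisym nsq_nonneg)
  then show "AE x in Tn n. symmetrization n f x = symmetrization n g x"
    using nsq_zero_iff[OF d] by simp
qed

text \<open>At t = 1 the given kernels are those of u itself. For any other t, uniqueness of the
  chaos expansion of u_s at almost every s forces the given kernels to agree with the cut of that
  one family. Summability comes from integrating \<open>Dk2_norm_sq_ge\<close> over s.\<close>

lemma skorohod_kernels:
  assumes k: "k \<ge> 1" and u: "u \<in> Lk2 M I k"
    and X: "\<And>t. t \<in> {0..1} \<Longrightarrow> has_skorohod_integral M I (\<lambda>s \<omega>. u s \<omega> * indicator {0..t} s) (X t)"
  obtains f where "skor_process f X" "summable (\<lambda>n. fact (Suc n) * nsq (Tn (Suc n)) (f n))"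
proof -
  define ker where "ker t f \<longleftrightarrow> (\<forall>n. f n \<in> L2 (Tn (Suc n)) \<and> symmetric_in n (Suc n) (f n)) \<and>
      (AE s in TT. L2_tendsto M (\<lambda>m \<omega>. \<Sum>n<m. I n (section_at n (f n) s) \<omega>)
        (\<lambda>\<omega>. u s \<omega> * indicator {0..t} s)) \<and>
      L2_tendsto M (\<lambda>m \<omega>. \<Sum>n<m. I (Suc n) (symmetrization (Suc n) (f n)) \<omega>) (X t)" for t f
  have ex: "\<exists>f. ker t f" if "t \<in> {0..1}" for t
    using X[OF that] unfolding has_skorohod_integral_def ker_def by blast
  have ker_chaos: "AE s in TT. chaos (\<lambda>n. section_at n (f n) s) (\<lambda>\<omega>. u s \<omega> * indicator {0..t} s)"
    if "ker t f" for t f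
  proof -
    have "AE s in TT. \<forall>n. section_at n (f n) s \<in> L2_sym n"
      unfolding AE_all_countable
    proof
      fix n show "AE s in TT. section_at n (f n) s \<in> L2_sym n"
        by (rule AE_section_at_L2_sym) (use that in \<open>simp_all add: ker_def\<close>)
    qed
    moreover have "AE s in TT. L2_tendsto M (\<lambda>m \<omega>. \<Sum>n<m. I n (section_at n (f n) s) \<omega>)
        (\<lambda>\<omega>. u s \<omega> * indicator {0..t} s)"
      using that by (simp add: ker_def)
    ultimately show ?thesis by eventually_elim (simp add: chaos_def)
  qed
  \<comment> \<open>On T the indicator of {0..1} is 1, so these kernels expand u.\<close>
  obtain f where f: "ker 1 f" using ex[of 1] by auto
  have fL: "f n \<in> L2 (Tn (Suc n))" for n using f by (simp add: ker_def)
  have f_chaos: "AE s in TT. chaos (\<lambda>n. section_at n (f n) s) (u s)"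
    using ker_chaos[OF f] AE_space by eventually_elim simp
  have "skor_process f X"
    unfolding skor_process_def
  proof (intro conjI allI ballI fL)
    fix t :: real assume t: "t \<in> {0..1}"
    then obtain g where g: "ker t g" using ex by blast
    have gL: "g n \<in> L2 (Tn (Suc n))" for n using g by (simp add: ker_def)
    have eq: "AE s in TT. \<forall>n. AE x in Tn n. section_at n (cut n {0..t} (f n)) s x = section_at n (g n) s x"
      using f_chaos ker_chaos[OF g]
    proof eventually_elim
      fix s assume 1: "chaos (\<lambda>n. section_at n (f n) s) (u s)"
        and 2: "chaos (\<lambda>n. section_at n (g n) s) (\<lambda>\<omega>. u s \<omega> * indicator {0..t} s)"
      show "\<forall>n. AE x in Tn n. section_at n (cut n {0..t} (f n)) s x = section_at n (g n) s x"
        using chaos_unique[OF chaos_scale[OF 1, of "indicator {0..t} s"] 2]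
        by (simp add: section_at_cut mult.commute)
    qed
    have "nsq (Tn (Suc n)) (\<lambda>x. cut n {0..t} (f n) x - g n x) = 0" for n
      by (intro nsq_diff_eq_0_if_sections_eq cut_L2 fL gL) (use eq in \<open>auto simp: AE_all_countable\<close>)
    then have "AE \<omega> in M. \<forall>n. skor n {0..t} (f n) \<omega> = I (Suc n) (symmetrization (Suc n) (g n)) \<omega>"
      unfolding skor_def AE_all_countable by (intro allI I_symmetrization_cong cut_L2 fL gL) auto
    then have AE_eq: "AE \<omega> in M. (\<Sum>n<m. skor n {0..t} (f n) \<omega>) =
        (\<Sum>n<m. I (Suc n) (symmetrization (Suc n) (g n)) \<omega>)" for m
      by eventually_elim simp
    have "L2_tendsto M (\<lambda>m \<omega>. \<Sum>n<m. I (Suc n) (symmetrization (Suc n) (g n)) \<omega>) (X t)"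
      using g by (simp add: ker_def)
    then show "L2_tendsto M (\<lambda>m \<omega>. \<Sum>n<m. skor n {0..t} (f n) \<omega>) (X t)"
      by (rule L2_tendsto_cong_AE[OF _ L2_sum[OF skor_L2[OF fL]] AE_eq]) simp
  qed
  moreover have "summable (\<lambda>n. fact (Suc n) * nsq (Tn (Suc n)) (f n))"
  proof (rule summableI_nonneg_bounded)
    let ?C = "\<integral>\<^sup>+s. ennreal (Dk2_norm_sq M I k (u s)) \<partial>TT"
    have C: "?C < \<infinity>" using u by (simp add: Lk2_def)
    have uD: "AE s in TT. u s \<in> Dk2 M I k" using u by (simp add: Lk2_def)
    fix K
    have "ennreal (\<Sum>n<K. fact (Suc n) * nsq (Tn (Suc n)) (f n)) =
        (\<Sum>n<K. ennreal (fact (Suc n)) * ennreal (nsq (Tn (Suc n)) (f n)))"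
      by (subst sum_ennreal[symmetric]) (auto simp: ennreal_mult simp del: fact_Suc)
    also have "\<dots> = (\<Sum>n<K. ennreal (fact (Suc n)) * (\<integral>\<^sup>+s. ennreal (nsq (Tn n) (section_at n (f n) s)) \<partial>TT))"
      by (simp only: nn_integral_nsq_section_at[OF fL])
    also have "\<dots> = (\<integral>\<^sup>+s. (\<Sum>n<K. ennreal (fact (Suc n)) * ennreal (nsq (Tn n) (section_at n (f n) s))) \<partial>TT)"
      using measurable_compose[OF measurable_nsq_section_at[OF fL] measurable_ennreal]
      by (subst nn_integral_sum) (auto intro!: sum.cong nn_integral_cmult[symmetric] simp del: fact_Suc)
    also have "\<dots> \<le> ?C"
      using f_chaos uD
    proof (intro nn_integral_mono_AE, eventually_elim)
      fix s assume c: "chaos (\<lambda>n. section_at n (f n) s) (u s)" and D: "u s \<in> Dk2 M I k"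
      have "(\<Sum>n<K. ennreal (fact (Suc n)) * ennreal (nsq (Tn n) (section_at n (f n) s))) =
          ennreal (\<Sum>n<K. fact (Suc n) * nsq (Tn n) (section_at n (f n) s))"
        by (subst sum_ennreal[symmetric]) (auto simp: ennreal_mult simp del: fact_Suc)
      also have "\<dots> \<le> ennreal (Dk2_norm_sq M I k (u s))"
        by (intro ennreal_leI Dk2_norm_sq_ge[OF D k c])
      finally show "(\<Sum>n<K. ennreal (fact (Suc n)) * ennreal (nsq (Tn n) (section_at n (f n) s)))
          \<le> ennreal (Dk2_norm_sq M I k (u s))" .
    qed
    finally have "ennreal (\<Sum>n<K. fact (Suc n) * nsq (Tn (Suc n)) (f n)) \<le> ?C" .
    then have "ennreal (\<Sum>n<K. fact (Suc n) * nsq (Tn (Suc n)) (f n)) \<le> ennreal (enn2real ?C)"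
      using C by simp
    then show "(\<Sum>n<K. fact (Suc n) * nsq (Tn (Suc n)) (f n)) \<le> enn2real ?C"
      by (subst (asm) ennreal_le_iff) simp_all
  qed simp
  ultimately show ?thesis by (rule that)
qed

end

section \<open>The path measures\<close>

text \<open>A Dynkin class argument in B, starting from half-lines. The set \<open>C x\<close> may
  depend on the parameter so that a cut {0..t} can vary when measurability is wanted jointly in t
  and omega.\<close>

lemma measurable_kernel:
  fixes K :: "'x \<Rightarrow> real measure" and C :: "'x \<Rightarrow> real set"
  assumes K: "\<And>x. finite_measure (K x)" "\<And>x. sets (K x) = sets borel" and C: "\<And>x. C x \<in> sets borel"
    and base: "\<And>a. (\<lambda>x. measure (K x) ({..a} \<inter> C x)) \<in> borel_measurable G"
    and B: "B \<in> sets borel"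
  shows "(\<lambda>x. measure (K x) (B \<inter> C x)) \<in> borel_measurable G"
proof -
  \<comment> \<open>The mass of \<open>C x\<close> itself must be measurable before complements can
    be treated by subtraction; half-lines exhaust it.\<close>
  have UNIV: "(\<lambda>x. measure (K x) (C x)) \<in> borel_measurable G"
  proof (rule borel_measurable_LIMSEQ_real)
    show "(\<lambda>x. measure (K x) ({..real i} \<inter> C x)) \<in> borel_measurable G" for i by (rule base)
    fix x
    interpret finite_measure "K x" by (rule K)
    have "(\<lambda>i. measure (K x) ({..real i} \<inter> C x)) \<longlonglongrightarrow> measure (K x) (\<Union>i. {..real i} \<inter> C x)"
      by (rule finite_Lim_measure_incseq) (auto simp: incseq_def K C)
    also have "(\<Union>i. {..real i} \<inter> C x) = C x"
      using real_arch_simple by auto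
    finally show "(\<lambda>i. measure (K x) ({..real i} \<inter> C x)) \<longlonglongrightarrow> measure (K x) (C x)" .
  qed
  have sets: "sets borel = sigma_sets UNIV (range (\<lambda>a::real. {..a}))"
    unfolding borel_eq_atMost by (rule sets_measure_of) simp
  have stable: "Int_stable (range (\<lambda>a::real. {..a}))"
    by (auto simp: Int_stable_def)
  have sub: "range (\<lambda>a::real. {..a}) \<subseteq> Pow UNIV" by simp
  from stable sub B[unfolded sets] show ?thesis
  proof (induction rule: sigma_sets_induct_disjoint)
    case (basic A)
    then show ?case using base by auto
  next
    case empty
    then show ?case by simp
  next
    case (compl A)
    have A: "A \<in> sets borel" using compl.hyps sets by simp
    have "measure (K x) ((UNIV - A) \<inter> C x) = measure (K x) (C x) - measure (K x) (A \<inter> C x)" for x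
    proof -
      interpret finite_measure "K x" by (rule K)
      have "(UNIV - A) \<inter> C x = C x - A \<inter> C x" by blast
      moreover have "measure (K x) (C x - A \<inter> C x) = measure (K x) (C x) - measure (K x) (A \<inter> C x)"
        by (rule finite_measure_Diff) (use sets.Int[OF A C[of x]] C in \<open>simp_all add: K\<close>)
      ultimately show ?thesis by simp
    qed
    then show ?case using UNIV compl.IH by simp
  next
    case (union A)
    have A: "A i \<in> sets borel" for i
      using union.hyps(2) unfolding sets by (auto dest: range_subsetD)
    have "measure (K x) ((\<Union>i. A i) \<inter> C x) = (\<Sum>i. measure (K x) (A i \<inter> C x))" for x
    proof -
      interpret finite_measure "K x" by (rule K)
      have "(\<lambda>i. measure (K x) (A i \<inter> C x)) sums measure (K x) (\<Union>i. A i \<inter> C x)"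
      proof (rule finite_measure_UNION)
        show "range (\<lambda>i. A i \<inter> C x) \<subseteq> sets (K x)"
          using sets.Int[OF A C[of x]] K(2)[of x] by blast
        show "disjoint_family (\<lambda>i. A i \<inter> C x)"
          using union.hyps(1) unfolding disjoint_family_on_def by blast
      qed
      then show ?thesis by (simp add: sums_iff)
    qed
    then show ?case using union.IH by simp
  qed
qed

lemma measurable_kernel_nn_integral:
  fixes K :: "'x \<Rightarrow> real measure"
  assumes K: "\<And>x. finite_measure (K x)" "\<And>x. sets (K x) = sets borel"
    and base: "\<And>B. B \<in> sets borel \<Longrightarrow> (\<lambda>x. measure (K x) (B \<inter> A)) \<in> borel_measurable G"
    and A: "A \<in> sets borel" and h: "h \<in> borel_measurable borel"
  shows "(\<lambda>x. \<integral>\<^sup>+s. h s * indicator A s \<partial>K x) \<in> borel_measurable G"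
proof -
  have meas_K: "borel_measurable (K x) = borel_measurable borel" for x
    by (rule measurable_cong_sets[OF K(2) refl])
  have ind: "indicator A \<in> borel_measurable borel" by (rule borel_measurable_indicator[OF A])
  have m: "(\<lambda>s. u s * indicator A s) \<in> borel_measurable (K x)"
    if "u \<in> borel_measurable borel" for u :: "real \<Rightarrow> ennreal" and x
    unfolding meas_K by (rule borel_measurable_times_ennreal[OF that ind])
  show ?thesis
    using h
  proof (induction rule: borel_measurable_induct)
    case (set B)
    have "(\<integral>\<^sup>+s. indicator B s * indicator A s \<partial>K x) = ennreal (measure (K x) (B \<inter> A))" for x
    proof -
      interpret finite_measure "K x" by (rule K)
      have "(\<integral>\<^sup>+s. indicator B s * indicator A s \<partial>K x) = (\<integral>\<^sup>+s. indicator (B \<inter> A) s \<partial>K x)"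
        by (intro nn_integral_cong) (simp add: indicator_def)
      also have "\<dots> = emeasure (K x) (B \<inter> A)"
        by (rule nn_integral_indicator) (use sets.Int[OF set A] K(2)[of x] in simp)
      finally show ?thesis by (simp add: emeasure_eq_measure)
    qed
    then show ?case using base[OF set] by simp
  next
    case (cong f g)
    then have "f = g" by (intro ext) simp
    then show ?case using cong by simp
  next
    case (mult u c)
    have "(\<integral>\<^sup>+s. c * u s * indicator A s \<partial>K x) = c * (\<integral>\<^sup>+s. u s * indicator A s \<partial>K x)" for x
      unfolding mult.assoc by (rule nn_integral_cmult[OF m[OF mult.hyps(2)]])
    then show ?case using mult.IH by simp
  next
    case (add u v)
    have "(\<integral>\<^sup>+s. (v s + u s) * indicator A s \<partial>K x) =
        (\<integral>\<^sup>+s. v s * indicator A s \<partial>K x) + (\<integral>\<^sup>+s. u s * indicator A s \<partial>K x)" for x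
      unfolding distrib_right by (rule nn_integral_add[OF m m]) (rule add.hyps)+
    then show ?case using add.IH by simp
  next
    case (seq U)
    have "(\<integral>\<^sup>+s. (SUP i. U i) s * indicator A s \<partial>K x) = (SUP i. \<integral>\<^sup>+s. U i s * indicator A s \<partial>K x)" for x
    proof -
      have "(\<integral>\<^sup>+s. (SUP i. U i) s * indicator A s \<partial>K x) = (\<integral>\<^sup>+s. (SUP i. U i s * indicator A s) \<partial>K x)"
        by (simp add: SUP_mult_right_ennreal image_comp)
      also have "\<dots> = (SUP i. \<integral>\<^sup>+s. U i s * indicator A s \<partial>K x)"
      proof (rule nn_integral_monotone_convergence_SUP)
        show "incseq (\<lambda>i s. U i s * indicator A s)"
          using seq.hyps(3) by (auto simp: incseq_def le_fun_def intro!: mult_right_mono)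
      qed (rule m[OF seq.hyps(1)])
      finally show ?thesis .
    qed
    then show ?case using seq.IH by simp
  qed
qed

lemma measurable_kernel_integral:
  fixes K :: "'x \<Rightarrow> real measure" and h :: "real \<Rightarrow> real"
  assumes K: "\<And>x. finite_measure (K x)" "\<And>x. sets (K x) = sets borel"
    and base: "\<And>B. B \<in> sets borel \<Longrightarrow> (\<lambda>x. measure (K x) (B \<inter> A)) \<in> borel_measurable G"
    and A: "A \<in> sets borel" and h: "h \<in> borel_measurable borel"
  shows "(\<lambda>x. \<integral>s. h s * indicator A s \<partial>K x) \<in> borel_measurable G"
proof -
  let ?P = "\<lambda>g x. \<integral>\<^sup>+s. ennreal (g s) * indicator A s \<partial>K x"
  have meas: "?P g \<in> borel_measurable G" if "g \<in> borel_measurable borel" for g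
    using that by (intro measurable_kernel_nn_integral K base A) auto
  have m: "(\<lambda>s. h s * indicator A s) \<in> borel_measurable (K x)" for x
    unfolding measurable_cong_sets[OF K(2) refl]
    by (rule borel_measurable_times[OF h borel_measurable_indicator[OF A]])
  \<comment> \<open>The Bochner integral of a function that is not integrable is 0 by convention, so
    this case needs its own measurable branch.\<close>
  have eq: "(\<integral>s. h s * indicator A s \<partial>K x) =
      (if ?P (\<lambda>s. \<bar>h s\<bar>) x < \<infinity> then enn2real (?P h x) - enn2real (?P (\<lambda>s. - h s) x) else 0)" for x
  proof -
    have "(\<integral>\<^sup>+s. ennreal (norm (h s * indicator A s)) \<partial>K x) = ?P (\<lambda>s. \<bar>h s\<bar>) x"
      by (intro nn_integral_cong) (simp add: indicator_def)
    then have iff: "integrable (K x) (\<lambda>s. h s * indicator A s) \<longleftrightarrow> ?P (\<lambda>s. \<bar>h s\<bar>) x < \<infinity>"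
      using m[of x] unfolding integrable_iff_bounded by simp
    have P: "?P h x = (\<integral>\<^sup>+s. ennreal (h s * indicator A s) \<partial>K x)"
      "?P (\<lambda>s. - h s) x = (\<integral>\<^sup>+s. ennreal (- (h s * indicator A s)) \<partial>K x)"
      by (intro nn_integral_cong, simp add: indicator_def)+
    show ?thesis
    proof (cases "integrable (K x) (\<lambda>s. h s * indicator A s)")
      case True
      then show ?thesis
        unfolding real_lebesgue_integral_def[OF True] P by (simp only: iff if_True)
    next
      case False
      then show ?thesis
        unfolding not_integrable_integral_eq[OF False] by (simp only: iff if_False)
    qed
  qed
  have [measurable]: "?P (\<lambda>s. \<bar>h s\<bar>) \<in> borel_measurable G" "?P h \<in> borel_measurable G"
    "?P (\<lambda>s. - h s) \<in> borel_measurable G"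
    using h by (auto intro!: meas)
  show ?thesis unfolding eq by measurable
qed

section \<open>A regular version of the path and its Stieltjes measure\<close>

context standard_poisson_space
begin

lemma complete_M: "complete_measure M"
  by (subst generated) (rule completion.complete_measure_axioms)

lemma null_sets_M_subset: "A \<subseteq> B \<Longrightarrow> B \<in> null_sets M \<Longrightarrow> A \<in> null_sets M"
  by (rule complete_measure.complete2[OF complete_M])

text \<open>No measurability of f is presupposed: by completeness every subset of the exceptional
  set is a null set, and G contains all null sets.\<close>

lemma borel_measurable_cong_AE_null:
  fixes f g :: "'a \<Rightarrow> real"
  assumes G: "subalgebra M G" "null_sets M \<subseteq> sets G" and g: "g \<in> borel_measurable G"
    and eq: "AE \<omega> in M. f \<omega> = g \<omega>"
  shows "f \<in> borel_measurable G"
proof (rule measurableI)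
  have sp: "space G = space M" using G(1) by (simp add: subalgebra_def)
  let ?E = "{\<omega> \<in> space M. f \<omega> \<noteq> g \<omega>}"
  have E: "?E \<in> null_sets M"
    using eq complete_measure.AE_iff_null_sets[OF complete_M, of "\<lambda>\<omega>. f \<omega> = g \<omega>"] by simp
  fix B :: "real set" assume B: "B \<in> sets borel"
  have "f -` B \<inter> space G = (g -` B \<inter> space G - {\<omega> \<in> ?E. g \<omega> \<in> B}) \<union> {\<omega> \<in> ?E. f \<omega> \<in> B}"
    by (auto simp: sp)
  moreover have "{\<omega> \<in> ?E. g \<omega> \<in> B} \<in> sets G" "{\<omega> \<in> ?E. f \<omega> \<in> B} \<in> sets G"
    using null_sets_M_subset[of "{\<omega> \<in> ?E. g \<omega> \<in> B}" ?E] null_sets_M_subset[of "{\<omega> \<in> ?E. f \<omega> \<in> B}" ?E] E G(2)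
    by blast+
  ultimately show "f -` B \<inter> space G \<in> sets G"
    using measurable_sets[OF g B] by (simp only: sets.Un sets.Diff)
qed simp

lemma borel_measurable_cong_AE_M:
  fixes f g :: "'a \<Rightarrow> real"
  assumes "g \<in> borel_measurable M" "AE \<omega> in M. f \<omega> = g \<omega>"
  shows "f \<in> borel_measurable M"
  by (rule borel_measurable_cong_AE_null[OF _ _ assms]) (auto simp: subalgebra_def)

definition good :: "'a \<Rightarrow> bool" where
  "good \<omega> \<longleftrightarrow> N 0 \<omega> = 0 \<and> mono_on {0..1} (\<lambda>t. N t \<omega>) \<and>
     (\<forall>t\<in>{0..<1}. continuous (at_right t) (\<lambda>s. N s \<omega>))"

text \<open>Set to zero on irregular paths, so that monotonicity, right-continuity and the value 0
  on the negative axis hold for every omega. Then \<open>nu\<close> is a finite measure for every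
  omega, as the kernel lemmas require.\<close>

definition path :: "real \<Rightarrow> 'a \<Rightarrow> real" where
  "path t \<omega> = (if good \<omega> then N (max 0 (min 1 t)) \<omega> else 0)"

definition nu :: "'a \<Rightarrow> real measure" where
  "nu \<omega> = interval_measure (\<lambda>t. path t \<omega>)"

lemma AE_good: "AE \<omega> in M. good \<omega>"
  using start paths by eventually_elim (simp add: good_def)

lemma path_eq_N: "good \<omega> \<Longrightarrow> t \<in> {0..1} \<Longrightarrow> path t \<omega> = N t \<omega>"
proof -
  assume "good \<omega>" "t \<in> {0..1}"
  moreover from this have "max 0 (min 1 t) = t" by auto
  ultimately show ?thesis by (simp add: path_def)
qed

lemma path_measure_eq_nu: "good \<omega> \<Longrightarrow> path_measure N \<omega> = nu \<omega>"
  by (simp add: path_measure_def nu_def path_def)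

lemma path_mono: "s \<le> t \<Longrightarrow> path s \<omega> \<le> path t \<omega>"
proof (cases "good \<omega>")
  case True
  assume "s \<le> t"
  then have "max 0 (min 1 s) \<le> max 0 (min 1 t)" by simp
  then have "N (max 0 (min 1 s)) \<omega> \<le> N (max 0 (min 1 t)) \<omega>"
    using True unfolding good_def by (intro mono_onD[of "{0..1}" "\<lambda>t. N t \<omega>"]) simp_all
  then show ?thesis using True by (simp add: path_def)
qed (simp add: path_def)

lemma path_nonpos: "t \<le> 0 \<Longrightarrow> path t \<omega> = 0"
  by (simp add: path_def good_def)

lemma path_nonneg: "0 \<le> path t \<omega>"
  using path_mono[of "min t 0" t \<omega>] path_nonpos[of "min t 0" \<omega>] by simp

lemma path_ge_1: "t \<ge> 1 \<Longrightarrow> path t \<omega> = path 1 \<omega>"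
  by (simp add: path_def)

lemma path_right_cont: "continuous (at_right t) (\<lambda>s. path s \<omega>)"
proof (cases "good \<omega>")
  case False
  then show ?thesis by (simp add: path_def)
next
  case True
  consider "t < 0" | "0 \<le> t" "t < 1" | "1 \<le> t" by linarith
  then show ?thesis
  proof cases
    case 1
    have "\<forall>\<^sub>F s in at_right t. path s \<omega> = path t \<omega>"
      using eventually_at_right_less[of t] eventually_at_right_real[OF 1]
      by eventually_elim (use 1 in \<open>simp add: path_nonpos\<close>)
    then show ?thesis unfolding continuous_within by (rule tendsto_eventually)
  next
    case 2
    have "((\<lambda>s. N s \<omega>) \<longlongrightarrow> N t \<omega>) (at_right t)"
      using True 2 by (simp add: good_def continuous_within)
    moreover have "\<forall>\<^sub>F s in at_right t. N s \<omega> = path s \<omega>"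
      using eventually_at_right_real[OF 2(2)]
      by eventually_elim (use 2 True in \<open>simp add: path_eq_N\<close>)
    moreover have "path t \<omega> = N t \<omega>" using 2 True by (simp add: path_eq_N)
    ultimately show ?thesis
      unfolding continuous_within using tendsto_cong[of "\<lambda>s. N s \<omega>" "\<lambda>s. path s \<omega>"] by simp
  next
    case 3
    have "\<forall>\<^sub>F s in at_right t. path s \<omega> = path t \<omega>"
      using eventually_at_right_less[of t]
    proof eventually_elim
      fix s assume "t < s"
      then show "path s \<omega> = path t \<omega>" using 3 path_ge_1[of s \<omega>] path_ge_1[of t \<omega>] by simp
    qed
    then show ?thesis unfolding continuous_within by (rule tendsto_eventually)
  qed
qed

lemma sets_nu [simp]: "sets (nu \<omega>) = sets borel" and space_nu [simp]: "space (nu \<omega>) = UNIV"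
  by (simp_all add: nu_def)

lemma emeasure_nu_Ioc: "a \<le> b \<Longrightarrow> emeasure (nu \<omega>) {a<..b} = ennreal (path b \<omega> - path a \<omega>)"
  unfolding nu_def
  by (rule emeasure_interval_measure_Ioc[where F = "\<lambda>t. path t \<omega>"]) (simp_all add: path_mono path_right_cont)

text \<open>The Stieltjes construction gives the mass of half-open intervals. Since
  \<open>path\<close> vanishes on the negative axis, {..a} is exhausted by intervals of eventually
  constant mass.\<close>

lemma emeasure_nu_atMost: "emeasure (nu \<omega>) {..a} = ennreal (path a \<omega>)"
proof -
  have "(\<lambda>i. emeasure (nu \<omega>) {- real i<..a}) \<longlonglongrightarrow> emeasure (nu \<omega>) (\<Union>i. {- real i<..a})"
    by (rule Lim_emeasure_incseq) (auto simp: incseq_def)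
  also have "(\<Union>i. {- real i<..a}) = {..a}"
  proof (intro set_eqI iffI)
    fix x assume "x \<in> {..a}"
    moreover obtain i where "- x < real i" using reals_Archimedean2 by blast
    ultimately have "x \<in> {- real i<..a}" by simp
    then show "x \<in> (\<Union>i. {- real i<..a})" by blast
  qed simp
  finally have 1: "(\<lambda>i. emeasure (nu \<omega>) {- real i<..a}) \<longlonglongrightarrow> emeasure (nu \<omega>) {..a}" .
  obtain n where n: "- a \<le> real n" using real_arch_simple by blast
  have "\<forall>\<^sub>F i in sequentially. emeasure (nu \<omega>) {- real i<..a} = ennreal (path a \<omega>)"
  proof (rule eventually_sequentiallyI)
    fix i assume "n \<le> i"
    then have "- real i \<le> a" using n by simp
    then show "emeasure (nu \<omega>) {- real i<..a} = ennreal (path a \<omega>)"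
      using path_nonpos[of "- real i" \<omega>] by (simp add: emeasure_nu_Ioc)
  qed
  then have "(\<lambda>i. emeasure (nu \<omega>) {- real i<..a}) \<longlonglongrightarrow> ennreal (path a \<omega>)"
    by (rule tendsto_eventually)
  with 1 show ?thesis by (rule LIMSEQ_unique)
qed

lemma finite_measure_nu: "finite_measure (nu \<omega>)"
proof
  have "(\<lambda>i. emeasure (nu \<omega>) {..real i}) \<longlonglongrightarrow> emeasure (nu \<omega>) (\<Union>i. {..real i})"
    by (rule Lim_emeasure_incseq) (auto simp: incseq_def)
  also have "(\<Union>i. {..real i}) = UNIV"
  proof (intro set_eqI iffI)
    fix x :: real
    obtain i where "x \<le> real i" using real_arch_simple by blast
    then show "x \<in> (\<Union>i. {..real i})" by blast
  qed simp
  finally have 1: "(\<lambda>i. emeasure (nu \<omega>) {..real i}) \<longlonglongrightarrow> emeasure (nu \<omega>) UNIV" .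
  have "emeasure (nu \<omega>) UNIV \<le> ennreal (path 1 \<omega>)"
  proof (rule LIMSEQ_le_const2[OF 1], intro exI allI impI)
    fix i :: nat
    have "path (real i) \<omega> \<le> path 1 \<omega>"
      using path_mono[of "real i" 1 \<omega>] path_ge_1[of "real i" \<omega>]
      by (cases "real i \<le> 1") simp_all
    then show "emeasure (nu \<omega>) {..real i} \<le> ennreal (path 1 \<omega>)"
      unfolding emeasure_nu_atMost by (rule ennreal_leI)
  qed
  then have "emeasure (nu \<omega>) UNIV < \<infinity>" by (rule le_less_trans) simp
  then show "emeasure (nu \<omega>) (space (nu \<omega>)) \<noteq> \<infinity>" by simp
qed

text \<open>As \<open>path\<close> vanishes up to 0, removing the negative axis removes no mass, so
  the closed endpoint 0 does no harm; for negative a both sides are 0.\<close>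

lemma measure_nu_left:
  assumes "0 \<le> t"
  shows "measure (nu \<omega>) ({..a} \<inter> {0..t}) = path (min a t) \<omega>"
proof -
  interpret finite_measure "nu \<omega>" by (rule finite_measure_nu)
  have m: "measure (nu \<omega>) {..b} = path b \<omega>" for b
    using emeasure_nu_atMost[of \<omega> b] path_nonneg[of b \<omega>] by (simp add: emeasure_eq_measure)
  have "measure (nu \<omega>) {..<0} \<le> measure (nu \<omega>) {..0}"
    by (rule finite_measure_mono) auto
  then have neg: "measure (nu \<omega>) {..<0} = 0"
    using m[of 0] path_nonpos[of 0 \<omega>] by (simp add: measure_le_0_iff)
  show ?thesis
  proof (cases "0 \<le> a")
    case True
    then have "{..a} \<inter> {0..t} = {..min a t} - {..<0}" by auto
    also have "measure (nu \<omega>) \<dots> = path (min a t) \<omega>"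
      using finite_measure_Diff[of "{..min a t}" "{..<0}"] True assms by (simp add: neg m subset_eq)
    finally show ?thesis .
  next
    case False
    then have "{..a} \<inter> {0..t} = {}" by auto
    then show ?thesis using False by (simp add: path_nonpos)
  qed
qed

text \<open>If a lies below t, the set is empty, and \<open>max t\<close> makes the difference of
  path values 0 as well.\<close>

lemma measure_nu_right:
  assumes "0 \<le> t" "t \<le> 1"
  shows "measure (nu \<omega>) ({..a} \<inter> {t<..1}) = path (max t (min a 1)) \<omega> - path t \<omega>"
proof (cases "t \<le> min a 1")
  case True
  then have "{..a} \<inter> {t<..1} = {t<..min a 1}" by auto
  then show ?thesis
    using emeasure_nu_Ioc[OF True, of \<omega>] path_mono[OF True, of \<omega>] True by (simp add: measure_def)
next
  case False
  then have "{..a} \<inter> {t<..1} = {}" "max t (min a 1) = t" using assms by (auto simp: max_def)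
  then show ?thesis by simp
qed

text \<open>Measurability of increments is contained in the notion of independent random variables:
  it is read off from \<open>indep_increments\<close> with a single increment.\<close>

lemma increment_measurable:
  assumes "0 \<le> s" "s < t" "t \<le> 1"
  shows "(\<lambda>\<omega>. N t \<omega> - N s \<omega>) \<in> borel_measurable M"
proof -
  have "indep_vars (\<lambda>_. borel) (\<lambda>i \<omega>. N ((\<lambda>i. if i = 0 then s else t) (Suc i)) \<omega>
      - N ((\<lambda>i. if i = 0 then s else t) i) \<omega>) {..<1::nat}"
    using assms by (intro indep_increments) auto
  then have "\<forall>i\<in>{..<1::nat}. random_variable borel (\<lambda>\<omega>. N ((\<lambda>i. if i = 0 then s else t) (Suc i)) \<omega>
      - N ((\<lambda>i. if i = 0 then s else t) i) \<omega>)"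
    unfolding indep_vars_def by (rule conjunct1)
  from bspec[OF this, of 0] show ?thesis by simp
qed

text \<open>Only increments are known to be measurable. Since N 0 is almost surely 0,
  \<open>path t\<close> is a version of the increment over [0,t], and completeness of
  \<open>M\<close> makes it measurable.\<close>

lemma path_measurable: "path t \<in> borel_measurable M"
proof -
  have 1: "path t \<in> borel_measurable M" if "0 < t" "t \<le> 1" for t
  proof (rule borel_measurable_cong_AE_M[OF increment_measurable[of 0 t]])
    show "AE \<omega> in M. path t \<omega> = N t \<omega> - N 0 \<omega>"
      using AE_good by eventually_elim (use that in \<open>simp add: path_eq_N, simp add: good_def\<close>)
  qed (use that in auto)
  consider "t \<le> 0" | "0 < t" "t \<le> 1" | "1 < t" by linarith
  then show ?thesis
  proof cases
    case 1
    then have "path t = (\<lambda>_. 0)" by (auto simp: path_nonpos)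
    then show ?thesis by simp
  next
    case 3
    then have "path t = path 1" by (intro ext path_ge_1) simp
    then show ?thesis using 1[of 1] by simp
  qed (rule 1)
qed

end

section \<open>Independence of past and future\<close>

context standard_poisson_space
begin

text \<open>An integral against \<open>nu\<close> of a function vanishing off A depends only on the
  masses of the sets \<open>{..a} \<inter> A\<close>, so it suffices that these are
  G-measurable.\<close>

lemma comp_integral_measurable:
  assumes G: "subalgebra M G" "null_sets M \<subseteq> sets G" and A: "A \<in> sets borel"
    and nu: "\<And>a. (\<lambda>\<omega>. measure (nu \<omega>) ({..a} \<inter> A)) \<in> borel_measurable G"
    and h: "h \<in> L2 TT"
  shows "comp_integral N (\<lambda>s. h s * indicator A s) \<in> borel_measurable G"
proof -
  have B: "(\<lambda>\<omega>. measure (nu \<omega>) (B \<inter> A)) \<in> borel_measurable G" if "B \<in> sets borel" for B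
    by (rule measurable_kernel[OF finite_measure_nu sets_nu A nu that])
  \<comment> \<open>Membership in \<open>L2 TT\<close> gives measurability on [0,1] only;
    multiplying by the indicator extends h by zero to the line.\<close>
  have "h \<in> borel_measurable (restrict_space borel {0..1})"
    using L2D[OF h] unfolding measurable_cong_sets[OF sets_TT refl] .
  then have h': "(\<lambda>s. indicator {0..1} s * h s) \<in> borel_measurable borel"
    by (subst (asm) borel_measurable_restrict_space_iff) (simp_all add: mult.commute)
  have "(\<lambda>\<omega>. \<integral>s. (indicator {0..1} s * h s) * indicator A s \<partial>nu \<omega>) \<in> borel_measurable G"
    by (rule measurable_kernel_integral[OF finite_measure_nu sets_nu B A h'])
  then have m: "(\<lambda>\<omega>. (\<integral>s. (indicator {0..1} s * h s) * indicator A s \<partial>nu \<omega>) -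
      (LINT s:{0..1}|lborel. h s * indicator A s)) \<in> borel_measurable G"
    by (rule borel_measurable_diff) simp
  show ?thesis
  proof (rule borel_measurable_cong_AE_null[OF G m])
    show "AE \<omega> in M. comp_integral N (\<lambda>s. h s * indicator A s) \<omega> =
        (\<integral>s. (indicator {0..1} s * h s) * indicator A s \<partial>nu \<omega>) - (LINT s:{0..1}|lborel. h s * indicator A s)"
      using AE_good
      by eventually_elim
         (simp add: comp_integral_def path_measure_eq_nu set_lebesgue_integral_def mult.assoc)
  qed
qed

section \<open>Sigma-fields generated by increments on dyadic grids\<close>

definition gen :: "(real \<Rightarrow> 'a \<Rightarrow> real) \<Rightarrow> real set \<Rightarrow> 'a set set" where
  "gen X D = sigma_sets (space M) {X s -` B \<inter> space M | s B. s \<in> D \<and> B \<in> sets borel}"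

lemma gen_mono: "D \<subseteq> D' \<Longrightarrow> gen X D \<subseteq> gen X D'"
  unfolding gen_def by (rule sigma_sets_mono') blast

lemma gen_Int:
  assumes "a \<in> gen X D" "b \<in> gen X D"
  shows "a \<inter> b \<in> gen X D"
proof -
  interpret sigma_algebra "space M" "gen X D"
    unfolding gen_def by (rule sigma_algebra_sigma_sets) auto
  show ?thesis using assms by (rule Int)
qed

text \<open>Dyadic subdivision makes the grids increase with m, so that events from two grids are
  events of the finer one and form a family stable under intersection.\<close>

definition grid :: "real \<Rightarrow> real \<Rightarrow> nat \<Rightarrow> real set" where
  "grid a b m = {a + (b - a) * (real i / 2 ^ m) | i. i \<le> 2 ^ m}"

lemma grid_mono: "m \<le> m' \<Longrightarrow> grid a b m \<subseteq> grid a b m'"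
proof (rule lift_Suc_mono_le[of "grid a b"])
  fix m show "grid a b m \<subseteq> grid a b (Suc m)"
  proof
    fix x assume "x \<in> grid a b m"
    then obtain i where "x = a + (b - a) * (real i / 2 ^ m)" "i \<le> 2 ^ m" by (auto simp: grid_def)
    then have "x = a + (b - a) * (real (2 * i) / 2 ^ Suc m)" "2 * i \<le> 2 ^ Suc m" by simp_all
    then show "x \<in> grid a b (Suc m)" unfolding grid_def by blast
  qed
qed

text \<open>Events are taken up to null sets because \<open>path\<close> agrees with \<open>N\<close> only almost surely.\<close>

definition grid_events :: "(real \<Rightarrow> 'a \<Rightarrow> real) \<Rightarrow> real \<Rightarrow> real \<Rightarrow> 'a set set" where
  "grid_events X a b = {E \<in> sets M. \<exists>m. \<exists>E0\<in>gen X (grid a b m). AE \<omega> in M. \<omega> \<in> E \<longleftrightarrow> \<omega> \<in> E0}"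

lemma Int_stable_grid_events: "Int_stable (grid_events X a b)"
proof (rule Int_stableI)
  fix E F assume "E \<in> grid_events X a b" "F \<in> grid_events X a b"
  then obtain m n E0 F0 where E: "E \<in> sets M" "E0 \<in> gen X (grid a b m)" "AE \<omega> in M. \<omega> \<in> E \<longleftrightarrow> \<omega> \<in> E0"
    and F: "F \<in> sets M" "F0 \<in> gen X (grid a b n)" "AE \<omega> in M. \<omega> \<in> F \<longleftrightarrow> \<omega> \<in> F0"
    unfolding grid_events_def by blast
  have "E0 \<in> gen X (grid a b (max m n))" "F0 \<in> gen X (grid a b (max m n))"
    using E(2) F(2) gen_mono[OF grid_mono[of m "max m n" a b], of X]
      gen_mono[OF grid_mono[of n "max m n" a b], of X] by auto
  then have "E0 \<inter> F0 \<in> gen X (grid a b (max m n))" by (rule gen_Int)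
  moreover have "AE \<omega> in M. \<omega> \<in> E \<inter> F \<longleftrightarrow> \<omega> \<in> E0 \<inter> F0"
    using E(3) F(3) by eventually_elim simp
  ultimately show "E \<inter> F \<in> grid_events X a b"
    using E(1) F(1) unfolding grid_events_def by blast
qed

definition Events :: "(real \<Rightarrow> 'a \<Rightarrow> real) \<Rightarrow> real \<Rightarrow> real \<Rightarrow> 'a measure" where
  "Events X a b = sigma (space M) (grid_events X a b)"

lemma grid_events_subset: "grid_events X a b \<subseteq> sets M" "grid_events X a b \<subseteq> Pow (space M)"
  using sets.sets_into_space by (auto simp: grid_events_def)

lemma sets_Events: "sets (Events X a b) = sigma_sets (space M) (grid_events X a b)"
  unfolding Events_def by (rule sets_measure_of[OF grid_events_subset(2)])

lemma subalgebra_Events: "subalgebra M (Events X a b)"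
  unfolding subalgebra_def sets_Events
  using sets.sigma_sets_subset[OF grid_events_subset(1)] by (simp add: Events_def space_measure_of_conv)

lemma null_sets_Events: "null_sets M \<subseteq> sets (Events X a b)"
proof
  fix E assume E: "E \<in> null_sets M"
  have "{} \<in> gen X (grid a b 0)" unfolding gen_def by (rule sigma_sets.Empty)
  moreover have "AE \<omega> in M. \<omega> \<in> E \<longleftrightarrow> \<omega> \<in> {}" using AE_not_in[OF E] by simp
  ultimately have "E \<in> grid_events X a b" using null_setsD2[OF E] unfolding grid_events_def by blast
  then show "E \<in> sets (Events X a b)" unfolding sets_Events by (rule sigma_sets.Basic)
qed

text \<open>Rounding up to the next dyadic point approximates r from the right, the side on which
  the paths are continuous.\<close>

lemma grid_approx:
  assumes "a \<le> r" "r \<le> b"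
  shows "\<exists>q. (\<forall>m. q m \<in> grid a b m \<and> r \<le> q m) \<and> q \<longlonglongrightarrow> r"
proof -
  obtain x where x: "0 \<le> x" "x \<le> 1" "r = a + (b - a) * x"
  proof (cases "a < b")
    case True
    then show ?thesis using assms by (intro that[of "(r - a) / (b - a)"]) (simp_all add: divide_simps)
  next
    case False
    then show ?thesis using assms by (intro that[of 0]) simp_all
  qed
  define i where "i m = nat \<lceil>2 ^ m * x\<rceil>" for m :: nat
  have i_ge: "2 ^ m * x \<le> real (i m)" for m
    using x(1) by (simp add: i_def)
  have i_lt: "real (i m) < 2 ^ m * x + 1" for m
    using x(1) by (simp add: i_def) linarith
  have i_le: "i m \<le> 2 ^ m" for m
  proof -
    have "real (i m) < 2 ^ m + 1"
    proof -
      have "2 ^ m * x \<le> 2 ^ m * 1" by (rule mult_left_mono[OF x(2)]) simp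
      then show ?thesis using i_lt[of m] unfolding mult_1_right by linarith
    qed
    then have "real (i m) < real (2 ^ m + 1)" by simp
    then show ?thesis by (simp only: of_nat_less_iff)
  qed
  define q where "q m = a + (b - a) * (real (i m) / 2 ^ m)" for m
  have ab: "0 \<le> b - a" using assms by simp
  have ge: "x \<le> real (i m) / 2 ^ m" and le: "real (i m) / 2 ^ m \<le> x + (1 / 2) ^ m" for m
    using i_ge[of m] i_lt[of m] by (simp_all add: field_simps power_divide)
  have lim: "(\<lambda>m. real (i m) / 2 ^ m) \<longlonglongrightarrow> x"
  proof (rule tendsto_sandwich[OF _ _ tendsto_const])
    show "(\<lambda>m. x + (1 / 2) ^ m) \<longlonglongrightarrow> x"
      by (auto intro!: tendsto_eq_intros LIMSEQ_power_zero)
  qed (auto intro!: always_eventually ge le)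
  have "q \<longlonglongrightarrow> r"
    unfolding q_def x(3) by (intro tendsto_intros lim)
  moreover have "q m \<in> grid a b m" for m
    using i_le[of m] unfolding q_def grid_def by blast
  moreover have "r \<le> q m" for m
    unfolding q_def x(3) by (intro add_left_mono mult_left_mono ge ab)
  ultimately show ?thesis by blast
qed

lemma grid_bounds:
  assumes "s \<in> grid a b m" "a \<le> b"
  shows "a \<le> s" "s \<le> b"
proof -
  obtain i where i: "s = a + (b - a) * (real i / 2 ^ m)" "i \<le> 2 ^ m" using assms(1) by (auto simp: grid_def)
  have "real i \<le> real (2 ^ m)" using i(2) by (rule of_nat_mono)
  then have "real i / 2 ^ m \<le> 1" by simp
  then show "a \<le> s" "s \<le> b"
    unfolding i(1) using mult_left_mono[of "real i / 2 ^ m" 1 "b - a"] assms(2)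
    by (auto intro!: mult_nonneg_nonneg)
qed

text \<open>Two processes occur because X (increments of \<open>N\<close>) carries the independence
  and X' (built from \<open>path\<close>) the right-continuity. They agree up to null sets at grid
  points; other times are limits of grid points from the right.\<close>

lemma measurable_Events:
  assumes X': "\<And>r. X' r \<in> borel_measurable M"
    and eq: "\<And>r. a \<le> r \<Longrightarrow> r \<le> b \<Longrightarrow> AE \<omega> in M. X' r \<omega> = X r \<omega>"
    and cont: "\<And>r \<omega>. continuous (at_right r) (\<lambda>s. X' s \<omega>)"
    and r: "a \<le> r" "r \<le> b"
  shows "X' r \<in> borel_measurable (Events X a b)"
proof -
  have sp: "space (Events X a b) = space M" by (simp add: Events_def space_measure_of_conv)
  have 1: "X' s \<in> borel_measurable (Events X a b)" if s: "s \<in> grid a b m" for s m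
  proof (rule measurableI)
    fix B :: "real set" assume B: "B \<in> sets borel"
    have "X s -` B \<inter> space M \<in> gen X (grid a b m)"
      unfolding gen_def using s B by (intro sigma_sets.Basic) blast
    moreover have "AE \<omega> in M. \<omega> \<in> X' s -` B \<inter> space M \<longleftrightarrow> \<omega> \<in> X s -` B \<inter> space M"
      using eq[of s] grid_bounds[OF s order_trans[OF r]] by auto
    moreover have "X' s -` B \<inter> space M \<in> sets M"
      by (rule measurable_sets[OF X' B])
    ultimately have "X' s -` B \<inter> space M \<in> grid_events X a b"
      unfolding grid_events_def by blast
    then show "X' s -` B \<inter> space (Events X a b) \<in> sets (Events X a b)"
      unfolding sets_Events sp by (rule sigma_sets.Basic)
  qed simp
  obtain q where q: "\<And>m. q m \<in> grid a b m" "\<And>m. r \<le> q m" "q \<longlonglongrightarrow> r"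
    using grid_approx[OF r] by blast
  show ?thesis
  proof (rule borel_measurable_LIMSEQ_real)
    show "X' (q m) \<in> borel_measurable (Events X a b)" for m by (rule 1[OF q(1)])
    fix \<omega>
    have "continuous (at r within {r..}) (\<lambda>s. X' s \<omega>)"
      using cont[of r \<omega>] by (simp add: at_within_Ici_at_right)
    then have "\<forall>x. (\<forall>n. x n \<in> {r..}) \<and> x \<longlonglongrightarrow> r \<longrightarrow> ((\<lambda>s. X' s \<omega>) \<circ> x) \<longlonglongrightarrow> X' r \<omega>"
      unfolding continuous_within_sequentially .
    from this[rule_format, of q] show "(\<lambda>m. X' (q m) \<omega>) \<longlonglongrightarrow> X' r \<omega>"
      using q(2,3) by (simp add: comp_def)
  qed
qed

text \<open>By telescoping, the variables behind E are sums of increments before the index k and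
  those behind F are sums of later increments. Grouping an independent family into two disjoint
  blocks gives independent blocks.\<close>

lemma indep_grid:
  fixes p :: "nat \<Rightarrow> real"
  assumes p: "p 0 = 0" "\<And>i. i < n \<Longrightarrow> p i < p (Suc i)" "p n \<le> 1" and k: "k \<le> n"
    and D: "D \<subseteq> p ` {..k}" and D': "D' \<subseteq> p ` {k..n}"
    and E: "E \<in> gen (\<lambda>r \<omega>. N r \<omega> - N 0 \<omega>) D" and F: "F \<in> gen (\<lambda>r \<omega>. N r \<omega> - N (p k) \<omega>) D'"
  shows "prob (E \<inter> F) = prob E * prob F"
proof -
  define \<Delta> where "\<Delta> i \<omega> = N (p (Suc i)) \<omega> - N (p i) \<omega>" for i \<omega>
  have "indep_vars (\<lambda>_. borel) \<Delta> {..<n}"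
    unfolding \<Delta>_def by (rule indep_increments) (use p in auto)
  then have iv: "indep_var (PiM {..<k} (\<lambda>_. borel)) (\<lambda>\<omega>. restrict (\<lambda>i. \<Delta> i \<omega>) {..<k})
      (PiM {k..<n} (\<lambda>_. borel)) (\<lambda>\<omega>. restrict (\<lambda>i. \<Delta> i \<omega>) {k..<n})"
    by (rule indep_var_restrict) (use k in auto)
  let ?U = "\<lambda>A. {(\<lambda>\<omega>. restrict (\<lambda>i. \<Delta> i \<omega>) A) -` S \<inter> space M | S. S \<in> sets (PiM A (\<lambda>_. borel))}"
  have sub: "gen Y S \<subseteq> sigma_sets (space M) (?U A)"
    if Y: "\<And>s. s \<in> S \<Longrightarrow> \<exists>J\<subseteq>A. \<forall>\<omega>. Y s \<omega> = (\<Sum>j\<in>J. \<Delta> j \<omega>)" for Y S A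
    unfolding gen_def
  proof (rule sigma_sets_mono, safe)
    fix s and B :: "real set" assume s: "s \<in> S" and B: "B \<in> sets borel"
    obtain J where J: "J \<subseteq> A" "\<And>\<omega>. Y s \<omega> = (\<Sum>j\<in>J. \<Delta> j \<omega>)" using Y[OF s] by blast
    let ?g = "\<lambda>v :: nat \<Rightarrow> real. \<Sum>j\<in>J. v j"
    have g: "?g \<in> borel_measurable (PiM A (\<lambda>_. borel))"
      by (rule borel_measurable_sum[where f = "\<lambda>j v. v j"]) (use J(1) in \<open>auto intro: measurable_component_singleton\<close>)
    have "Y s \<omega> = ?g (restrict (\<lambda>i. \<Delta> i \<omega>) A)" for \<omega>
      unfolding J(2) using J(1) by (intro sum.cong) auto
    then have "Y s -` B \<inter> space M = (\<lambda>\<omega>. restrict (\<lambda>i. \<Delta> i \<omega>) A) -` (?g -` B \<inter> space (PiM A (\<lambda>_. borel))) \<inter> space M"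
      by (auto simp: space_PiM)
    moreover have "?g -` B \<inter> space (PiM A (\<lambda>_. borel)) \<in> sets (PiM A (\<lambda>_. borel))"
      by (rule measurable_sets[OF g B])
    ultimately show "Y s -` B \<inter> space M \<in> sigma_sets (space M) (?U A)"
      by (intro sigma_sets.Basic) blast
  qed
  have tel: "N (p j) \<omega> - N (p i) \<omega> = (\<Sum>l\<in>{i..<j}. \<Delta> l \<omega>)" if "i \<le> j" for i j \<omega>
    unfolding \<Delta>_def using that by (simp add: sum_Suc_diff'[of i j "\<lambda>l. N (p l) \<omega>"])
  have "E \<in> sigma_sets (space M) (?U {..<k})"
  proof (rule subsetD[OF sub E])
    fix s assume "s \<in> D"
    then obtain j where "s = p j" "j \<le> k" using D by auto
    then show "\<exists>J\<subseteq>{..<k}. \<forall>\<omega>. N s \<omega> - N 0 \<omega> = (\<Sum>j\<in>J. \<Delta> j \<omega>)"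
      using tel[of 0 j] p(1) by (intro exI[of _ "{0..<j}"]) auto
  qed
  moreover have "F \<in> sigma_sets (space M) (?U {k..<n})"
  proof (rule subsetD[OF sub F])
    fix s assume "s \<in> D'"
    then obtain j where "s = p j" "k \<le> j" "j \<le> n" using D' by auto
    then show "\<exists>J\<subseteq>{k..<n}. \<forall>\<omega>. N s \<omega> - N (p k) \<omega> = (\<Sum>j\<in>J. \<Delta> j \<omega>)"
      using tel[of k j] by (intro exI[of _ "{k..<j}"]) auto
  qed
  moreover have "indep_set (sigma_sets (space M) (?U {..<k})) (sigma_sets (space M) (?U {k..<n}))"
    using iv unfolding indep_var_eq by blast
  ultimately show ?thesis by (rule indep_setD[rotated])
qed

text \<open>Independent increments are available for strictly increasing partitions only. At t = 0
  or t = 1 one of the two grids collapses to a point, so these cases use the dyadic partition of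
  [0,1] with the splitting index at one end.\<close>

lemma indep_gen:
  assumes t: "0 \<le> t" "t \<le> 1"
    and E: "E \<in> gen (\<lambda>r \<omega>. N r \<omega> - N 0 \<omega>) (grid 0 t m)" and F: "F \<in> gen (\<lambda>r \<omega>. N r \<omega> - N t \<omega>) (grid t 1 m)"
  shows "prob (E \<inter> F) = prob E * prob F"
proof -
  let ?n = "2 ^ m :: nat"
  consider "t = 0" | "t = 1" | "0 < t" "t < 1" using t by linarith
  then show ?thesis
  proof cases
    case 1
    let ?p = "\<lambda>i. real i / 2 ^ m"
    show ?thesis
    proof (rule indep_grid[where p = ?p and n = ?n and k = 0])
      show "?p i < ?p (Suc i)" for i by (intro divide_strict_right_mono) simp_all
      show "grid 0 t m \<subseteq> ?p ` {..0}" unfolding grid_def 1 by auto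
      show "grid t 1 m \<subseteq> ?p ` {0..?n}" unfolding grid_def 1 by auto
      show "F \<in> gen (\<lambda>r \<omega>. N r \<omega> - N (?p 0) \<omega>) (grid t 1 m)" using F by (simp add: 1)
    qed (use E in simp_all)
  next
    case 2
    let ?p = "\<lambda>i. real i / 2 ^ m"
    show ?thesis
    proof (rule indep_grid[where p = ?p and n = ?n and k = ?n])
      show "?p i < ?p (Suc i)" for i by (intro divide_strict_right_mono) simp_all
      show "grid 0 t m \<subseteq> ?p ` {..?n}" unfolding grid_def 2 by auto
      show "grid t 1 m \<subseteq> ?p ` {?n..?n}" unfolding grid_def 2 by auto
      show "F \<in> gen (\<lambda>r \<omega>. N r \<omega> - N (?p ?n) \<omega>) (grid t 1 m)" using F by (simp add: 2)
    qed (use E in simp_all)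
  next
    case 3
    \<comment> \<open>The first 2^m steps run through the grid of [0,t], the next 2^m through the
      grid of [t,1]; the index 2^m is the common point t.\<close>
    define p where "p i = (if i \<le> ?n then t * (real i / 2 ^ m) else t + (1 - t) * ((real i - 2 ^ m) / 2 ^ m))" for i
    have pk: "p ?n = t" by (simp add: p_def)
    show ?thesis
    proof (rule indep_grid[where p = p and n = "2 * ?n" and k = ?n and D = "grid 0 t m" and D' = "grid t 1 m"])
      show "p 0 = 0" by (simp add: p_def)
      show "p (2 * ?n) \<le> 1" by (simp add: p_def)
      show "p i < p (Suc i)" for i
      proof -
        consider "Suc i \<le> ?n" | "i = ?n" | "?n < i" by linarith
        then show ?thesis
        proof cases
          case 1
          then show ?thesis using 3 by (simp add: p_def divide_strict_right_mono)
        next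
          case 2
          then show ?thesis using 3 by (simp add: p_def)
        next
          case h: 3
          have "(real i - 2 ^ m) / 2 ^ m < (real (Suc i) - 2 ^ m) / 2 ^ m"
            by (intro divide_strict_right_mono) auto
          then have "t + (1 - t) * ((real i - 2 ^ m) / 2 ^ m) < t + (1 - t) * ((real (Suc i) - 2 ^ m) / 2 ^ m)"
            using 3 by (intro add_strict_left_mono mult_strict_left_mono) auto
          then show ?thesis using h by (simp add: p_def)
        qed
      qed
      show "grid 0 t m \<subseteq> p ` {..?n}"
      proof
        fix x assume "x \<in> grid 0 t m"
        then obtain i where "i \<le> ?n" "x = p i" by (auto simp: grid_def p_def)
        then show "x \<in> p ` {..?n}" by blast
      qed
      show "grid t 1 m \<subseteq> p ` {?n..2 * ?n}"
      proof
        fix x assume "x \<in> grid t 1 m"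
        then obtain i where i: "i \<le> ?n" "x = t + (1 - t) * (real i / 2 ^ m)" by (auto simp: grid_def)
        then have "x = p (?n + i)" by (cases "i = 0") (simp_all add: p_def)
        moreover have "?n + i \<in> {?n..2 * ?n}" using i(1) by simp
        ultimately show "x \<in> p ` {?n..2 * ?n}" by blast
      qed
    qed (use E F pk in simp_all)
  qed
qed

abbreviation past :: "real \<Rightarrow> 'a measure" where
  "past t \<equiv> Events (\<lambda>r \<omega>. N r \<omega> - N 0 \<omega>) 0 t"

abbreviation future :: "real \<Rightarrow> 'a measure" where
  "future t \<equiv> Events (\<lambda>r \<omega>. N r \<omega> - N t \<omega>) t 1"

lemma gen_in_sets:
  assumes "\<And>s. s \<in> D \<Longrightarrow> X s \<in> borel_measurable M"
  shows "gen X D \<subseteq> sets M"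
  unfolding gen_def by (rule sets.sigma_sets_subset) (use measurable_sets[OF assms] in blast)

lemma N_diff_measurable:
  assumes "0 \<le> s" "s \<le> t" "t \<le> 1"
  shows "(\<lambda>\<omega>. N t \<omega> - N s \<omega>) \<in> borel_measurable M"
  using increment_measurable[of s t] assms by (cases "s = t") auto

text \<open>It suffices to treat the intersection-stable generators. Two events are moved to a
  common finer grid and replaced by exact grid events, which changes no probability.\<close>

lemma indep_past_future:
  assumes t: "0 \<le> t" "t \<le> 1"
  shows "indep_set (sets (past t)) (sets (future t))"
  unfolding sets_Events
proof (rule indep_set_sigma_sets[OF _ Int_stable_grid_events Int_stable_grid_events], rule indep_setI)
  fix E F assume "E \<in> grid_events (\<lambda>r \<omega>. N r \<omega> - N 0 \<omega>) 0 t" "F \<in> grid_events (\<lambda>r \<omega>. N r \<omega> - N t \<omega>) t 1"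
  then obtain m n E0 F0 where E: "E \<in> sets M" "E0 \<in> gen (\<lambda>r \<omega>. N r \<omega> - N 0 \<omega>) (grid 0 t m)"
      "AE \<omega> in M. \<omega> \<in> E \<longleftrightarrow> \<omega> \<in> E0"
    and F: "F \<in> sets M" "F0 \<in> gen (\<lambda>r \<omega>. N r \<omega> - N t \<omega>) (grid t 1 n)" "AE \<omega> in M. \<omega> \<in> F \<longleftrightarrow> \<omega> \<in> F0"
    unfolding grid_events_def by blast
  let ?k = "max m n"
  have E0: "E0 \<in> gen (\<lambda>r \<omega>. N r \<omega> - N 0 \<omega>) (grid 0 t ?k)"
    using E(2) gen_mono[OF grid_mono[of m ?k 0 t]] by auto
  have F0: "F0 \<in> gen (\<lambda>r \<omega>. N r \<omega> - N t \<omega>) (grid t 1 ?k)"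
    using F(2) gen_mono[OF grid_mono[of n ?k t 1]] by auto
  have E0m: "E0 \<in> sets M"
    by (rule subsetD[OF gen_in_sets E0]) (use t grid_bounds[of _ 0 t] in \<open>force intro!: N_diff_measurable\<close>)
  have F0m: "F0 \<in> sets M"
    by (rule subsetD[OF gen_in_sets F0]) (use t grid_bounds[of _ t 1] in \<open>force intro!: N_diff_measurable\<close>)
  have "prob (E \<inter> F) = prob (E0 \<inter> F0)"
    by (rule finite_measure_eq_AE) (use E F E0m F0m in auto)
  also have "\<dots> = prob E0 * prob F0" by (rule indep_gen[OF t E0 F0])
  also have "prob E0 = prob E" by (rule finite_measure_eq_AE) (use E E0m in auto)
  also have "prob F0 = prob F" by (rule finite_measure_eq_AE) (use F F0m in auto)
  finally show "prob (E \<inter> F) = prob E * prob F" .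
qed (auto simp: grid_events_def)

lemma path_past: "0 \<le> r \<Longrightarrow> r \<le> t \<Longrightarrow> t \<le> 1 \<Longrightarrow> path r \<in> borel_measurable (past t)"
proof (rule measurable_Events[where X' = path, OF path_measurable _ path_right_cont])
  fix r assume "0 \<le> r" "r \<le> t" "t \<le> 1"
  then have r: "r \<in> {0..1}" by simp
  show "AE \<omega> in M. path r \<omega> = N r \<omega> - N 0 \<omega>"
    using AE_good by eventually_elim (simp add: path_eq_N[OF _ r], simp add: good_def)
qed

lemma path_future:
  assumes t: "0 \<le> t" and r: "t \<le> r" "r \<le> 1"
  shows "(\<lambda>\<omega>. path r \<omega> - path t \<omega>) \<in> borel_measurable (future t)"
proof (rule measurable_Events[where X' = "\<lambda>r \<omega>. path r \<omega> - path t \<omega>", OF _ _ _ r])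
  show "(\<lambda>\<omega>. path r \<omega> - path t \<omega>) \<in> borel_measurable M" for r
    by (intro borel_measurable_diff path_measurable)
  show "continuous (at_right r) (\<lambda>s. path s \<omega> - path t \<omega>)" for r \<omega>
    by (intro continuous_diff path_right_cont continuous_const)
  fix r assume "t \<le> r" "r \<le> 1"
  then have r: "r \<in> {0..1}" "t \<in> {0..1}" using t by auto
  show "AE \<omega> in M. path r \<omega> - path t \<omega> = N r \<omega> - N t \<omega>"
    using AE_good by eventually_elim (simp add: path_eq_N[OF _ r(1)] path_eq_N[OF _ r(2)])
qed

section \<open>Comparison with the sigma-fields of stochastic integrals\<close>

lemma sigma_field_generator:
  "null_sets M \<union> {comp_integral N (\<lambda>s. h s * indicator A s) -` B \<inter> space M | h B. h \<in> L2 TT \<and> B \<in> sets borel}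
    \<subseteq> Pow (space M)"
proof (rule Un_least)
  show "null_sets M \<subseteq> Pow (space M)"
  proof
    fix E assume "E \<in> null_sets M"
    from sets.sets_into_space[OF null_setsD2[OF this]] show "E \<in> Pow (space M)" by (rule PowI)
  qed
qed blast

lemma sigma_field_subset:
  assumes G: "subalgebra M G" "null_sets M \<subseteq> sets G" and A: "A \<in> sets borel"
    and nu: "\<And>a. (\<lambda>\<omega>. measure (nu \<omega>) ({..a} \<inter> A)) \<in> borel_measurable G"
  shows "sets (sigma_field M N A) \<subseteq> sets G"
proof -
  have sp: "space G = space M" using G(1) by (simp add: subalgebra_def)
  let ?S = "null_sets M \<union> {comp_integral N (\<lambda>s. h s * indicator A s) -` B \<inter> space M | h B. h \<in> L2 TT \<and> B \<in> sets borel}"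
  have "sets (sigma_field M N A) = sigma_sets (space M) ?S"
    unfolding sigma_field_def by (rule sets_measure_of[OF sigma_field_generator])
  also have "\<dots> \<subseteq> sets G"
    unfolding sp[symmetric]
  proof (rule sets.sigma_sets_subset, rule Un_least)
    show "{comp_integral N (\<lambda>s. h s * indicator A s) -` B \<inter> space G | h B. h \<in> L2 TT \<and> B \<in> sets borel}
        \<subseteq> sets G"
      using measurable_sets[OF comp_integral_measurable[OF G A nu]] by blast
  qed (rule G(2))
  finally show ?thesis .
qed

text \<open>On [0,t] the measure \<open>nu\<close> is determined by path values up to time t. This
  is the bridge from stochastic integrals to increments of \<open>N\<close>; an inclusion suffices
  because independence passes to smaller sigma-fields.\<close>

lemma sigma_field_past:
  assumes t: "0 \<le> t" "t \<le> 1"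
  shows "sets (sigma_field M N {0..t}) \<subseteq> sets (past t)"
proof (rule sigma_field_subset[OF subalgebra_Events null_sets_Events])
  fix a
  show "(\<lambda>\<omega>. measure (nu \<omega>) ({..a} \<inter> {0..t})) \<in> borel_measurable (past t)"
    unfolding measure_nu_left[OF t(1)]
  proof (cases "0 \<le> a")
    case True
    then show "path (min a t) \<in> borel_measurable (past t)" using t by (intro path_past) auto
  next
    case False
    then have "path (min a t) = (\<lambda>_. 0)" by (intro ext path_nonpos) simp
    then show "path (min a t) \<in> borel_measurable (past t)" by simp
  qed
qed simp

lemma sigma_field_future:
  assumes t: "0 \<le> t" "t \<le> 1"
  shows "sets (sigma_field M N {t<..1}) \<subseteq> sets (future t)"
proof (rule sigma_field_subset[OF subalgebra_Events null_sets_Events])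
  fix a
  show "(\<lambda>\<omega>. measure (nu \<omega>) ({..a} \<inter> {t<..1})) \<in> borel_measurable (future t)"
    unfolding measure_nu_right[OF t] using t by (intro path_future) auto
qed simp

lemma space_sigma_field: "space (sigma_field M N A) = space M"
  by (simp add: sigma_field_def space_measure_of_conv)

lemma subalgebra_sigma_field:
  assumes t: "0 \<le> t" "t \<le> 1"
  shows "subalgebra M (sigma_field M N {0..t})" "subalgebra M (sigma_field M N {t<..1})"
  using sigma_field_past[OF t] sigma_field_future[OF t] subalgebra_Events
  unfolding subalgebra_def space_sigma_field by blast+

lemma indep_sigma_field:
  assumes t: "0 \<le> t" "t \<le> 1"
  shows "indep_set (sets (sigma_field M N {0..t})) (sets (sigma_field M N {t<..1}))"
  unfolding indep_set_def
  by (rule indep_sets_mono_sets[OF indep_past_future[OF t, unfolded indep_set_def]])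
     (use sigma_field_past[OF t] sigma_field_future[OF t] in \<open>auto split: bool.split\<close>)

text \<open>With \<open>indicator B\<close> as integrand h, the compensated mass is itself one of
  the generating integrals, for every omega and not just almost surely.\<close>

lemma comp_measure_in_sigma_field:
  assumes "B \<in> sets borel" "B \<subseteq> {0..1}" "A \<in> sets borel"
  shows "comp_measure N (B \<inter> A) \<in> borel_measurable (sigma_field M N A)"
proof (rule measurableI)
  have eq: "comp_measure N (B \<inter> A) = comp_integral N (\<lambda>s. indicator B s * indicator A s)"
  proof
    fix \<omega>
    have "(LINT s:{0..1}|L. indicator B s * indicator A s) = measure L (B \<inter> A)"
      if "space L = UNIV" for L :: "real measure"
    proof -
      have "(\<lambda>s. indicator {0..1} s *\<^sub>R (indicator B s * indicator A s)) = (indicator (B \<inter> A) :: real \<Rightarrow> real)"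
        using assms(2) by (auto simp: indicator_def fun_eq_iff)
      then show ?thesis using that by (simp add: set_lebesgue_integral_def)
    qed
    then show "comp_measure N (B \<inter> A) \<omega> = comp_integral N (\<lambda>s. indicator B s * indicator A s) \<omega>"
      by (simp add: comp_measure_def comp_integral_def path_measure_def)
  qed
  have B: "indicator B \<in> L2 TT"
  proof (rule L2_bound[where g = "\<lambda>_. 1"])
    show "(\<lambda>_. 1) \<in> L2 TT" by (simp add: L2_def)
    show "(indicator B :: real \<Rightarrow> real) \<in> borel_measurable TT"
      using measurable_compose[OF measurable_id_TT, of "indicator B" borel] assms(1) by simp
  qed (simp add: indicator_def)
  fix S :: "real set" assume "S \<in> sets borel"
  then have "comp_integral N (\<lambda>s. indicator B s * indicator A s) -` S \<inter> space M \<in>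
      {comp_integral N (\<lambda>s. h s * indicator A s) -` B \<inter> space M | h B. h \<in> L2 TT \<and> B \<in> sets borel}"
    using B by blast
  then show "comp_measure N (B \<inter> A) -` S \<inter> space (sigma_field M N A) \<in> sets (sigma_field M N A)"
    unfolding eq space_sigma_field unfolding sigma_field_def
    by (rule in_measure_of[OF sigma_field_generator UnI2])
qed simp

end

section \<open>Conditional expectations of products\<close>

context standard_poisson_space
begin

lemma comp_measure_measurable:
  assumes "B \<in> sets borel" "B \<subseteq> {0..1}"
  shows "comp_measure N B \<in> borel_measurable M"
proof -
  have "comp_measure N (B \<inter> {0..1}) \<in> borel_measurable (sigma_field M N {0..1})"
    by (rule comp_measure_in_sigma_field[OF assms]) simp
  moreover have "B \<inter> {0..1} = B" using assms(2) by blast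
  ultimately show ?thesis
    using measurable_from_subalg[OF subalgebra_sigma_field(1)[of 1]] by simp
qed

lemma comp_measure_good: "good \<omega> \<Longrightarrow> comp_measure N B \<omega> = measure (nu \<omega>) B - measure lborel B"
  by (simp add: comp_measure_def path_measure_eq_nu)

lemma fmeasurable_unit: "B \<in> sets borel \<Longrightarrow> B \<subseteq> {0..1::real} \<Longrightarrow> B \<in> fmeasurable lborel"
  by (rule fmeasurableI2[of "{0..1}"]) (simp_all add: fmeasurable_def)

text \<open>Additivity of \<open>measure\<close> requires finite masses. These are at hand for
  \<open>nu\<close>, which coincides with the path measure on regular paths.\<close>

lemma AE_comp_measure_split:
  assumes "B \<in> sets borel" "B \<subseteq> {0..1}" and t: "0 \<le> t" "t \<le> 1"
  shows "AE \<omega> in M. comp_measure N B \<omega> = comp_measure N (B \<inter> {0..t}) \<omega> + comp_measure N (B \<inter> {t<..1}) \<omega>"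
  using AE_good
proof eventually_elim
  fix \<omega> assume good: "good \<omega>"
  interpret finite_measure "nu \<omega>" by (rule finite_measure_nu)
  have B: "B = (B \<inter> {0..t}) \<union> (B \<inter> {t<..1})" using assms by auto
  have disj: "(B \<inter> {0..t}) \<inter> (B \<inter> {t<..1}) = {}" by auto
  have m: "B \<inter> {0..t} \<in> sets borel" "B \<inter> {t<..1} \<in> sets borel"
    using assms(1) by (auto intro!: sets.Int)
  have "measure (nu \<omega>) B = measure (nu \<omega>) (B \<inter> {0..t}) + measure (nu \<omega>) (B \<inter> {t<..1})"
    by (subst B, rule finite_measure_Union[OF _ _ disj]) (use m in simp_all)
  moreover have "measure lborel B = measure lborel (B \<inter> {0..t}) + measure lborel (B \<inter> {t<..1})"
    by (subst B, rule measure_Un3[THEN trans])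
       (use m assms(2) disj in \<open>auto intro!: fmeasurable_unit\<close>)
  ultimately show "comp_measure N B \<omega> = comp_measure N (B \<inter> {0..t}) \<omega> + comp_measure N (B \<inter> {t<..1}) \<omega>"
    by (simp add: comp_measure_good[OF good])
qed

lemma indep_set_commute: "indep_set A B \<Longrightarrow> indep_set B A"
  unfolding indep_set_def indep_sets2_eq[unfolded indep_set_def]
  by (metis Int_commute mult.commute)

lemma indep_expectation_mult:
  fixes Y W :: "'a \<Rightarrow> real"
  assumes ind: "indep_set (sets F) (sets G)" and F: "subalgebra M F" and G: "subalgebra M G"
    and Y: "Y \<in> borel_measurable F" and W: "W \<in> borel_measurable G"
    and int: "integrable M Y" "integrable M W"
  shows "(\<integral>\<omega>. Y \<omega> * W \<omega> \<partial>M) = (\<integral>\<omega>. Y \<omega> \<partial>M) * (\<integral>\<omega>. W \<omega> \<partial>M)"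
proof -
  have sub: "sigma_sets (space M) {Z -` A \<inter> space M | A. A \<in> sets borel} \<subseteq> sets H"
    if H: "subalgebra M H" and Z: "Z \<in> borel_measurable H" for H and Z :: "'a \<Rightarrow> real"
  proof -
    have sp: "space H = space M" using H by (simp add: subalgebra_def)
    show ?thesis
      unfolding sp[symmetric] by (rule sets.sigma_sets_subset) (use measurable_sets[OF Z] in blast)
  qed
  have "indep_var borel Y borel W"
    unfolding indep_var_eq indep_set_def
  proof (intro conjI indep_sets_mono_sets[OF ind[unfolded indep_set_def]])
    show "random_variable borel Y" "random_variable borel W"
      using measurable_from_subalg[OF F Y] measurable_from_subalg[OF G W] .
    show "case_bool (sigma_sets (space M) {Y -` A \<inter> space M |A. A \<in> sets borel})
        (sigma_sets (space M) {W -` A \<inter> space M |A. A \<in> sets borel}) i \<subseteq> case_bool (sets F) (sets G) i" for i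
      using sub[OF F Y] sub[OF G W] by (simp split: bool.split)
  qed
  then show ?thesis using int by (rule indep_var_lebesgue_integral)
qed

end

context multiple_poisson_integral
begin

text \<open>The product is the multiple integral of a symmetrized box, hence square integrable; for
  nonempty S it is orthogonal to degree 0, that is, to the constants. The index set is arbitrary
  because subsets of the sides will occur.\<close>

lemma prod_comp_measure:
  assumes S: "finite S" and B: "\<And>j. j \<in> S \<Longrightarrow> B j \<in> sets borel \<and> B j \<subseteq> {0..1}" "disjoint_family_on B S"
  shows "(\<lambda>\<omega>. \<Prod>j\<in>S. comp_measure N (B j) \<omega>) \<in> L2 M"
    and "(\<integral>\<omega>. (\<Prod>j\<in>S. comp_measure N (B j) \<omega>) \<partial>M) = (if S = {} then 1 else 0)"
proof -
  let ?n = "card S"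
  let ?P = "\<lambda>\<omega>. \<Prod>j\<in>S. comp_measure N (B j) \<omega>"
  obtain h where h: "bij_betw h {..<?n} S"
    using ex_bij_betw_nat_finite[OF S] by (auto simp: atLeast0LessThan)
  let ?f = "symmetrization ?n (\<lambda>x. \<Prod>i<?n. indicator (B (h i)) (x i))"
  have hS: "h i \<in> S" if "i < ?n" for i using bij_betwE[OF h] that by auto
  have "AE \<omega> in M. I ?n ?f \<omega> = (\<Prod>i<?n. comp_measure N (B (h i)) \<omega>)"
  proof (rule products)
    show "disjoint_family_on (\<lambda>i. B (h i)) {..<?n}"
      unfolding disjoint_family_on_def
    proof (intro ballI impI)
      fix i j assume ij: "i \<in> {..<?n}" "j \<in> {..<?n}" "i \<noteq> j"
      then have "h i \<noteq> h j" using bij_betw_imp_inj_on[OF h] by (auto dest: inj_onD)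
      then show "B (h i) \<inter> B (h j) = {}"
        using B(2) hS ij unfolding disjoint_family_on_def by blast
    qed
  qed (use B(1) hS in blast)
  moreover have "(\<Prod>i<?n. comp_measure N (B (h i)) \<omega>) = ?P \<omega>" for \<omega>
    by (rule prod.reindex_bij_betw[OF h])
  ultimately have eq: "AE \<omega> in M. ?P \<omega> = I ?n ?f \<omega>" by (simp add: eq_commute)
  have f: "?f \<in> L2_sym ?n"
    by (intro symmetrization_in_L2_sym box_L2) (use B(1) hS in blast)
  have P: "?P \<in> borel_measurable M"
    by (intro borel_measurable_prod comp_measure_measurable) (use B(1) in auto)
  show "?P \<in> L2 M" by (rule L2_cong_AE[OF square_integrable[OF L2_symD[OF f]] P eq])
  show "(\<integral>\<omega>. ?P \<omega> \<partial>M) = (if S = {} then 1 else 0)"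
  proof (cases "S = {}")
    case True
    then show ?thesis by (simp add: prob_space)
  next
    case False
    have one: "(\<lambda>x. 1) \<in> L2_sym 0"
      by (simp add: L2_sym_def symmetric_in_def L2_def)
    have "{p. \<forall>x. p x = x} = {\<lambda>x::nat. x}" by auto
    then have "symmetrization 0 (\<lambda>x. 1) = (\<lambda>x. 1)"
      by (simp add: symmetrization_def fun_eq_iff)
    \<comment> \<open>The case n = 0 of \<open>products\<close>, where the empty product yields
      I_0(1) = 1.\<close>
    then have I0: "AE \<omega> in M. I 0 (\<lambda>x. 1) \<omega> = 1"
      using products[of 0 "\<lambda>_. {}"] by (simp add: disjoint_family_on_def)
    have "(\<integral>\<omega>. ?P \<omega> \<partial>M) = (\<integral>\<omega>. I ?n ?f \<omega> * I 0 (\<lambda>x. 1) \<omega> \<partial>M)"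
    proof (rule integral_cong_AE[OF P])
      show "(\<lambda>\<omega>. I ?n ?f \<omega> * I 0 (\<lambda>x. 1) \<omega>) \<in> borel_measurable M"
        by (intro borel_measurable_times I_measurable L2_symD f one)
      show "AE \<omega> in M. ?P \<omega> = I ?n ?f \<omega> * I 0 (\<lambda>x. 1) \<omega>"
        using eq I0 by eventually_elim simp
    qed
    also have "\<dots> = 0" using isometry[OF f one] S False by simp
    finally show ?thesis using False by simp
  qed
qed

text \<open>Expand the product over the choices of A1 or A2 for each factor. A term with some factor
  on A2 contains an independent product of mean zero, so conditioning on A1 keeps the pure A1 term
  only. Leaving A1 and A2 open covers past and future at once.\<close>

lemma cond_exp_prod_comp_measure:
  assumes A: "A1 \<in> sets borel" "A2 \<in> sets borel" "A1 \<inter> A2 = {}"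
    and F: "subalgebra M (sigma_field M N A1)" "subalgebra M (sigma_field M N A2)"
    and ind: "indep_set (sets (sigma_field M N A1)) (sets (sigma_field M N A2))"
    and split: "\<And>B. B \<in> sets borel \<Longrightarrow> B \<subseteq> {0..1} \<Longrightarrow>
      AE \<omega> in M. comp_measure N B \<omega> = comp_measure N (B \<inter> A1) \<omega> + comp_measure N (B \<inter> A2) \<omega>"
    and S: "finite S" and B: "\<And>j. j \<in> S \<Longrightarrow> B j \<in> sets borel \<and> B j \<subseteq> {0..1}" "disjoint_family_on B S"
  shows "AE \<omega> in M. real_cond_exp M (sigma_field M N A1) (\<lambda>\<omega>. \<Prod>j\<in>S. comp_measure N (B j) \<omega>) \<omega> =
    (\<Prod>j\<in>S. comp_measure N (B j \<inter> A1) \<omega>)"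
proof -
  interpret sigma_finite_subalgebra M "sigma_field M N A1"
    by (rule finite_measure_subalgebra_is_sigma_finite) (unfold_locales, rule F)
  define Y where "Y A R \<omega> = (\<Prod>j\<in>R. comp_measure N (B j \<inter> A) \<omega>)" for A R \<omega>
  have Y_L2: "Y A R \<in> L2 M" and Y_mean: "(\<integral>\<omega>. Y A R \<omega> \<partial>M) = (if R = {} then 1 else 0)"
    if "R \<subseteq> S" "A \<in> sets borel" for A R
  proof -
    have *: "finite R" "\<And>j. j \<in> R \<Longrightarrow> B j \<inter> A \<in> sets borel \<and> B j \<inter> A \<subseteq> {0..1}"
      using that S B(1) finite_subset by blast+
    have "disjoint_family_on (\<lambda>j. B j \<inter> A) R"
      using B(2) that(1) unfolding disjoint_family_on_def by blast
    note * = * this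
    show "Y A R \<in> L2 M" "(\<integral>\<omega>. Y A R \<omega> \<partial>M) = (if R = {} then 1 else 0)"
      unfolding Y_def using prod_comp_measure[OF *] by simp_all
  qed
  have Y_meas: "Y A R \<in> borel_measurable (sigma_field M N A)" if "R \<subseteq> S" "A \<in> sets borel" for A R
    unfolding Y_def
    by (intro borel_measurable_prod comp_measure_in_sigma_field that(2)) (use that(1) B in auto)
  let ?P = "\<lambda>\<omega>. \<Prod>j\<in>S. comp_measure N (B j) \<omega>"
  have P: "integrable M ?P" by (rule L2_imp_integrable[OF prod_comp_measure(1)[OF S B]])
  have split_S: "AE \<omega> in M. ?P \<omega> = (\<Sum>R\<in>Pow S. Y A1 R \<omega> * Y A2 (S - R) \<omega>)"
  proof -
    have "AE \<omega> in M. \<forall>j\<in>S. comp_measure N (B j) \<omega> = comp_measure N (B j \<inter> A1) \<omega> + comp_measure N (B j \<inter> A2) \<omega>"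
      by (rule AE_finite_allI[OF S]) (use split B in blast)
    then show ?thesis
      by eventually_elim (simp add: Y_def prod_add[OF S] cong: prod.cong)
  qed
  show ?thesis
    unfolding Y_def[symmetric]
  proof (rule real_cond_exp_charact[OF _ P])
    show "integrable M (Y A1 S)" by (rule L2_imp_integrable[OF Y_L2[OF order_refl A(1)]])
    show "Y A1 S \<in> borel_measurable (sigma_field M N A1)" by (rule Y_meas[OF order_refl A(1)])
    fix E assume E: "E \<in> sets (sigma_field M N A1)"
    then have EM: "E \<in> sets M" using F(1) by (auto simp: subalgebra_def)
    have EY_m: "(\<lambda>\<omega>. indicator E \<omega> * Y A1 R \<omega>) \<in> borel_measurable (sigma_field M N A1)" if "R \<subseteq> S" for R
      by (intro borel_measurable_times borel_measurable_indicator E Y_meas that A)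
    have EY_L2: "(\<lambda>\<omega>. indicator E \<omega> * Y A1 R \<omega>) \<in> L2 M" if "R \<subseteq> S" for R
      by (rule L2_bound[OF Y_L2[OF that A(1)] measurable_from_subalg[OF F(1) EY_m[OF that]]])
         (auto simp: indicator_def)
    \<comment> \<open>The indicator of E joins the A1 factor, which is independent of the A2 factor;
      the latter has mean 0 unless S - R is empty.\<close>
    have int_mult: "(\<integral>\<omega>. (indicator E \<omega> * Y A1 R \<omega>) * Y A2 (S - R) \<omega> \<partial>M) =
        (if R = S then \<integral>\<omega>. indicator E \<omega> * Y A1 S \<omega> \<partial>M else 0)" if R: "R \<subseteq> S" for R
    proof -
      have "(\<integral>\<omega>. (indicator E \<omega> * Y A1 R \<omega>) * Y A2 (S - R) \<omega> \<partial>M) =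
          (\<integral>\<omega>. indicator E \<omega> * Y A1 R \<omega> \<partial>M) * (\<integral>\<omega>. Y A2 (S - R) \<omega> \<partial>M)"
        by (rule indep_expectation_mult[OF ind F EY_m[OF R] Y_meas[OF Diff_subset A(2)]
              L2_imp_integrable[OF EY_L2[OF R]] L2_imp_integrable[OF Y_L2[OF Diff_subset A(2)]]])
      also have "(\<integral>\<omega>. Y A2 (S - R) \<omega> \<partial>M) = (if R = S then 1 else 0)"
        using R by (subst Y_mean[OF Diff_subset A(2)]) auto
      finally show ?thesis by simp
    qed
    have "(\<integral>\<omega>\<in>E. ?P \<omega> \<partial>M) = (\<integral>\<omega>. (\<Sum>R\<in>Pow S. (indicator E \<omega> * Y A1 R \<omega>) * Y A2 (S - R) \<omega>) \<partial>M)"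
      unfolding set_lebesgue_integral_def
    proof (rule integral_cong_AE)
      show "AE \<omega> in M. indicator E \<omega> *\<^sub>R ?P \<omega> = (\<Sum>R\<in>Pow S. (indicator E \<omega> * Y A1 R \<omega>) * Y A2 (S - R) \<omega>)"
        using split_S by eventually_elim (simp add: sum_distrib_left mult.assoc)
      show "(\<lambda>\<omega>. indicator E \<omega> *\<^sub>R ?P \<omega>) \<in> borel_measurable M"
        using EM P by measurable
      show "(\<lambda>\<omega>. \<Sum>R\<in>Pow S. (indicator E \<omega> * Y A1 R \<omega>) * Y A2 (S - R) \<omega>) \<in> borel_measurable M"
        by (intro borel_measurable_sum borel_measurable_times[of "\<lambda>\<omega>. _ \<omega> * _ \<omega>"] L2D[OF EY_L2] L2D[OF Y_L2[OF _ A(2)]]) auto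
    qed
    also have "\<dots> = (\<Sum>R\<in>Pow S. \<integral>\<omega>. (indicator E \<omega> * Y A1 R \<omega>) * Y A2 (S - R) \<omega> \<partial>M)"
      by (rule Bochner_Integration.integral_sum) (intro L2_mult_integrable EY_L2 Y_L2 A; auto)
    also have "\<dots> = (\<Sum>R\<in>Pow S. if R = S then \<integral>\<omega>. indicator E \<omega> * Y A1 S \<omega> \<partial>M else 0)"
      by (rule sum.cong[OF refl]) (rule int_mult, simp)
    also have "\<dots> = (\<integral>\<omega>\<in>E. Y A1 S \<omega> \<partial>M)"
      using S by (simp add: set_lebesgue_integral_def)
    finally show "(\<integral>\<omega>\<in>E. ?P \<omega> \<partial>M) = (\<integral>\<omega>\<in>E. Y A1 S \<omega> \<partial>M)" .
  qed
qed

lemma cond_exp_past: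
  assumes t: "0 \<le> t" "t \<le> 1"
    and S: "finite S" and B: "\<And>j. j \<in> S \<Longrightarrow> B j \<in> sets borel \<and> B j \<subseteq> {0..1}" "disjoint_family_on B S"
  shows "AE \<omega> in M. real_cond_exp M (sigma_field M N {0..t}) (\<lambda>\<omega>. \<Prod>j\<in>S. comp_measure N (B j) \<omega>) \<omega> =
    (\<Prod>j\<in>S. comp_measure N (B j \<inter> {0..t}) \<omega>)"
  by (rule cond_exp_prod_comp_measure[where ?A2.0 = "{t<..1}", OF _ _ _ subalgebra_sigma_field[OF t]
        indep_sigma_field[OF t] AE_comp_measure_split[OF _ _ t] S B]) auto

lemma cond_exp_future:
  assumes t: "0 \<le> t" "t \<le> 1"
    and S: "finite S" and B: "\<And>j. j \<in> S \<Longrightarrow> B j \<in> sets borel \<and> B j \<subseteq> {0..1}" "disjoint_family_on B S"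
  shows "AE \<omega> in M. real_cond_exp M (sigma_field M N ({0..1} - {0..t})) (\<lambda>\<omega>. \<Prod>j\<in>S. comp_measure N (B j) \<omega>) \<omega> =
    (\<Prod>j\<in>S. comp_measure N (B j \<inter> {t<..1}) \<omega>)"
proof -
  have eq: "{0..1} - {0..t} = {t<..1}" using t by auto
  have "AE \<omega> in M. comp_measure N B \<omega> = comp_measure N (B \<inter> {t<..1}) \<omega> + comp_measure N (B \<inter> {0..t}) \<omega>"
    if "B \<in> sets borel" "B \<subseteq> {0..1}" for B
    using AE_comp_measure_split[OF that t] by (simp add: add.commute)
  then show ?thesis
    unfolding eq
    by (intro cond_exp_prod_comp_measure[where ?A2.0 = "{0..t}", OF _ _ _ subalgebra_sigma_field(2,1)[OF t]
          indep_set_commute[OF indep_sigma_field[OF t]] _ S B]) auto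
qed

end

section \<open>Approximation by processes in BF\<close>

context standard_poisson_space
begin

text \<open>Time is replaced by a multiple of 1/(k+1) strictly to its right, which takes countably
  many values; right-continuity recovers the path in the limit.\<close>

lemma path_jointly_measurable:
  "(\<lambda>z. path (fst z) (snd z)) \<in> borel_measurable (borel \<Otimes>\<^sub>M M)"
proof (rule borel_measurable_LIMSEQ_real)
  let ?q = "\<lambda>k t. (real_of_int \<lfloor>real (Suc k) * t\<rfloor> + 1) / real (Suc k)"
  fix k
  show "(\<lambda>z. path (?q k (fst z)) (snd z)) \<in> borel_measurable (borel \<Otimes>\<^sub>M M)"
  proof (rule measurable_compose_countable[where f = "\<lambda>i z. path ((real_of_int i + 1) / real (Suc k)) (snd z)"
        and g = "\<lambda>z. \<lfloor>real (Suc k) * fst z\<rfloor>"])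
    show "(\<lambda>z. path ((real_of_int i + 1) / real (Suc k)) (snd z)) \<in> borel_measurable (borel \<Otimes>\<^sub>M M)" for i
      by (rule measurable_compose[OF measurable_snd path_measurable])
    show "(\<lambda>z. \<lfloor>real (Suc k) * fst z\<rfloor>) \<in> measurable (borel \<Otimes>\<^sub>M M) (count_space UNIV)"
      by measurable
  qed
next
  let ?q = "\<lambda>k t. (real_of_int \<lfloor>real (Suc k) * t\<rfloor> + 1) / real (Suc k)"
  fix z :: "real \<times> 'a"
  have ge: "fst z < ?q k (fst z)" and le: "?q k (fst z) \<le> fst z + 1 / real (Suc k)" for k
  proof -
    have f: "real (Suc k) * fst z < real_of_int \<lfloor>real (Suc k) * fst z\<rfloor> + 1"
      "real_of_int \<lfloor>real (Suc k) * fst z\<rfloor> \<le> real (Suc k) * fst z" by linarith+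
    then show "fst z < ?q k (fst z)"
      by (subst pos_less_divide_eq) (simp_all add: mult.commute)
    have "?q k (fst z) \<le> (real (Suc k) * fst z + 1) / real (Suc k)"
      using f(2) by (intro divide_right_mono) simp_all
    also have "\<dots> = fst z + 1 / real (Suc k)" by (simp add: add_divide_distrib)
    finally show "?q k (fst z) \<le> fst z + 1 / real (Suc k)" .
  qed
  have lim: "(\<lambda>k. ?q k (fst z)) \<longlonglongrightarrow> fst z"
  proof (rule tendsto_sandwich[OF _ _ tendsto_const])
    show "(\<lambda>k. fst z + 1 / real (Suc k)) \<longlonglongrightarrow> fst z"
      using tendsto_add[OF tendsto_const[of "fst z"] lim_1_over_n[THEN LIMSEQ_Suc]] by simp
  qed (use ge le less_imp_le in \<open>blast intro: always_eventually\<close>)+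
  have "continuous (at (fst z) within {fst z..}) (\<lambda>s. path s (snd z))"
    using path_right_cont[of "fst z" "snd z"] by (simp add: at_within_Ici_at_right)
  then have "\<forall>x. (\<forall>n. x n \<in> {fst z..}) \<and> x \<longlonglongrightarrow> fst z \<longrightarrow>
      ((\<lambda>s. path s (snd z)) \<circ> x) \<longlonglongrightarrow> path (fst z) (snd z)"
    unfolding continuous_within_sequentially .
  from this[rule_format, of "\<lambda>k. ?q k (fst z)"] show "(\<lambda>k. path (?q k (fst z)) (snd z)) \<longlonglongrightarrow> path (fst z) (snd z)"
    using lim less_imp_le[OF ge] by (simp add: comp_def)
qed

text \<open>A version of \<open>comp_measure N B\<close> that is jointly measurable once \<open>B\<close> is cut at time \<open>t\<close>.\<close>

definition cm :: "real set \<Rightarrow> 'a \<Rightarrow> real" where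
  "cm B \<omega> = measure (nu \<omega>) B - measure lborel B"

lemma AE_cm: "AE \<omega> in M. \<forall>B. comp_measure N B \<omega> = cm B \<omega>"
  using AE_good by eventually_elim (simp add: comp_measure_good cm_def)

text \<open>For half-lines the random mass is \<open>path\<close> at the smaller of a and the
  current time, so joint measurability of \<open>path\<close> applies; the Lebesgue part is monotone
  in time.\<close>

lemma cm_jointly_measurable:
  assumes B: "B \<in> sets borel" "B \<subseteq> {0..1}"
  shows "(\<lambda>z. cm (B \<inter> {0..fst z}) (snd z)) \<in> borel_measurable (TT \<Otimes>\<^sub>M M)"
proof -
  have fst_TT: "fst \<in> borel_measurable (TT \<Otimes>\<^sub>M M)"
    by (rule measurable_compose[OF measurable_fst measurable_id_TT])
  have "(\<lambda>z. measure (nu (snd z)) (B \<inter> {0..fst z})) \<in> borel_measurable (TT \<Otimes>\<^sub>M M)"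
  proof (rule measurable_kernel[OF finite_measure_nu sets_nu _ _ B(1)])
    fix a
    have "(\<lambda>z. (min a (fst z), snd z)) \<in> measurable (TT \<Otimes>\<^sub>M M) (borel \<Otimes>\<^sub>M M)"
      by (intro measurable_Pair borel_measurable_min borel_measurable_const fst_TT measurable_snd)
    from measurable_compose[OF this path_jointly_measurable]
    have "(\<lambda>z. path (min a (fst z)) (snd z)) \<in> borel_measurable (TT \<Otimes>\<^sub>M M)" by simp
    moreover have "measure (nu (snd z)) ({..a} \<inter> {0..fst z}) = path (min a (fst z)) (snd z)" for z
      using measure_nu_left[of "fst z" "snd z" a] path_nonpos[of "min a (fst z)" "snd z"]
      by (cases "0 \<le> fst z") simp_all
    ultimately show "(\<lambda>z. measure (nu (snd z)) ({..a} \<inter> {0..fst z})) \<in> borel_measurable (TT \<Otimes>\<^sub>M M)"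
      by simp
  qed simp
  moreover have "(\<lambda>z. measure lborel (B \<inter> {0..fst z})) \<in> borel_measurable (TT \<Otimes>\<^sub>M M)"
  proof (rule measurable_compose[OF fst_TT], rule borel_measurable_mono, rule monoI)
    fix s t :: real assume "s \<le> t"
    then show "measure lborel (B \<inter> {0..s}) \<le> measure lborel (B \<inter> {0..t})"
      using B by (intro measure_mono_fmeasurable fmeasurable_unit) auto
  qed
  ultimately show ?thesis unfolding cm_def by (rule borel_measurable_diff)
qed

lemma cm_measurable:
  assumes B: "B \<in> sets borel" "B \<subseteq> {0..1}"
  shows "cm B \<in> borel_measurable M"
  by (rule borel_measurable_cong_AE_M[OF comp_measure_measurable[OF B]])
     (use AE_cm in \<open>eventually_elim, simp\<close>)

text \<open>Admits any finite index set for the linear combination: subsets of the sides of a box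
  and disjoint unions are the index sets used below.\<close>

lemma BF_I:
  assumes "case_prod Z \<in> borel_measurable (TT \<Otimes>\<^sub>M M)" and J: "finite J"
    and H: "\<And>j. j \<in> J \<Longrightarrow> H1 j \<in> L2_zero_mean M \<and> H2 j \<in> L2 M"
    and Z: "\<And>t. t \<in> {0..1} \<Longrightarrow> AE \<omega> in M. Z t \<omega> =
      (\<Sum>j\<in>J. c j * (real_cond_exp M (sigma_field M N {0..t}) (H1 j) \<omega> *
        real_cond_exp M (sigma_field M N ({0..1} - {0..t})) (H2 j) \<omega>))"
  shows "Z \<in> BF M N"
proof -
  obtain h where h: "bij_betw h {..<card J} J"
    using ex_bij_betw_nat_finite[OF J] by (auto simp: atLeast0LessThan)
  have "AE \<omega> in M. Z t \<omega> =
      (\<Sum>i<card J. c (h i) * (real_cond_exp M (sigma_field M N {0..t}) (H1 (h i)) \<omega> *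
        real_cond_exp M (sigma_field M N ({0..1} - {0..t})) (H2 (h i)) \<omega>))" if t: "t \<in> {0..1}" for t
    using Z[OF t] by eventually_elim (simp add: sum.reindex_bij_betw[OF h, symmetric])
  moreover have "\<forall>i<card J. H1 (h i) \<in> L2_zero_mean M \<and> H2 (h i) \<in> L2 M"
    using H bij_betwE[OF h] by blast
  ultimately show ?thesis
    unfolding BF_def using assms(1)
    by (intro CollectI conjI exI[of _ "card J"] exI[of _ "\<lambda>i. c (h i)"] exI[of _ "\<lambda>i. H1 (h i)"]
      exI[of _ "\<lambda>i. H2 (h i)"] ballI) blast+
qed

lemma BF_E:
  assumes "Z \<in> BF M N"
  obtains n :: nat and c H1 H2 where "case_prod Z \<in> borel_measurable (TT \<Otimes>\<^sub>M M)"
    and "\<And>i. i \<in> {..<n} \<Longrightarrow> H1 i \<in> L2_zero_mean M \<and> H2 i \<in> L2 M"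
    and "\<And>t. t \<in> {0..1} \<Longrightarrow> AE \<omega> in M. Z t \<omega> =
      (\<Sum>i<n. c i * (real_cond_exp M (sigma_field M N {0..t}) (H1 i) \<omega> *
        real_cond_exp M (sigma_field M N ({0..1} - {0..t})) (H2 i) \<omega>))"
  using assms unfolding BF_def by blast

lemma BF_zero: "(\<lambda>t \<omega>. 0) \<in> BF M N"
  by (rule BF_I[where J = "{} :: nat set"]) simp_all

lemma BF_add_scale:
  assumes "Y \<in> BF M N" "Z \<in> BF M N"
  shows "(\<lambda>t \<omega>. Y t \<omega> + a * Z t \<omega>) \<in> BF M N"
proof -
  obtain n :: nat and c H1 H2 where Y: "case_prod Y \<in> borel_measurable (TT \<Otimes>\<^sub>M M)"
    "\<And>i. i \<in> {..<n} \<Longrightarrow> H1 i \<in> L2_zero_mean M \<and> H2 i \<in> L2 M"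
    "\<And>t. t \<in> {0..1} \<Longrightarrow> AE \<omega> in M. Y t \<omega> =
      (\<Sum>i<n. c i * (real_cond_exp M (sigma_field M N {0..t}) (H1 i) \<omega> *
        real_cond_exp M (sigma_field M N ({0..1} - {0..t})) (H2 i) \<omega>))"
    using assms(1) by (rule BF_E) blast
  obtain m :: nat and d G1 G2 where Z: "case_prod Z \<in> borel_measurable (TT \<Otimes>\<^sub>M M)"
    "\<And>i. i \<in> {..<m} \<Longrightarrow> G1 i \<in> L2_zero_mean M \<and> G2 i \<in> L2 M"
    "\<And>t. t \<in> {0..1} \<Longrightarrow> AE \<omega> in M. Z t \<omega> =
      (\<Sum>i<m. d i * (real_cond_exp M (sigma_field M N {0..t}) (G1 i) \<omega> *
        real_cond_exp M (sigma_field M N ({0..1} - {0..t})) (G2 i) \<omega>))"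
    using assms(2) by (rule BF_E) blast
  show ?thesis
  proof (rule BF_I[where J = "{..<n} <+> {..<m}" and c = "case_sum c (\<lambda>i. a * d i)"
        and ?H1.0 = "case_sum H1 G1" and ?H2.0 = "case_sum H2 G2"])
    show "case_prod (\<lambda>t \<omega>. Y t \<omega> + a * Z t \<omega>) \<in> borel_measurable (TT \<Otimes>\<^sub>M M)"
      using borel_measurable_add[OF Y(1) borel_measurable_times[OF borel_measurable_const[of a] Z(1)]]
      by (simp add: case_prod_beta')
    show "case_sum H1 G1 j \<in> L2_zero_mean M \<and> case_sum H2 G2 j \<in> L2 M" if "j \<in> {..<n} <+> {..<m}" for j
      using that Y(2) Z(2) by auto
    fix t :: real assume t: "t \<in> {0..1}"
    show "AE \<omega> in M. Y t \<omega> + a * Z t \<omega> = (\<Sum>j\<in>{..<n} <+> {..<m}. case_sum c (\<lambda>i. a * d i) j *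
        (real_cond_exp M (sigma_field M N {0..t}) (case_sum H1 G1 j) \<omega> *
         real_cond_exp M (sigma_field M N ({0..1} - {0..t})) (case_sum H2 G2 j) \<omega>))"
      using Y(3)[OF t] Z(3)[OF t]
      by eventually_elim (simp add: sum.Plus sum_distrib_left mult.assoc)
  qed simp
qed

end

context multiple_poisson_integral
begin

lemma box_process_in_BF:
  assumes B: "B \<in> disjoint_boxes (Suc n)"
  shows "\<exists>Z\<in>BF M N. \<forall>t\<in>{0..1}. AE \<omega> in M.
    Z t \<omega> = skor n {0..t} (\<lambda>x. \<Prod>i<Suc n. indicator (B i) (x i)) \<omega>"
proof (intro bexI ballI)
  have Bs: "\<And>i. i < Suc n \<Longrightarrow> B i \<in> sets borel \<and> B i \<subseteq> {0..1}"
    and disj: "disjoint_family_on B {..<Suc n}"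
    using B unfolding disjoint_boxes_def by blast+
  \<comment> \<open>Built from \<open>cm\<close> and not from \<open>comp_measure\<close>, so that
    joint measurability in time and omega is available; the two agree almost surely.\<close>
  define Z where "Z t \<omega> = (\<Prod>i<n. cm (B i) \<omega>) * cm (B n \<inter> {0..t}) \<omega>" for t \<omega>
  have Z_eq: "AE \<omega> in M. Z t \<omega> = (\<Prod>i<n. comp_measure N (B i) \<omega>) * comp_measure N (B n \<inter> {0..t}) \<omega>" for t
    using AE_cm by eventually_elim (simp add: Z_def)
  show "AE \<omega> in M. Z t \<omega> = skor n {0..t} (\<lambda>x. \<Prod>i<Suc n. indicator (B i) (x i)) \<omega>"
    if t: "t \<in> {0..1}" for t
  proof -
    \<comment> \<open>Cutting the last side at t keeps the sides disjoint, so
      \<open>products\<close> evaluates the integral of the cut kernel as well.\<close>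
    let ?B = "B(n := B n \<inter> {0..t})"
    have "AE \<omega> in M. I (Suc n) (symmetrization (Suc n) (\<lambda>x. \<Prod>i<Suc n. indicator (?B i) (x i))) \<omega>
        = (\<Prod>i<Suc n. comp_measure N (?B i) \<omega>)"
    proof (rule products)
      show "?B i \<in> sets borel \<and> ?B i \<subseteq> {0..1}" if "i < Suc n" for i
        using Bs[OF that] by auto
      have "?B i \<subseteq> B i" for i by auto
      then show "disjoint_family_on ?B {..<Suc n}"
        using disj unfolding disjoint_family_on_def by blast
    qed
    moreover have "(\<lambda>x. \<Prod>i<Suc n. indicator (?B i) (x i)) =
        cut n {0..t} (\<lambda>x. \<Prod>i<Suc n. indicator (B i) (x i))"
      by (simp add: cut_def fun_eq_iff indicator_inter_arith mult.assoc)
    ultimately have "AE \<omega> in M. skor n {0..t} (\<lambda>x. \<Prod>i<Suc n. indicator (B i) (x i)) \<omega>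
        = (\<Prod>i<Suc n. comp_measure N (?B i) \<omega>)"
      by (simp only: skor_def)
    then show ?thesis using Z_eq[of t] by eventually_elim simp
  qed
  \<comment> \<open>R collects the sides among the first n that are placed in the past. The masses
    here are uncut and independent of the choice of t; the conditional expectations cut them to
    [0,t] and (t,1]. Since n always belongs to the first product, that product is nonempty and has
    mean zero.\<close>
  let ?H1 = "\<lambda>R \<omega>. \<Prod>j\<in>insert n R. comp_measure N (B j) \<omega>"
  let ?H2 = "\<lambda>R \<omega>. \<Prod>j\<in>{..<n} - R. comp_measure N (B j) \<omega>"
  have sub: "finite S" "\<And>j. j \<in> S \<Longrightarrow> B j \<in> sets borel \<and> B j \<subseteq> {0..1}" "disjoint_family_on B S"
    if "S \<subseteq> {..<Suc n}" for S
    using that Bs disj disjoint_family_on_mono finite_subset by blast+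
  have R1: "insert n R \<subseteq> {..<Suc n}" and R2: "{..<n} - R \<subseteq> {..<Suc n}" if "R \<in> Pow {..<n}" for R
    using that by auto
  show "Z \<in> BF M N"
  proof (rule BF_I[where J = "Pow {..<n}" and c = "\<lambda>_. 1" and ?H1.0 = ?H1 and ?H2.0 = ?H2])
    have "(\<lambda>z. cm (B i) (snd z)) \<in> borel_measurable (TT \<Otimes>\<^sub>M M)" if "i < n" for i
      using Bs[of i] that by (intro measurable_compose[OF measurable_snd cm_measurable]) auto
    then have "(\<lambda>z. (\<Prod>i<n. cm (B i) (snd z)) * cm (B n \<inter> {0..fst z}) (snd z)) \<in> borel_measurable (TT \<Otimes>\<^sub>M M)"
      using Bs[of n] by (intro borel_measurable_times borel_measurable_prod cm_jointly_measurable) auto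
    then show "case_prod Z \<in> borel_measurable (TT \<Otimes>\<^sub>M M)"
      by (simp add: case_prod_beta' Z_def)
    show "?H1 R \<in> L2_zero_mean M \<and> ?H2 R \<in> L2 M" if R: "R \<in> Pow {..<n}" for R
      using prod_comp_measure[OF sub[OF R1[OF R]]] prod_comp_measure(1)[OF sub[OF R2[OF R]]]
      by (simp add: L2_zero_mean_def)
    fix t :: real assume "t \<in> {0..1}"
    then have t: "0 \<le> t" "t \<le> 1" by auto
    have "AE \<omega> in M. \<forall>R\<in>Pow {..<n}.
        real_cond_exp M (sigma_field M N {0..t}) (?H1 R) \<omega> = (\<Prod>j\<in>insert n R. comp_measure N (B j \<inter> {0..t}) \<omega>) \<and>
        real_cond_exp M (sigma_field M N ({0..1} - {0..t})) (?H2 R) \<omega> = (\<Prod>j\<in>{..<n} - R. comp_measure N (B j \<inter> {t<..1}) \<omega>)"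
    proof (rule AE_finite_allI)
      fix R assume R: "R \<in> Pow {..<n}"
      note s1 = sub[OF R1[OF R]] and s2 = sub[OF R2[OF R]]
      have "AE \<omega> in M. real_cond_exp M (sigma_field M N {0..t}) (?H1 R) \<omega> =
          (\<Prod>j\<in>insert n R. comp_measure N (B j \<inter> {0..t}) \<omega>)"
        by (rule cond_exp_past[OF t s1(1) _ s1(3)]) (rule s1(2))
      moreover have "AE \<omega> in M. real_cond_exp M (sigma_field M N ({0..1} - {0..t})) (?H2 R) \<omega> =
          (\<Prod>j\<in>{..<n} - R. comp_measure N (B j \<inter> {t<..1}) \<omega>)"
        by (rule cond_exp_future[OF t s2(1) _ s2(3)]) (rule s2(2))
      ultimately show "AE \<omega> in M. real_cond_exp M (sigma_field M N {0..t}) (?H1 R) \<omega> = (\<Prod>j\<in>insert n R. comp_measure N (B j \<inter> {0..t}) \<omega>) \<and>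
          real_cond_exp M (sigma_field M N ({0..1} - {0..t})) (?H2 R) \<omega> = (\<Prod>j\<in>{..<n} - R. comp_measure N (B j \<inter> {t<..1}) \<omega>)"
        by eventually_elim blast
    qed simp
    moreover have "AE \<omega> in M. \<forall>j\<in>{..<n}. comp_measure N (B j) \<omega> =
        comp_measure N (B j \<inter> {0..t}) \<omega> + comp_measure N (B j \<inter> {t<..1}) \<omega>"
    proof (rule AE_finite_allI)
      fix j assume "j \<in> {..<n}"
      then show "AE \<omega> in M. comp_measure N (B j) \<omega> =
          comp_measure N (B j \<inter> {0..t}) \<omega> + comp_measure N (B j \<inter> {t<..1}) \<omega>"
        using Bs[of j] by (intro AE_comp_measure_split t) auto
    qed simp
    ultimately show "AE \<omega> in M. Z t \<omega> = (\<Sum>R\<in>Pow {..<n}. 1 *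
        (real_cond_exp M (sigma_field M N {0..t}) (?H1 R) \<omega> *
         real_cond_exp M (sigma_field M N ({0..1} - {0..t})) (?H2 R) \<omega>))"
      using Z_eq[of t]
    proof eventually_elim
      fix \<omega>
      let ?a = "\<lambda>j. comp_measure N (B j \<inter> {0..t}) \<omega>" and ?b = "\<lambda>j. comp_measure N (B j \<inter> {t<..1}) \<omega>"
      assume ce: "\<forall>R\<in>Pow {..<n}. real_cond_exp M (sigma_field M N {0..t}) (?H1 R) \<omega> = (\<Prod>j\<in>insert n R. ?a j) \<and>
          real_cond_exp M (sigma_field M N ({0..1} - {0..t})) (?H2 R) \<omega> = (\<Prod>j\<in>{..<n} - R. ?b j)"
        and sp: "\<forall>j\<in>{..<n}. comp_measure N (B j) \<omega> = ?a j + ?b j"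
        and Z: "Z t \<omega> = (\<Prod>i<n. comp_measure N (B i) \<omega>) * ?a n"
      have "Z t \<omega> = (\<Prod>i<n. ?a i + ?b i) * ?a n"
        unfolding Z using sp by simp
      also have "\<dots> = (\<Sum>R\<in>Pow {..<n}. (\<Prod>j\<in>R. ?a j) * (\<Prod>j\<in>{..<n} - R. ?b j) * ?a n)"
        by (simp add: prod_add sum_distrib_right)
      also have "\<dots> = (\<Sum>R\<in>Pow {..<n}. 1 * (real_cond_exp M (sigma_field M N {0..t}) (?H1 R) \<omega> *
         real_cond_exp M (sigma_field M N ({0..1} - {0..t})) (?H2 R) \<omega>))"
      proof (rule sum.cong[OF refl])
        fix R assume R: "R \<in> Pow {..<n}"
        then have "finite R" "n \<notin> R" using finite_subset by auto
        then have "(\<Prod>j\<in>insert n R. ?a j) = ?a n * (\<Prod>j\<in>R. ?a j)" by simp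
        then show "(\<Prod>j\<in>R. ?a j) * (\<Prod>j\<in>{..<n} - R. ?b j) * ?a n =
          1 * (real_cond_exp M (sigma_field M N {0..t}) (?H1 R) \<omega> *
            real_cond_exp M (sigma_field M N ({0..1} - {0..t})) (?H2 R) \<omega>)"
          using bspec[OF ce R] by simp
      qed
      finally show "Z t \<omega> = (\<Sum>R\<in>Pow {..<n}. 1 * (real_cond_exp M (sigma_field M N {0..t}) (?H1 R) \<omega> *
         real_cond_exp M (sigma_field M N ({0..1} - {0..t})) (?H2 R) \<omega>))" .
    qed
  qed simp
qed

lemma box_span_process_in_BF:
  assumes "f \<in> box_span (Suc n)"
  shows "\<exists>Z\<in>BF M N. \<forall>t\<in>{0..1}. AE \<omega> in M. Z t \<omega> = skor n {0..t} f \<omega>"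
  using assms
proof (induction rule: box_span.induct)
  case zero
  show ?case
    by (rule bexI[OF _ BF_zero]) (use skor_zero in \<open>auto simp: eq_commute[of 0]\<close>)
next
  case (add f B c)
  let ?g = "\<lambda>x. \<Prod>i<Suc n. indicator (B i) (x i) :: real"
  obtain Y where Y: "Y \<in> BF M N" "\<And>t. t \<in> {0..1} \<Longrightarrow> AE \<omega> in M. Y t \<omega> = skor n {0..t} f \<omega>"
    using add.IH by blast
  obtain Z where Z: "Z \<in> BF M N" "\<And>t. t \<in> {0..1} \<Longrightarrow> AE \<omega> in M. Z t \<omega> = skor n {0..t} ?g \<omega>"
    using box_process_in_BF[OF add.hyps(2)] by blast
  have g: "?g \<in> L2 (Tn (Suc n))" by (rule box_span_L2[OF box_in_box_span[OF add.hyps(2)]])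
  show ?case
  proof (intro bexI[OF _ BF_add_scale[OF Y(1) Z(1), of c]] ballI)
    fix t :: real assume t: "t \<in> {0..1}"
    have "AE \<omega> in M. skor n {0..t} (\<lambda>x. f x + c * ?g x) \<omega> = skor n {0..t} f \<omega> + c * skor n {0..t} ?g \<omega>"
      by (rule skor_add[OF box_span_L2[OF add.hyps(1)] g]) simp
    then show "AE \<omega> in M. Y t \<omega> + c * Z t \<omega> = skor n {0..t} (\<lambda>x. f x + c * ?g x) \<omega>"
      using Y(2)[OF t] Z(2)[OF t] by eventually_elim simp
  qed
qed

text \<open>With finitely many nonzero kernels the Skorohod series is stationary from K on, so a
  process equal almost surely at each time to the K-th partial sum is its L^2 limit.\<close>

lemma finite_skor_process_in_BF:
  assumes g: "\<And>n. g n \<in> box_span (Suc n)" and z: "\<And>n. K \<le> n \<Longrightarrow> g n = (\<lambda>_. 0)"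
  shows "\<exists>Z\<in>BF M N. skor_process g Z"
proof -
  have "\<exists>Z\<in>BF M N. \<forall>t\<in>{0..1}. AE \<omega> in M. Z t \<omega> = (\<Sum>n<k. skor n {0..t} (g n) \<omega>)" for k
  proof (induction k)
    case 0
    show ?case by (rule bexI[OF _ BF_zero]) simp
  next
    case (Suc k)
    then obtain Y where Y: "Y \<in> BF M N"
      "\<And>t. t \<in> {0..1} \<Longrightarrow> AE \<omega> in M. Y t \<omega> = (\<Sum>n<k. skor n {0..t} (g n) \<omega>)" by blast
    obtain Z where Z: "Z \<in> BF M N" "\<And>t. t \<in> {0..1} \<Longrightarrow> AE \<omega> in M. Z t \<omega> = skor k {0..t} (g k) \<omega>"
      using box_span_process_in_BF[OF g] by blast
    show ?case
    proof (intro bexI[OF _ BF_add_scale[OF Y(1) Z(1), of 1]] ballI)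
      fix t :: real assume t: "t \<in> {0..1}"
      show "AE \<omega> in M. Y t \<omega> + 1 * Z t \<omega> = (\<Sum>n<Suc k. skor n {0..t} (g n) \<omega>)"
        using Y(2)[OF t] Z(2)[OF t] by eventually_elim simp
    qed
  qed
  then obtain Z where Z: "Z \<in> BF M N"
    "\<And>t. t \<in> {0..1} \<Longrightarrow> AE \<omega> in M. Z t \<omega> = (\<Sum>n<K. skor n {0..t} (g n) \<omega>)" by blast
  have gL: "g n \<in> L2 (Tn (Suc n))" for n by (rule box_span_L2[OF g])
  have "skor_process g Z"
    unfolding skor_process_def
  proof (intro conjI allI ballI gL)
    fix t :: real assume t: "t \<in> {0..1}"
    let ?S = "\<lambda>m \<omega>. \<Sum>n<m. skor n {0..t} (g n) \<omega>"
    have SL: "?S m \<in> L2 M" for m by (intro L2_sum skor_L2 gL) simp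
    have "case_prod Z \<in> borel_measurable (TT \<Otimes>\<^sub>M M)" using Z(1) by (simp add: BF_def)
    from measurable_compose[OF measurable_Pair1' this, of t] have Zm: "Z t \<in> borel_measurable M"
      using t by simp
    have ZL: "Z t \<in> L2 M" by (rule L2_cong_AE[OF SL Zm Z(2)[OF t]])
    have zero: "AE \<omega> in M. \<forall>n. K \<le> n \<longrightarrow> skor n {0..t} (g n) \<omega> = 0"
      unfolding AE_all_countable
    proof
      fix n show "AE \<omega> in M. K \<le> n \<longrightarrow> skor n {0..t} (g n) \<omega> = 0"
        using skor_zero[of n "{0..t}"] z[of n] by (cases "K \<le> n") simp_all
    qed
    have "nsq M (\<lambda>\<omega>. ?S m \<omega> - Z t \<omega>) = 0" if "K \<le> m" for m
      unfolding nsq_zero_iff[OF L2_diff[OF SL ZL]]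
      using zero Z(2)[OF t]
    proof eventually_elim
      fix \<omega> assume 0: "\<forall>n. K \<le> n \<longrightarrow> skor n {0..t} (g n) \<omega> = 0" and Z: "Z t \<omega> = ?S K \<omega>"
      have "?S m \<omega> = ?S K \<omega>" by (rule sum.mono_neutral_right) (use 0 that in auto)
      then show "?S m \<omega> - Z t \<omega> = 0" using Z by simp
    qed
    then have "(\<lambda>m. nsq M (\<lambda>\<omega>. ?S m \<omega> - Z t \<omega>)) \<longlonglongrightarrow> 0"
      by (intro tendsto_eventually eventually_sequentiallyI[of K])
    then show "L2_tendsto M ?S (Z t)" using SL ZL by (simp add: L2_tendsto_def)
  qed
  with Z(1) show ?thesis by blast
qed

lemma BF_approximation:
  assumes f: "skor_process f X" and sm: "summable (\<lambda>n. fact (Suc n) * nsq (Tn (Suc n)) (f n))"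
    and e: "e > 0"
  shows "\<exists>Z\<in>BF M N. V M (\<lambda>t \<omega>. X t \<omega> - Z t \<omega>) \<le> ennreal e"
proof -
  let ?c = "\<lambda>n. fact (Suc n) * nsq (Tn (Suc n)) (f n)"
  \<comment> \<open>Degrees from K on are replaced by zero kernels at a cost of at most e/2; the
    other e/2 is left for the first K kernels.\<close>
  obtain K where K: "norm (\<Sum>i. ?c (i + K)) < e / 2"
    using suminf_exist_split[of "e / 2" ?c] e sm by auto
  \<comment> \<open>An equal share of e/2 for each of the K kernels, already weighted by the
    factorial; dividing by \<open>Suc K\<close> also covers K = 0.\<close>
  have "\<exists>g\<in>box_span (Suc n). fact (Suc n) * nsq (Tn (Suc n)) (\<lambda>x. f n x - g x) \<le> e / 2 / real (Suc K)" for n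
  proof -
    have "f n \<in> box_closure (Suc n)" using skor_processD(1)[OF f] by (simp add: box_span_dense)
    moreover have "e / 2 / real (Suc K) / fact (Suc n) > 0" using e by simp
    ultimately obtain g where g: "g \<in> box_span (Suc n)"
      "nsq (Tn (Suc n)) (\<lambda>x. f n x - g x) < e / 2 / real (Suc K) / fact (Suc n)"
      unfolding box_closure_def by blast
    have "fact (Suc n) * nsq (Tn (Suc n)) (\<lambda>x. f n x - g x) \<le> fact (Suc n) * (e / 2 / real (Suc K) / fact (Suc n))"
      using g(2) by (intro mult_left_mono) simp_all
    also have "\<dots> = e / 2 / real (Suc K)"
      using fact_nonzero[of "Suc n", where 'a = real] by (simp del: fact_Suc of_nat_Suc)
    finally show ?thesis using g(1) by blast
  qed
  then obtain g0 where g0: "\<And>n. g0 n \<in> box_span (Suc n)"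
    "\<And>n. fact (Suc n) * nsq (Tn (Suc n)) (\<lambda>x. f n x - g0 n x) \<le> e / 2 / real (Suc K)"
    by metis
  define g where "g n = (if n < K then g0 n else (\<lambda>_. 0))" for n
  have "g n \<in> box_span (Suc n)" for n using g0(1) by (simp add: g_def box_span.zero)
  then obtain Z where Z: "Z \<in> BF M N" "skor_process g Z"
    using finite_skor_process_in_BF[of g K] by (auto simp: g_def)
  let ?d = "\<lambda>n. fact (Suc n) * nsq (Tn (Suc n)) (\<lambda>x. f n x - g n x)"
  have d_tail: "?d n = ?c n" if "K \<le> n" for n using that by (simp add: g_def)
  have smd: "summable ?d"
  proof -
    have "\<forall>\<^sub>F n in sequentially. ?d n = ?c n" by (rule eventually_sequentiallyI[OF d_tail])
    from iffD2[OF summable_cong[OF this] sm] show ?thesis .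
  qed
  have "suminf ?d = (\<Sum>i. ?d (i + K)) + (\<Sum>i<K. ?d i)"
    by (rule suminf_split_initial_segment[OF smd])
  also have "(\<Sum>i. ?d (i + K)) = (\<Sum>i. ?c (i + K))"
    by (rule suminf_cong) (rule d_tail, simp)
  also have "\<dots> \<le> e / 2" using K by simp
  also have "(\<Sum>i<K. ?d i) \<le> (\<Sum>i<K. e / 2 / real (Suc K))"
    by (rule sum_mono) (use g0(2) in \<open>simp add: g_def del: fact_Suc of_nat_Suc\<close>)
  also have "\<dots> = real K * (e / 2 / real (Suc K))" by simp
  also have "\<dots> \<le> real (Suc K) * (e / 2 / real (Suc K))"
    using e by (intro mult_right_mono) simp_all
  also have "\<dots> = e / 2" by (simp del: of_nat_Suc)
  finally have "suminf ?d \<le> e" by simp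
  then have "V M (\<lambda>t \<omega>. X t \<omega> - Z t \<omega>) \<le> ennreal e"
    using V_skor_process_le[OF skor_process_diff[OF f Z(2)] smd] ennreal_leI order_trans by blast
  with Z(1) show ?thesis by blast
qed

end

theorem theorem1:
  fixes M :: "'a measure"
    and N :: "real \<Rightarrow> 'a \<Rightarrow> real"
    and I :: "nat \<Rightarrow> ((nat \<Rightarrow> real) \<Rightarrow> real) \<Rightarrow> 'a \<Rightarrow> real"
    and k :: nat
    and u X :: "real \<Rightarrow> 'a \<Rightarrow> real"
  assumes "multiple_poisson_integral M N I"
    and "k \<ge> 3"
    and "u \<in> Lk2 M I k"
    and "\<And>t. t \<in> {0..1} \<Longrightarrow> has_skorohod_integral M I (\<lambda>s \<omega>. u s \<omega> * indicator {0..t} s) (X t)"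
  shows "\<exists>Z :: nat \<Rightarrow> real \<Rightarrow> 'a \<Rightarrow> real.
    (\<forall>r\<ge>1. Z r \<in> BF M N) \<and>
    (\<lambda>r. V M (\<lambda>t \<omega>. X t \<omega> - Z r t \<omega>)) \<longlonglongrightarrow> 0"
proof -
  interpret multiple_poisson_integral M N I by (rule assms(1))
  have "k \<ge> 1" using assms(2) by simp
  then obtain f where f: "skor_process f X" "summable (\<lambda>n. fact (Suc n) * nsq (Tn (Suc n)) (f n))"
    using skorohod_kernels[OF _ assms(3,4)] by blast
  have "\<exists>Z\<in>BF M N. V M (\<lambda>t \<omega>. X t \<omega> - Z t \<omega>) \<le> ennreal (1 / real (Suc r))" for r
    by (rule BF_approximation[OF f]) simp
  then obtain Z where Z: "\<And>r. Z r \<in> BF M N"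
    "\<And>r. V M (\<lambda>t \<omega>. X t \<omega> - Z r t \<omega>) \<le> ennreal (1 / real (Suc r))"
    by metis
  have "(\<lambda>r. ennreal (1 / real (Suc r))) \<longlonglongrightarrow> ennreal 0"
    by (intro tendsto_ennrealI lim_1_over_n[THEN LIMSEQ_Suc])
  then have lim: "(\<lambda>r. ennreal (1 / real (Suc r))) \<longlonglongrightarrow> 0" by simp
  have "(\<lambda>r. V M (\<lambda>t \<omega>. X t \<omega> - Z r t \<omega>)) \<longlonglongrightarrow> 0"
  proof (rule tendsto_sandwich[OF _ _ tendsto_const lim])
    show "\<forall>\<^sub>F r in sequentially. 0 \<le> V M (\<lambda>t \<omega>. X t \<omega> - Z r t \<omega>)"
      by (rule always_eventually) (intro allI zero_le)
    show "\<forall>\<^sub>F r in sequentially. V M (\<lambda>t \<omega>. X t \<omega> - Z r t \<omega>) \<le> ennreal (1 / real (Suc r))"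
      by (rule always_eventually) (intro allI Z(2))
  qed
  with Z(1) show ?thesis by blast
qed

end
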